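(* Let $(M_t)_{0\le t<T}$ be a maximal solution of the $|A|^2$-flow $\frac{d}{dt}X=-|A|^2\nu$ of closed strictly convex hypersurfaces in $\mathbb{R}^{4}$, where $M_0$ is $3$-pinched. Let $$\psi_{|A|^2}=\frac{(a+b+c)^2\left((a-b)^2+(a-c)^2+(b-c)^2\right)}{abc},$$ where $a,b,c$ are the principal curvatures. Then $\max_{M_t}\psi_{|A|^2}$ is non-increasing in time $t\in[0,T)$.
   Context: Hypersurfaces are smooth, closed (compact, without boundary), embedded, of dimension $n=3$ in Euclidean $\mathbb{R}^4$, with outer unit normal $\nu$, induced metric $g_{ij}=\langle X_{,i},X_{,j}\rangle$, second fundamental form $h_{ij}=-\langle X_{,ij},\nu\rangle$, and principal curvatures $a=\lambda_1,\ b=\lambda_2,\ c=\lambda_3$ (the eigenvalues of $(h_{ij})$ with respect to $(g_{ij})$). Strictly convex means that all $\lambda_i>0$. $|A|^2=a^2+b^2+c^2$ is the squared norm of the second fundamental form. A solution of the flow is a smooth time-dependent family of embeddings $X(\cdot,t)$ with image $M_t$, $0\le t<T$, satisfying $\frac{d}{dt}X=-|A|^2\nu$ and starting at $M_0$; it is maximal if it cannot be extended as a smooth solution beyond time $T$. $M_0$ is $3$-pinched if $\lambda_i/\lambda_j\le 3$ everywhere on $M_0$ for all $1\le i,j\le 3$. *)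

theory Defs
  imports "HOL-Analysis.Analysis"
begin

section \<open>Smooth maps\<close>

text \<open>
  The sets \<open>S\<close> used below are open, or of the form \<open>U \<times> [0,T)\<close> with \<open>U\<close> open; on those the
  derivative within \<open>S\<close> is unique, and it is one-sided in time at \<open>t = 0\<close>.
\<close>

primrec Ck_on :: "nat \<Rightarrow> ('a::real_normed_vector \<Rightarrow> 'b::real_normed_vector) \<Rightarrow> 'a set \<Rightarrow> bool" where
  "Ck_on 0 f S \<longleftrightarrow> continuous_on S f"
| "Ck_on (Suc k) f S \<longleftrightarrow> f differentiable_on S \<and>
     (\<forall>v. Ck_on k (\<lambda>x. frechet_derivative f (at x within S) v) S)"

definition smooth_on :: "('a::real_normed_vector \<Rightarrow> 'b::real_normed_vector) \<Rightarrow> 'a set \<Rightarrow> bool" where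
  "smooth_on f S \<longleftrightarrow> (\<forall>k. Ck_on k f S)"


section \<open>Closed three-dimensional manifolds\<close>

text \<open>
  An atlas is a set of local parametrizations \<open>(U, \<phi>)\<close>, that is, of inverses of charts.
  Second countability follows from compactness.
\<close>

type_synonym 'm atlas = "((real^3) set \<times> (real^3 \<Rightarrow> 'm)) set"

definition closed_manifold :: "'m::t2_space set \<Rightarrow> 'm atlas \<Rightarrow> bool" where
  "closed_manifold M \<A> \<longleftrightarrow>
     compact M \<and> M \<noteq> {} \<and> (\<Union>(U, \<phi>)\<in>\<A>. \<phi> ` U) = M \<and>
     (\<forall>(U, \<phi>)\<in>\<A>. open U \<and> openin (top_of_set M) (\<phi> ` U) \<and> (\<exists>\<psi>. homeomorphism U (\<phi> ` U) \<phi> \<psi>)) \<and>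
     (\<forall>(U, \<phi>)\<in>\<A>. \<forall>(V, \<eta>)\<in>\<A>. smooth_on (inv_into V \<eta> \<circ> \<phi>) (U \<inter> \<phi> -` (\<eta> ` V)))"

definition smooth_embedding :: "'m::t2_space set \<Rightarrow> 'm atlas \<Rightarrow> ('m \<Rightarrow> real^4) \<Rightarrow> bool" where
  "smooth_embedding M \<A> F \<longleftrightarrow>
     (\<forall>(U, \<phi>)\<in>\<A>. smooth_on (F \<circ> \<phi>) U \<and> (\<forall>u\<in>U. inj (frechet_derivative (F \<circ> \<phi>) (at u)))) \<and>
     (\<exists>G. homeomorphism M (F ` M) F G)"


section \<open>Geometry of hypersurfaces\<close>

definition partial_deriv :: "3 \<Rightarrow> (real^3 \<Rightarrow> real^4) \<Rightarrow> real^3 \<Rightarrow> real^4" where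
  "partial_deriv i f u = frechet_derivative f (at u) (axis i 1)"

definition induced_metric :: "(real^3 \<Rightarrow> real^4) \<Rightarrow> real^3 \<Rightarrow> real^3^3" where
  "induced_metric f u = (\<chi> i j. partial_deriv i f u \<bullet> partial_deriv j f u)"

definition second_fundamental_form :: "(real^3 \<Rightarrow> real^4) \<Rightarrow> real^4 \<Rightarrow> real^3 \<Rightarrow> real^3^3" where
  "second_fundamental_form f N u = (\<chi> i j. - (partial_deriv j (partial_deriv i f) u \<bullet> N))"

text \<open>
  The constants \<open>inside\<close> and \<open>outside\<close> of the library are the unions of the bounded, respectively
  unbounded, components of the complement. Requiring both makes the outer normal unique.
\<close>

definition outer_unit_normal ::
  "'m::t2_space set \<Rightarrow> 'm atlas \<Rightarrow> ('m \<Rightarrow> real^4) \<Rightarrow> 'm \<Rightarrow> real^4 \<Rightarrow> bool" where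
  "outer_unit_normal M \<A> F x N \<longleftrightarrow>
     norm N = 1 \<and>
     (\<forall>(U, \<phi>)\<in>\<A>. \<forall>u\<in>U. \<phi> u = x \<longrightarrow> (\<forall>i. partial_deriv i (F \<circ> \<phi>) u \<bullet> N = 0)) \<and>
     (\<forall>\<^sub>F s in at_right 0. F x + s *\<^sub>R N \<in> outside (F ` M) \<and> F x - s *\<^sub>R N \<in> inside (F ` M))"

text \<open>
  The eigenvalues of \<open>h\<close> with respect to \<open>g\<close>, each listed according to its multiplicity; the order
  is not prescribed, so the entries of \<open>l\<close> are determined up to a permutation.
\<close>

definition eigenvalues_wrt :: "real^3^3 \<Rightarrow> real^3^3 \<Rightarrow> real^3 \<Rightarrow> bool" where
  "eigenvalues_wrt g h l \<longleftrightarrow>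
     (\<exists>e :: 3 \<Rightarrow> real^3. (\<forall>i j. e i \<bullet> (g *v e j) = (if i = j then 1 else 0)) \<and>
        (\<forall>i. h *v e i = l $ i *\<^sub>R (g *v e i)))"

definition principal_curvatures ::
  "'m atlas \<Rightarrow> ('m \<Rightarrow> real^4) \<Rightarrow> real^4 \<Rightarrow> 'm \<Rightarrow> real^3 \<Rightarrow> bool" where
  "principal_curvatures \<A> F N x l \<longleftrightarrow>
     (\<forall>(U, \<phi>)\<in>\<A>. \<forall>u\<in>U. \<phi> u = x \<longrightarrow>
        eigenvalues_wrt (induced_metric (F \<circ> \<phi>) u) (second_fundamental_form (F \<circ> \<phi>) N u) l)"

definition norm_A_squared :: "real^3 \<Rightarrow> real" where
  "norm_A_squared l = (l $ 1)\<^sup>2 + (l $ 2)\<^sup>2 + (l $ 3)\<^sup>2"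

definition psi_A_squared :: "real^3 \<Rightarrow> real" where
  "psi_A_squared l =
     (let a = l $ 1; b = l $ 2; c = l $ 3 in
      (a + b + c)\<^sup>2 * ((a - b)\<^sup>2 + (a - c)\<^sup>2 + (b - c)\<^sup>2) / (a * b * c))"

definition strictly_convex :: "'m set \<Rightarrow> ('m \<Rightarrow> real^3) \<Rightarrow> bool" where
  "strictly_convex M \<kappa> \<longleftrightarrow> (\<forall>x\<in>M. \<forall>i. 0 < \<kappa> x $ i)"

definition pinched :: "real \<Rightarrow> 'm set \<Rightarrow> ('m \<Rightarrow> real^3) \<Rightarrow> bool" where
  "pinched C M \<kappa> \<longleftrightarrow> (\<forall>x\<in>M. \<forall>i j. \<kappa> x $ i / \<kappa> x $ j \<le> C)"


section \<open>The flow\<close>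

text \<open>The interval \<open>[0,T)\<close>, where \<open>T = \<infinity>\<close> is allowed.\<close>

definition time_interval :: "ereal \<Rightarrow> real set" where
  "time_interval T = {t. 0 \<le> t \<and> ereal t < T}"

text \<open>
  \<open>X t\<close> is the embedding at time \<open>t\<close>, with outer unit normal \<open>\<nu> t\<close> and principal curvatures
  \<open>\<kappa> t\<close>. These are carried along as fields instead of being chosen by a description operator;
  \<open>X\<close> determines \<open>\<nu>\<close> uniquely and \<open>\<kappa>\<close> up to the order of the principal curvatures at each point,
  which does not affect the speed. No regularity of \<open>\<nu>\<close> or \<open>\<kappa>\<close> is imposed.
\<close>

definition A_squared_flow ::
  "'m::t2_space set \<Rightarrow> 'm atlas \<Rightarrow> ereal \<Rightarrow> (real \<Rightarrow> 'm \<Rightarrow> real^4) \<Rightarrow>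
   (real \<Rightarrow> 'm \<Rightarrow> real^4) \<Rightarrow> (real \<Rightarrow> 'm \<Rightarrow> real^3) \<Rightarrow> bool" where
  "A_squared_flow M \<A> T X \<nu> \<kappa> \<longleftrightarrow>
     closed_manifold M \<A> \<and> 0 < T \<and>
     (\<forall>(U, \<phi>)\<in>\<A>. smooth_on (\<lambda>(u, t). X t (\<phi> u)) (U \<times> time_interval T)) \<and>
     (\<forall>t\<in>time_interval T. smooth_embedding M \<A> (X t)) \<and>
     (\<forall>t\<in>time_interval T. \<forall>x\<in>M.
        outer_unit_normal M \<A> (X t) x (\<nu> t x) \<and>
        principal_curvatures \<A> (X t) (\<nu> t x) x (\<kappa> t x) \<and>
        ((\<lambda>s. X s x) has_vector_derivative - norm_A_squared (\<kappa> t x) *\<^sub>R \<nu> t x)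
          (at t within time_interval T))"

definition maximal_A_squared_flow ::
  "'m::t2_space set \<Rightarrow> 'm atlas \<Rightarrow> ereal \<Rightarrow> (real \<Rightarrow> 'm \<Rightarrow> real^4) \<Rightarrow>
   (real \<Rightarrow> 'm \<Rightarrow> real^4) \<Rightarrow> (real \<Rightarrow> 'm \<Rightarrow> real^3) \<Rightarrow> bool" where
  "maximal_A_squared_flow M \<A> T X \<nu> \<kappa> \<longleftrightarrow>
     A_squared_flow M \<A> T X \<nu> \<kappa> \<and>
     \<not> (\<exists>T' Y \<nu>' \<kappa>'. T < T' \<and> A_squared_flow M \<A> T' Y \<nu>' \<kappa>' \<and>
          (\<forall>t\<in>time_interval T. \<forall>x\<in>M. Y t x = X t x))"

end

theory Submission
  imports Defs
begin

text \<open>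
  Near a point of space-time the hypersurface is, at the time in question, the graph of a convex
  function \<open>w\<close> over its tangent space. In such coordinates the metric is Euclidean to first order, so
  all geometric quantities are explicit in the derivatives of \<open>w\<close>, and the symmetry of the fourth
  derivatives of \<open>w\<close> replaces the Codazzi and Simons identities. At a spatial maximum of a symmetric
  function of the principal curvatures, its time derivative therefore splits into a reaction term, a
  multiple of the squared mixed third derivative, and three quadratic forms in three third
  derivatives each.

  The degree-one quantity \<open>\<psi>\<close> does not control the pinching, so a cone has to be preserved first. The
  circular cone \<open>25 |A|\<^sup>2 \<le> 11 H\<^sup>2\<close>, equivalently \<open>7 H\<^sup>2 \<le> 25 (ab + ac + bc)\<close>, contains all 3-pinched
  triples, and touches them at \<open>(1, 1, 3)\<close>. On it every principal curvature is at most \<open>3/5 H\<close>, which is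
  exactly what makes the quadratic forms for \<open>25 |A|\<^sup>2 - 11 H\<^sup>2\<close> nonpositive; the reaction term is
  negative on the boundary, so the cone is preserved. Inside the cone the quadratic forms for \<open>\<psi>\<close>,
  restricted by the first order condition at a maximum, are nonpositive as well, and the maximum
  principle applies to \<open>\<psi>\<close>.
\<close>

section \<open>Calculus of \<open>C\<^sup>k\<close> maps\<close>

text \<open>The fields \<nu> and \<kappa> come without regularity, and principal curvatures need not
  be differentiable where they coincide. Hence curvature enters only through the elementary
  symmetric functions of \<kappa>, which are ratios of coefficients of det (h + s g), and the normal
  is compared with a polynomial one; convexity decides the sign between the two.

  The constants of the cone are the values at (1, 1, 3): there H = 5, |A|^2 = 11 and ab + ac + bc =
  7. The bound 3/5 H is matched to the weighted Cauchy-Schwarz inequality 3 (x + y + z)^2 \<le> 5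
  (x^2 + 3 y^2 + 3 z^2), where x, y, z are the third derivatives that make up one derivative of H.

  The maximum principle is applied in two different ways. The initial hypersurface may touch the
  cone, so there the time derivative on the boundary has to be strictly negative. For \<psi> the
  derivative at a maximum is only nonpositive; a small multiple of time is subtracted to create
  strictness, and \<psi> \<le> m is multiplied by abc so that only polynomials are
  differentiated.\<close>

definition uniq_diff :: "'a::euclidean_space set \<Rightarrow> bool" where
  "uniq_diff S \<longleftrightarrow> (\<forall>x\<in>S. \<forall>i\<in>Basis. \<forall>e>0. \<exists>d. 0 < \<bar>d\<bar> \<and> \<bar>d\<bar> < e \<and> x + d *\<^sub>R i \<in> S)"

text \<open>With the direction before the function, \<open>dirD S v\<close> is an operator on
  functions that can be iterated, in step with the recursion of \<open>Ck_on\<close>.\<close>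

definition dirD :: "'a::real_normed_vector set \<Rightarrow> 'a \<Rightarrow> ('a \<Rightarrow> 'b::real_normed_vector) \<Rightarrow> 'a \<Rightarrow> 'b" where
  "dirD S v f x = frechet_derivative f (at x within S) v"

lemma uniq_diff_open: "open S \<Longrightarrow> uniq_diff S"
  unfolding uniq_diff_def
proof (intro ballI allI impI)
  fix x :: 'a and i :: 'a and e :: real
  assume "open S" "x \<in> S" "i \<in> Basis" "0 < e"
  then obtain d where d: "d > 0" "ball x d \<subseteq> S" by (meson open_contains_ball)
  have "x + (min d e / 2) *\<^sub>R i \<in> S"
    using d \<open>0 < e\<close> \<open>i \<in> Basis\<close> by (intro subsetD[OF d(2)]) (auto simp: dist_norm)
  then show "\<exists>d. 0 < \<bar>d\<bar> \<and> \<bar>d\<bar> < e \<and> x + d *\<^sub>R i \<in> S"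
    using d \<open>0 < e\<close> by (intro exI[of _ "min d e / 2"]) auto
qed

lemma uniq_diff_Times:
  assumes "uniq_diff S" "uniq_diff T"
  shows "uniq_diff (S \<times> T)"
  unfolding uniq_diff_def
proof (intro ballI allI impI)
  fix x :: "'a \<times> 'b" and i :: "'a \<times> 'b" and e :: real
  assume x: "x \<in> S \<times> T" and i: "i \<in> Basis" and e: "0 < e"
  obtain a b where ab: "x = (a, b)" "a \<in> S" "b \<in> T" using x by auto
  consider u where "i = (u, 0)" "u \<in> Basis" | v where "i = (0, v)" "v \<in> Basis"
    using i by (auto simp: Basis_prod_def)
  then show "\<exists>d. 0 < \<bar>d\<bar> \<and> \<bar>d\<bar> < e \<and> x + d *\<^sub>R i \<in> S \<times> T"
  proof cases
    case 1
    then obtain d where "0 < \<bar>d\<bar>" "\<bar>d\<bar> < e" "a + d *\<^sub>R u \<in> S"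
      using assms(1) ab(2) e unfolding uniq_diff_def by blast
    then show ?thesis using 1 ab by (intro exI[of _ d]) simp
  next
    case 2
    then obtain d where "0 < \<bar>d\<bar>" "\<bar>d\<bar> < e" "b + d *\<^sub>R v \<in> T"
      using assms(2) ab(3) e unfolding uniq_diff_def by blast
    then show ?thesis using 2 ab by (intro exI[of _ d]) simp
  qed
qed

text \<open>Derivatives within a set are unique as soon as the set has nearby points along every
  coordinate axis, on one side at least. This is what \<open>uniq_diff\<close> records; it includes
  one-sided time derivatives at time 0.\<close>

lemma uniq_diff_deriv_eq:
  "uniq_diff S \<Longrightarrow> x \<in> S \<Longrightarrow> (f has_derivative f') (at x within S) \<Longrightarrow> dirD S v f x = f' v"
proof -
  assume S: "uniq_diff S" "x \<in> S" and d: "(f has_derivative f') (at x within S)"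
  have "(f has_derivative frechet_derivative f (at x within S)) (at x within S)"
    using d by (simp add: differentiableI flip: frechet_derivative_works)
  then have "frechet_derivative f (at x within S) = f'"
    using S d by (intro frechet_derivative_unique_within) (auto simp: uniq_diff_def)
  then show ?thesis by (simp add: dirD_def)
qed

lemma dirD_open: "open S \<Longrightarrow> x \<in> S \<Longrightarrow> dirD S v f x = frechet_derivative f (at x) v"
  by (simp add: dirD_def at_within_open[of x S])

lemma dirD_cong:
  assumes "x \<in> S" "\<And>y. y \<in> S \<Longrightarrow> f y = g y"
  shows "dirD S v f x = dirD S v g x"
proof -
  have "(f has_derivative d) (at x within S) = (g has_derivative d) (at x within S)" for d
    using has_derivative_transform[OF assms(1), of f g] has_derivative_transform[OF assms(1), of g f] assms(2)
    by metis
  then show ?thesis by (simp add: dirD_def frechet_derivative_def)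
qed

lemma Ck_on_cong:
  "(\<And>y. y \<in> S \<Longrightarrow> f y = g y) \<Longrightarrow> Ck_on k f S = Ck_on k g S"
proof (induction k arbitrary: f g)
  case 0
  then show ?case by (auto intro: continuous_on_cong)
next
  case (Suc k)
  have "(f has_derivative d) (at x within S) = (g has_derivative d) (at x within S)"
    if "x \<in> S" for x d
    using has_derivative_transform[OF that, of f g] has_derivative_transform[OF that, of g f] Suc.prems
    by metis
  then have "(f differentiable_on S) = (g differentiable_on S)"
    unfolding differentiable_on_def differentiable_def by simp
  moreover have "Ck_on k (dirD S v f) S = Ck_on k (dirD S v g) S" for v
    by (rule Suc.IH) (rule dirD_cong[OF _ Suc.prems])
  ultimately show ?case by (simp flip: dirD_def)
qed

lemma Ck_on_SucD: "Ck_on (Suc k) f S \<Longrightarrow> Ck_on k f S"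
proof (induction k arbitrary: f)
  case 0
  then show ?case by (simp add: differentiable_imp_continuous_on)
next
  case (Suc k)
  show ?case
    unfolding Ck_on.simps(2)[of k]
    using Suc.prems Suc.IH unfolding Ck_on.simps(2)[of "Suc k"] by blast
qed

lemma Ck_on_le: "Ck_on n f S \<Longrightarrow> k \<le> n \<Longrightarrow> Ck_on k f S"
proof (induction n)
  case (Suc n)
  then show ?case by (cases "k = Suc n") (auto simp del: Ck_on.simps intro: Ck_on_SucD)
qed simp

lemma Ck_on_imp_continuous: "Ck_on k f S \<Longrightarrow> continuous_on S f"
  using Ck_on_le[of k f S 0] by simp

lemma Ck_on_dirD: "Ck_on (Suc k) f S \<Longrightarrow> Ck_on k (dirD S v f) S"
  by (simp add: dirD_def[abs_def])

lemma Ck_on_has_derivative: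
  "Ck_on (Suc k) f S \<Longrightarrow> x \<in> S \<Longrightarrow> (f has_derivative (\<lambda>v. dirD S v f x)) (at x within S)"
  by (simp add: dirD_def differentiable_on_def frechet_derivative_works)

declare Ck_on.simps(2) [simp del]

text \<open>Any formula for the derivative will do. Closure under an operation thus becomes an
  induction on \<open>k\<close>, whose step applies the induction hypothesis to the usual
  differentiation rule.\<close>

lemma Ck_on_SucI:
  assumes "uniq_diff S" "\<And>x. x \<in> S \<Longrightarrow> (f has_derivative f' x) (at x within S)"
    and "\<And>v. Ck_on k (\<lambda>x. f' x v) S"
  shows "Ck_on (Suc k) f S"
proof -
  have "f differentiable_on S"
    using assms(2) by (auto simp: differentiable_on_def differentiable_def)
  moreover have "Ck_on k (dirD S v f) S" for v
  proof -
    have "Ck_on k (dirD S v f) S = Ck_on k (\<lambda>x. f' x v) S"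
      using uniq_diff_deriv_eq[OF assms(1) _ assms(2)] by (intro Ck_on_cong) auto
    then show ?thesis using assms(3) by simp
  qed
  ultimately show ?thesis by (simp add: Ck_on.simps(2) flip: dirD_def)
qed

lemma Ck_on_const: "uniq_diff S \<Longrightarrow> Ck_on k (\<lambda>x. c) S"
proof (induction k arbitrary: c)
  case (Suc k)
  then show ?case by (intro Ck_on_SucI[where f' = "\<lambda>_ _. 0"]) auto
qed auto

lemma Ck_on_linear_comp:
  assumes "uniq_diff S" "bounded_linear L" "Ck_on k f S"
  shows "Ck_on k (\<lambda>x. L (f x)) S"
  using assms(3)
proof (induction k arbitrary: f)
  case 0
  then show ?case using assms(2) by (simp add: bounded_linear.continuous_on)
next
  case (Suc k)
  show ?case
  proof (rule Ck_on_SucI[OF assms(1)])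
    show "((\<lambda>x. L (f x)) has_derivative (\<lambda>v. L (dirD S v f x))) (at x within S)" if "x \<in> S" for x
      using bounded_linear.has_derivative[OF assms(2) Ck_on_has_derivative[OF Suc.prems that]] .
    show "Ck_on k (\<lambda>x. L (dirD S v f x)) S" for v
      by (rule Suc.IH) (rule Ck_on_dirD[OF Suc.prems])
  qed
qed

lemma Ck_on_id: "uniq_diff S \<Longrightarrow> Ck_on k (\<lambda>x. x) S"
proof (cases k)
  case (Suc n)
  assume "uniq_diff S"
  then show ?thesis unfolding Suc
    by (intro Ck_on_SucI[where f' = "\<lambda>_ v. v"]) (auto intro: Ck_on_const)
qed (simp add: continuous_on_id)

lemma Ck_on_linear: "uniq_diff S \<Longrightarrow> bounded_linear L \<Longrightarrow> Ck_on k L S"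
  using Ck_on_linear_comp[OF _ _ Ck_on_id] by blast

lemma Ck_on_add:
  assumes "uniq_diff S" "Ck_on k f S" "Ck_on k g S"
  shows "Ck_on k (\<lambda>x. f x + g x) S"
  using assms(2,3)
proof (induction k arbitrary: f g)
  case 0
  then show ?case by (simp add: continuous_on_add)
next
  case (Suc k)
  show ?case
  proof (rule Ck_on_SucI[OF assms(1)])
    show "((\<lambda>x. f x + g x) has_derivative (\<lambda>v. dirD S v f x + dirD S v g x)) (at x within S)"
      if "x \<in> S" for x
      by (rule has_derivative_add[OF Ck_on_has_derivative[OF Suc.prems(1) that]
            Ck_on_has_derivative[OF Suc.prems(2) that]])
    show "Ck_on k (\<lambda>x. dirD S v f x + dirD S v g x) S" for v
      by (intro Suc.IH Ck_on_dirD Suc.prems)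
  qed
qed

lemma Ck_on_uminus: "uniq_diff S \<Longrightarrow> Ck_on k f S \<Longrightarrow> Ck_on k (\<lambda>x. - f x) S"
  by (rule Ck_on_linear_comp[where L = uminus]) (auto intro: bounded_linear_minus bounded_linear_ident)

lemma Ck_on_diff:
  "uniq_diff S \<Longrightarrow> Ck_on k f S \<Longrightarrow> Ck_on k g S \<Longrightarrow> Ck_on k (\<lambda>x. f x - g x) S"
  using Ck_on_add[of S k f "\<lambda>x. - g x"] Ck_on_uminus[of S k g] by simp

lemma Ck_on_sum:
  "uniq_diff S \<Longrightarrow> (\<And>i. i \<in> A \<Longrightarrow> Ck_on k (f i) S) \<Longrightarrow> Ck_on k (\<lambda>x. \<Sum>i\<in>A. f i x) S"
  by (induction A rule: infinite_finite_induct) (auto intro: Ck_on_const Ck_on_add)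

lemma Ck_on_bilinear:
  assumes "uniq_diff S" "bounded_bilinear b" "Ck_on k f S" "Ck_on k g S"
  shows "Ck_on k (\<lambda>x. b (f x) (g x)) S"
  using assms(3,4)
proof (induction k arbitrary: f g)
  case 0
  then show ?case using assms(2) by (simp add: bounded_bilinear.continuous_on)
next
  case (Suc k)
  show ?case
  proof (rule Ck_on_SucI[OF assms(1)])
    show "((\<lambda>x. b (f x) (g x)) has_derivative (\<lambda>v. b (f x) (dirD S v g x) + b (dirD S v f x) (g x)))
        (at x within S)" if "x \<in> S" for x
      by (rule bounded_bilinear.FDERIV[OF assms(2) Ck_on_has_derivative[OF Suc.prems(1) that]
            Ck_on_has_derivative[OF Suc.prems(2) that]])
    show "Ck_on k (\<lambda>x. b (f x) (dirD S v g x) + b (dirD S v f x) (g x)) S" for v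
      by (intro Ck_on_add assms Suc.IH Ck_on_dirD Suc.prems Ck_on_SucD[OF Suc.prems(1)]
          Ck_on_SucD[OF Suc.prems(2)])
  qed
qed

lemmas Ck_on_mult = Ck_on_bilinear[OF _ bounded_bilinear_mult]
lemmas Ck_on_scaleR = Ck_on_bilinear[OF _ bounded_bilinear_scaleR]
lemmas Ck_on_inner = Ck_on_bilinear[OF _ bounded_bilinear_inner]

lemma Ck_on_vec_nth: "uniq_diff S \<Longrightarrow> Ck_on k f S \<Longrightarrow> Ck_on k (\<lambda>x. f x $ i) S"
  by (rule Ck_on_linear_comp[OF _ bounded_linear_vec_nth])

lemma Ck_on_vec_lambda:
  fixes f :: "'a::euclidean_space \<Rightarrow> 'n::finite \<Rightarrow> real"
  assumes "uniq_diff S" "\<And>i. Ck_on k (\<lambda>x. f x i) S"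
  shows "Ck_on k (\<lambda>x. \<chi> i. f x i) S"
proof -
  have "(\<lambda>x. \<chi> i. f x i) = (\<lambda>x. \<Sum>i\<in>UNIV. f x i *\<^sub>R axis i 1)"
    by (auto simp: vec_eq_iff axis_def sum.delta' if_distrib cong: if_cong)
  moreover have "Ck_on k (\<lambda>x. \<Sum>i\<in>UNIV. f x i *\<^sub>R axis i (1::real)) S"
    by (intro Ck_on_sum Ck_on_scaleR Ck_on_const assms)
  ultimately show ?thesis by simp
qed

lemma Ck_on_inverse:
  fixes f :: "'a::euclidean_space \<Rightarrow> real"
  assumes "uniq_diff S" "\<And>x. x \<in> S \<Longrightarrow> f x \<noteq> 0" "Ck_on k f S"
  shows "Ck_on k (\<lambda>x. inverse (f x)) S"
  using assms(3)
proof (induction k)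
  case 0
  then show ?case using assms(2) by (simp add: continuous_on_inverse)
next
  case (Suc k)
  have IH: "Ck_on k (\<lambda>x. inverse (f x)) S" using Suc Ck_on_SucD by blast
  show ?case
  proof (rule Ck_on_SucI[OF assms(1)])
    show "((\<lambda>x. inverse (f x)) has_derivative (\<lambda>v. - (inverse (f x) * dirD S v f x * inverse (f x))))
        (at x within S)" if "x \<in> S" for x
      using Deriv.has_derivative_inverse[OF assms(2)[OF that] Ck_on_has_derivative[OF Suc.prems that]] .
    show "Ck_on k (\<lambda>x. - (inverse (f x) * dirD S v f x * inverse (f x))) S" for v
      by (intro Ck_on_uminus Ck_on_mult assms IH Ck_on_dirD Suc.prems)
  qed
qed

lemma Ck_on_divide:
  fixes f g :: "'a::euclidean_space \<Rightarrow> real"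
  assumes "uniq_diff S" "\<And>x. x \<in> S \<Longrightarrow> g x \<noteq> 0" "Ck_on k f S" "Ck_on k g S"
  shows "Ck_on k (\<lambda>x. f x / g x) S"
  unfolding divide_inverse by (intro Ck_on_mult Ck_on_inverse assms)

section \<open>Chain rule and product rule for directional derivatives\<close>

lemma linear_expand:
  fixes L :: "'a::euclidean_space \<Rightarrow> 'b::real_normed_vector"
  assumes "linear L"
  shows "L v = (\<Sum>b\<in>Basis. (v \<bullet> b) *\<^sub>R L b)"
proof -
  have "L v = L (\<Sum>b\<in>Basis. (v \<bullet> b) *\<^sub>R b)" by (simp only: euclidean_representation)
  then show ?thesis by (simp only: linear_sum[OF assms] linear_scale[OF assms])
qed

lemma Ck_on_compose:
  fixes g :: "'a::euclidean_space \<Rightarrow> 'b::euclidean_space"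
  assumes "uniq_diff S" "g ` S \<subseteq> T" "Ck_on k f T" "Ck_on k g S"
  shows "Ck_on k (\<lambda>x. f (g x)) S"
  using assms(3,4)
proof (induction k arbitrary: f)
  case 0
  then show ?case using assms(2) by (auto intro: continuous_on_compose2)
next
  case (Suc k)
  \<comment> \<open>The chain rule differentiates \<open>f\<close> in the direction
    \<open>dirD S v g x\<close>, which varies with \<open>x\<close>. Expanding it over the basis
    leaves fixed directions, to which the induction hypothesis applies.\<close>
  let ?d = "\<lambda>x v. \<Sum>b\<in>Basis. (dirD S v g x \<bullet> b) *\<^sub>R dirD T b f (g x)"
  show ?case
  proof (rule Ck_on_SucI[OF assms(1)])
    fix x assume x: "x \<in> S"
    then have gx: "g x \<in> T" using assms(2) by auto
    have df: "(f has_derivative (\<lambda>v. dirD T v f (g x))) (at (g x) within T)"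
      by (rule Ck_on_has_derivative[OF Suc.prems(1) gx])
    have lin: "linear (\<lambda>v. dirD T v f (g x))" by (rule has_derivative_linear[OF df])
    have eq: "(\<lambda>v. dirD T (dirD S v g x) f (g x)) = ?d x"
      by (rule ext) (rule linear_expand[OF lin])
    show "((\<lambda>x. f (g x)) has_derivative ?d x) (at x within S)"
      unfolding eq[symmetric]
      by (rule has_derivative_in_compose[OF Ck_on_has_derivative[OF Suc.prems(2) x]
            has_derivative_subset[OF df assms(2)]])
  next
    show "Ck_on k (\<lambda>x. ?d x v) S" for v
      by (intro Ck_on_sum Ck_on_scaleR Ck_on_inner assms Ck_on_const Ck_on_dirD Suc Ck_on_SucD[OF Suc.prems(2)])
  qed
qed

lemma dirD_compose:
  fixes g :: "'a::euclidean_space \<Rightarrow> 'b::euclidean_space"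
  assumes "uniq_diff S" "g ` S \<subseteq> T" "Ck_on (Suc k) f T" "Ck_on (Suc m) g S" "x \<in> S"
  shows "dirD S v (\<lambda>x. f (g x)) x = dirD T (dirD S v g x) f (g x)"
  by (rule uniq_diff_deriv_eq[OF assms(1,5)])
     (rule has_derivative_in_compose[OF Ck_on_has_derivative[OF assms(4,5)]
        has_derivative_subset[OF Ck_on_has_derivative[OF assms(3)] assms(2)]], use assms in auto)

lemma dirD_bilinear:
  assumes "uniq_diff S" "bounded_bilinear b" "Ck_on (Suc k) f S" "Ck_on (Suc m) g S" "x \<in> S"
  shows "dirD S v (\<lambda>x. b (f x) (g x)) x = b (f x) (dirD S v g x) + b (dirD S v f x) (g x)"
  by (rule uniq_diff_deriv_eq[OF assms(1,5)])
     (rule bounded_bilinear.FDERIV[OF assms(2) Ck_on_has_derivative[OF assms(3,5)]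
        Ck_on_has_derivative[OF assms(4,5)]])

lemmas dirD_inner = dirD_bilinear[OF _ bounded_bilinear_inner]

lemma dirD_linear_comp:
  assumes "uniq_diff S" "bounded_linear L" "Ck_on (Suc k) f S" "x \<in> S"
  shows "dirD S v (\<lambda>x. L (f x)) x = L (dirD S v f x)"
  by (rule uniq_diff_deriv_eq[OF assms(1,4)])
     (rule bounded_linear.has_derivative[OF assms(2) Ck_on_has_derivative[OF assms(3,4)]])

lemma dirD_linear:
  assumes "Ck_on (Suc k) f S" "x \<in> S"
  shows "linear (\<lambda>v. dirD S v f x)"
  using has_derivative_linear[OF Ck_on_has_derivative[OF assms]] .

lemma Ck_on_line_derivative:
  fixes f :: "'a::euclidean_space \<Rightarrow> 'b::real_normed_vector"
  assumes "Ck_on (Suc k) f S" "x + s *\<^sub>R v \<in> S" "\<And>r. r \<in> R \<Longrightarrow> x + r *\<^sub>R v \<in> S"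
  shows "((\<lambda>r. f (x + r *\<^sub>R v)) has_vector_derivative dirD S v f (x + s *\<^sub>R v)) (at s within R)"
proof -
  have lin: "linear (\<lambda>w. dirD S w f (x + s *\<^sub>R v))" by (rule dirD_linear[OF assms(1,2)])
  have "((\<lambda>r. x + r *\<^sub>R v) has_derivative (\<lambda>h. h *\<^sub>R v)) (at s within R)"
    by (auto intro!: derivative_eq_intros)
  moreover have "(f has_derivative (\<lambda>w. dirD S w f (x + s *\<^sub>R v)))
     (at (x + s *\<^sub>R v) within (\<lambda>r. x + r *\<^sub>R v) ` R)"
    using Ck_on_has_derivative[OF assms(1,2)] assms(3) by (auto intro: has_derivative_subset)
  ultimately have "((\<lambda>r. f (x + r *\<^sub>R v)) has_derivative (\<lambda>h. dirD S (h *\<^sub>R v) f (x + s *\<^sub>R v))) (at s within R)"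
    by (rule has_derivative_in_compose)
  then show ?thesis
    by (simp add: has_vector_derivative_def linear.scaleR[OF lin])
qed

section \<open>Mixed partial derivatives and the inverse function theorem\<close>

text \<open>The mean value theorem is applied along \<open>v\<close> to the difference of two
  parallel edges, then along \<open>w\<close>. Only nonnegative multiples of \<open>v\<close> and
  \<open>w\<close> occur, so that the statement also fits at the boundary time 0.\<close>

lemma mvt_square:
  fixes f :: "'a::euclidean_space \<Rightarrow> real"
  assumes C: "Ck_on (Suc (Suc k)) f S" and h: "0 < h"
    and S: "\<And>r s. 0 \<le> r \<Longrightarrow> r \<le> h \<Longrightarrow> 0 \<le> s \<Longrightarrow> s \<le> h \<Longrightarrow> x + r *\<^sub>R v + s *\<^sub>R w \<in> S"
  shows "\<exists>r s. 0 \<le> r \<and> r \<le> h \<and> 0 \<le> s \<and> s \<le> h \<and>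
     f (x + h *\<^sub>R v + h *\<^sub>R w) - f (x + h *\<^sub>R v) - f (x + h *\<^sub>R w) + f x =
     h\<^sup>2 * dirD S w (dirD S v f) (x + r *\<^sub>R v + s *\<^sub>R w)"
proof -
  have 1: "((\<lambda>r. f (x + s *\<^sub>R w + r *\<^sub>R v)) has_vector_derivative
      dirD S v f (x + s *\<^sub>R w + r *\<^sub>R v)) (at r within {0..h})"
    if "0 \<le> r" "r \<le> h" "0 \<le> s" "s \<le> h" for r s
    using S that by (intro Ck_on_line_derivative[OF C]) (auto simp: add_ac)
  define p where "p r = f (x + h *\<^sub>R w + r *\<^sub>R v) - f (x + 0 *\<^sub>R w + r *\<^sub>R v)" for r
  define p' where "p' r = dirD S v f (x + h *\<^sub>R w + r *\<^sub>R v) - dirD S v f (x + 0 *\<^sub>R w + r *\<^sub>R v)" for r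
  have "(p has_derivative (\<lambda>d. d * p' r)) (at r within {0..h})" if "0 \<le> r" "r \<le> h" for r
    using has_vector_derivative_diff[OF 1[OF that, of h] 1[OF that, of 0]] h
    unfolding p_def p'_def has_vector_derivative_def by simp
  from mvt_simple[OF h this] obtain r where r: "0 < r" "r < h" "p h - p 0 = h * p' r" by auto
  have 2: "((\<lambda>s. dirD S v f (x + r *\<^sub>R v + s *\<^sub>R w)) has_vector_derivative
      dirD S w (dirD S v f) (x + r *\<^sub>R v + s *\<^sub>R w)) (at s within {0..h})"
    if "0 \<le> s" "s \<le> h" for s
    using S that r by (intro Ck_on_line_derivative[OF Ck_on_dirD[OF C]]) auto
  obtain s where s: "0 < s" "s < h"
    "dirD S v f (x + r *\<^sub>R v + h *\<^sub>R w) - dirD S v f (x + r *\<^sub>R v + 0 *\<^sub>R w)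
       = h * dirD S w (dirD S v f) (x + r *\<^sub>R v + s *\<^sub>R w)"
    using mvt_simple[OF h 2[unfolded has_vector_derivative_def]] by auto
  have "p' r = h * dirD S w (dirD S v f) (x + r *\<^sub>R v + s *\<^sub>R w)"
    using s(3) by (simp add: p'_def add_ac)
  then have "p h - p 0 = h\<^sup>2 * dirD S w (dirD S v f) (x + r *\<^sub>R v + s *\<^sub>R w)"
    using r(3) by (simp add: power2_eq_square)
  moreover have "p h - p 0 = f (x + h *\<^sub>R v + h *\<^sub>R w) - f (x + h *\<^sub>R v) - f (x + h *\<^sub>R w) + f x"
    by (simp add: p_def add_ac)
  ultimately show ?thesis using r s by (intro exI[of _ r] exI[of _ s]) auto
qed

text \<open>The second difference over a small square is symmetric in \<open>v\<close> and
  \<open>w\<close>, so both iterated derivatives take a common value at points of that square;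
  continuity carries this to the corner \<open>x\<close>.\<close>

lemma dirD_commute_real:
  fixes f :: "'a::euclidean_space \<Rightarrow> real"
  assumes C: "Ck_on (Suc (Suc k)) f S" and e: "0 < e"
    and S: "\<And>r s. 0 \<le> r \<Longrightarrow> r < e \<Longrightarrow> 0 \<le> s \<Longrightarrow> s < e \<Longrightarrow> x + r *\<^sub>R v + s *\<^sub>R w \<in> S"
  shows "dirD S v (dirD S w f) x = dirD S w (dirD S v f) x"
proof (rule ccontr)
  let ?A = "dirD S w (dirD S v f)" and ?B = "dirD S v (dirD S w f)"
  assume ne: "?B x \<noteq> ?A x"
  define d where "d = \<bar>?B x - ?A x\<bar> / 2"
  have d: "d > 0" using ne by (simp add: d_def)
  have x: "x \<in> S" using S[of 0 0] e by simp
  have cont: "continuous_on S ?A" "continuous_on S ?B"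
    by (intro Ck_on_imp_continuous[of k] Ck_on_dirD C)+
  obtain d1 where d1: "d1 > 0" "\<And>y. y \<in> S \<Longrightarrow> dist y x < d1 \<Longrightarrow> dist (?A y) (?A x) < d"
    using cont(1) x d unfolding continuous_on_iff by blast
  obtain d2 where d2: "d2 > 0" "\<And>y. y \<in> S \<Longrightarrow> dist y x < d2 \<Longrightarrow> dist (?B y) (?B x) < d"
    using cont(2) x d unfolding continuous_on_iff by blast
  define m where "m = norm v + norm w + 1"
  have m: "m > 0" unfolding m_def by (smt (verit) norm_ge_zero)
  define h where "h = min (e / 2) (min d1 d2 / (2 * m))"
  have h: "0 < h" "h < e" "h * m < d1" "h * m < d2"
  proof -
    have "h \<le> min d1 d2 / (2 * m)" by (simp add: h_def)
    then have "h * m \<le> min d1 d2 / 2" using m by (simp add: field_simps)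
    then show "h * m < d1" "h * m < d2" using d1(1) d2(1) by auto
    show "0 < h" "h < e" using e m d1(1) d2(1) by (auto simp: h_def)
  qed
  have near: "dist (x + r *\<^sub>R v + s *\<^sub>R w) x < min d1 d2"
    if "0 \<le> r" "r \<le> h" "0 \<le> s" "s \<le> h" for r s
  proof -
    have "dist (x + r *\<^sub>R v + s *\<^sub>R w) x \<le> r * norm v + s * norm w"
      using norm_triangle_ineq[of "r *\<^sub>R v" "s *\<^sub>R w"] that by (simp add: dist_norm add.assoc)
    also have "\<dots> \<le> h * norm v + h * norm w"
      using that by (intro add_mono mult_right_mono) auto
    also have "\<dots> \<le> h * m" using h by (simp add: m_def algebra_simps)
    finally show ?thesis using h by simp
  qed
  obtain r s where rs: "0 \<le> r" "r \<le> h" "0 \<le> s" "s \<le> h"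
     "f (x + h *\<^sub>R v + h *\<^sub>R w) - f (x + h *\<^sub>R v) - f (x + h *\<^sub>R w) + f x =
     h\<^sup>2 * ?A (x + r *\<^sub>R v + s *\<^sub>R w)"
    using mvt_square[OF C h(1), of x v w] S h(2) by force
  obtain r' s' where rs': "0 \<le> r'" "r' \<le> h" "0 \<le> s'" "s' \<le> h"
     "f (x + h *\<^sub>R w + h *\<^sub>R v) - f (x + h *\<^sub>R w) - f (x + h *\<^sub>R v) + f x =
     h\<^sup>2 * ?B (x + r' *\<^sub>R w + s' *\<^sub>R v)"
    using mvt_square[OF C h(1), of x w v] S h(2) by (force simp: add_ac)
  have *: "x + r' *\<^sub>R w + s' *\<^sub>R v = x + s' *\<^sub>R v + r' *\<^sub>R w"
    and swap: "x + h *\<^sub>R w + h *\<^sub>R v = x + h *\<^sub>R v + h *\<^sub>R w" by simp_all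
  have "h\<^sup>2 * ?A (x + r *\<^sub>R v + s *\<^sub>R w) = h\<^sup>2 * ?B (x + s' *\<^sub>R v + r' *\<^sub>R w)"
    using rs(5) rs'(5) unfolding * swap by linarith
  then have "?A (x + r *\<^sub>R v + s *\<^sub>R w) = ?B (x + s' *\<^sub>R v + r' *\<^sub>R w)" using h(1) by simp
  moreover have "dist (?A (x + r *\<^sub>R v + s *\<^sub>R w)) (?A x) < d"
    using near[OF rs(1-4)] S[of r s] rs h by (intro d1) auto
  moreover have "dist (?B (x + s' *\<^sub>R v + r' *\<^sub>R w)) (?B x) < d"
    using near[OF rs'(3,4,1,2)] S[of s' r'] rs' h by (intro d2) auto
  ultimately have "\<bar>?B x - ?A x\<bar> < 2 * d" unfolding dist_real_def by arith
  then show False by (simp add: d_def)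
qed

lemma dirD_commute:
  fixes f :: "'a::euclidean_space \<Rightarrow> 'b::euclidean_space"
  assumes u: "uniq_diff S" and C: "Ck_on (Suc (Suc k)) f S" and e: "0 < e"
    and S: "\<And>r s. 0 \<le> r \<Longrightarrow> r < e \<Longrightarrow> 0 \<le> s \<Longrightarrow> s < e \<Longrightarrow> x + r *\<^sub>R v + s *\<^sub>R w \<in> S"
  shows "dirD S v (dirD S w f) x = dirD S w (dirD S v f) x"
proof (rule euclidean_eqI)
  fix b :: 'b assume "b \<in> Basis"
  have x: "x \<in> S" using S[of 0 0] e by simp
  have L: "bounded_linear (\<lambda>y. y \<bullet> b)" by (rule bounded_linear_inner_left)
  have eq: "dirD S p (dirD S q f) x \<bullet> b = dirD S p (dirD S q (\<lambda>y. f y \<bullet> b)) x" for p q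
  proof -
    have "dirD S p (dirD S q f) x \<bullet> b = dirD S p (\<lambda>y. dirD S q f y \<bullet> b) x"
      by (rule dirD_linear_comp[OF u L Ck_on_dirD[OF C] x, symmetric])
    also have "\<dots> = dirD S p (dirD S q (\<lambda>y. f y \<bullet> b)) x"
      by (rule dirD_cong[OF x]) (rule dirD_linear_comp[OF u L C, symmetric])
    finally show ?thesis .
  qed
  show "dirD S v (dirD S w f) x \<bullet> b = dirD S w (dirD S v f) x \<bullet> b"
    unfolding eq by (rule dirD_commute_real[OF Ck_on_linear_comp[OF u L C] e S])
qed

lemma dirD_commute_open:
  fixes f :: "'a::euclidean_space \<Rightarrow> 'b::euclidean_space"
  assumes "open S" "Ck_on (Suc (Suc k)) f S" "x \<in> S"
  shows "dirD S v (dirD S w f) x = dirD S w (dirD S v f) x"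
proof -
  obtain d where d: "d > 0" "ball x d \<subseteq> S" using assms by (meson open_contains_ball)
  define m where "m = norm v + norm w + 1"
  have m: "m > 0" unfolding m_def by (smt (verit) norm_ge_zero)
  show ?thesis
  proof (rule dirD_commute[OF uniq_diff_open[OF assms(1)] assms(2)])
    show "0 < d / m" using d m by simp
    fix r s :: real assume rs: "0 \<le> r" "r < d / m" "0 \<le> s" "s < d / m"
    have "norm (r *\<^sub>R v + s *\<^sub>R w) \<le> r * norm v + s * norm w"
      using norm_triangle_ineq[of "r *\<^sub>R v" "s *\<^sub>R w"] rs by simp
    also have "\<dots> \<le> d / m * norm v + d / m * norm w"
      using rs by (intro add_mono mult_right_mono) auto
    also have "\<dots> = d / m * (m - 1)" by (simp only: m_def add_diff_cancel_right' distrib_left)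
    also have "\<dots> < d / m * m"
      using d m by (intro mult_strict_left_mono) auto
    finally have "norm (r *\<^sub>R v + s *\<^sub>R w) < d" using m by simp
    moreover have "dist x (x + r *\<^sub>R v + s *\<^sub>R w) = norm (r *\<^sub>R v + s *\<^sub>R w)"
      by (subst dist_commute) (simp add: dist_norm add.assoc)
    ultimately show "x + r *\<^sub>R v + s *\<^sub>R w \<in> S"
      using d(2) by (auto simp: subset_eq)
  qed
qed

section \<open>Regularity of the inverse map\<close>

lemma Ck_on_prod:
  fixes f :: "'i \<Rightarrow> 'a::euclidean_space \<Rightarrow> real"
  shows "uniq_diff S \<Longrightarrow> (\<And>i. i \<in> A \<Longrightarrow> Ck_on k (f i) S) \<Longrightarrow> Ck_on k (\<lambda>x. \<Prod>i\<in>A. f i x) S"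
  by (induction A rule: infinite_finite_induct) (auto intro: Ck_on_const Ck_on_mult)

lemma Ck_on_det:
  fixes A :: "'a::euclidean_space \<Rightarrow> real^'n^'n"
  assumes "uniq_diff S" "\<And>i j. Ck_on k (\<lambda>x. A x $ i $ j) S"
  shows "Ck_on k (\<lambda>x. det (A x)) S"
  unfolding det_def by (intro Ck_on_sum Ck_on_mult Ck_on_prod Ck_on_const assms)

text \<open>Bootstrapping: the derivative of \<open>\<theta>\<close> at \<open>z\<close> inverts the
  Jacobian at \<open>\<theta> z\<close>, and by Cramer's rule its entries are quotients of
  determinants in \<open>J (\<theta> z)\<close>. So regularity of order \<open>n\<close> of
  \<open>\<theta>\<close> yields order \<open>n + 1\<close>, as long as \<open>y\<close>
  permits.\<close>

lemma inverse_function_Ck: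
  fixes y :: "real^'n \<Rightarrow> real^'n"
  assumes U: "open U" and y: "Ck_on (Suc m) y U" and u0: "u0 \<in> U"
    and inj: "inj (\<lambda>v. dirD U v y u0)"
  obtains V \<theta> where "open V" "y u0 \<in> V" "\<theta> ` V \<subseteq> U" "\<theta> (y u0) = u0"
    "\<And>z. z \<in> V \<Longrightarrow> y (\<theta> z) = z" "Ck_on (Suc m) \<theta> V"
proof -
  have uU: "uniq_diff U" by (rule uniq_diff_open[OF U])
  have der: "(y has_derivative (\<lambda>v. dirD U v y x)) (at x)" if "x \<in> U" for x
    using Ck_on_has_derivative[OF y that] at_within_open[OF that U] by simp
  have bl: "bounded_linear (\<lambda>v. dirD U v y x)" if "x \<in> U" for x
    using has_derivative_bounded_linear[OF der[OF that]] .
  define y' where "y' x = Blinfun (\<lambda>v. dirD U v y x)" for x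
  have y': "blinfun_apply (y' x) = (\<lambda>v. dirD U v y x)" if "x \<in> U" for x
    unfolding y'_def by (rule bounded_linear_Blinfun_apply[OF bl[OF that]])
  have der': "(y has_derivative blinfun_apply (y' x)) (at x)" if "x \<in> U" for x
    using der[OF that] y'[OF that] by simp
  have cont: "continuous_on U y'"
  proof (rule continuous_on_blinfun_componentwise)
    fix i :: "real^'n"
    have "continuous_on U (dirD U i y)" by (rule Ck_on_imp_continuous[OF Ck_on_dirD[OF y]])
    then show "continuous_on U (\<lambda>x. blinfun_apply (y' x) i)"
      by (rule continuous_on_eq) (simp add: y')
  qed
  obtain g where g: "linear g" "g \<circ> (\<lambda>v. dirD U v y u0) = id"
    using linear_injective_left_inverse[OF bounded_linear.linear[OF bl[OF u0]] inj] by blast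
  have gb: "bounded_linear g" using g(1) by (simp add: linear_conv_bounded_linear)
  have "Blinfun g o\<^sub>L y' u0 = id_blinfun"
    using g(2) by (intro blinfun_eqI) (simp add: bounded_linear_Blinfun_apply[OF gb] y'[OF u0] fun_eq_iff)
  from inverse_function_theorem[OF U der' cont u0 this]
  obtain U' V \<theta> \<theta>' where *: "open U'" "U' \<subseteq> U" "u0 \<in> U'" "open V" "y u0 \<in> V"
    "homeomorphism U' V y \<theta>"
    "\<And>z. z \<in> V \<Longrightarrow> (\<theta> has_derivative (\<theta>' z)) (at z)"
    "\<And>z. z \<in> V \<Longrightarrow> \<theta>' z = inv (blinfun_apply (y' (\<theta> z)))"
    "\<And>z. z \<in> V \<Longrightarrow> bij (blinfun_apply (y' (\<theta> z)))"
    by metis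
  have \<theta>U: "\<theta> ` V \<subseteq> U" using *(2,6) by (auto simp: homeomorphism_def)
  have uV: "uniq_diff V" by (rule uniq_diff_open[OF *(4)])
  define J where "J x = matrix (\<lambda>v. dirD U v y x)" for x
  have J: "dirD U v y x = J x *v v" if "x \<in> U" for x v
    unfolding J_def using bounded_linear.linear[OF bl[OF that]] by simp
  have Jentry: "J x $ i $ j = dirD U (axis j 1) y x $ i" for x i j
    by (simp add: J_def matrix_def)
  have det: "det (J (\<theta> z)) \<noteq> 0" if "z \<in> V" for z
  proof -
    have z: "\<theta> z \<in> U" using \<theta>U that by auto
    have "bij (\<lambda>v. J (\<theta> z) *v v)" using *(9)[OF that] y'[OF z] J[OF z] by simp
    then have "invertible (J (\<theta> z))"
      using bij_is_inj invertible_left_inverse matrix_left_invertible_injective by blast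
    then show ?thesis by (simp add: invertible_det_nz)
  qed
  have \<theta>': "\<theta>' z v = (\<chi> k. det (\<chi> i j. if j = k then v $ i else J (\<theta> z) $ i $ j) / det (J (\<theta> z)))"
    if "z \<in> V" for z v
  proof -
    have z: "\<theta> z \<in> U" using \<theta>U that by auto
    have "J (\<theta> z) *v (\<theta>' z v) = v"
      using *(8,9)[OF that] J[OF z] y'[OF z] by (metis bij_inv_eq_iff)
    then show ?thesis using cramer[OF det[OF that]] by blast
  qed
  have "Ck_on n \<theta> V" if "n \<le> Suc m" for n
    using that
  proof (induction n)
    case 0
    then show ?case using *(6) by (simp add: homeomorphism_def)
  next
    case (Suc n)
    have J_Ck: "Ck_on n (\<lambda>z. J (\<theta> z) $ i $ j) V" for i j
      unfolding Jentry
      by (rule Ck_on_vec_nth[OF uV Ck_on_compose[OF uV \<theta>U Ck_on_le[OF Ck_on_dirD[OF y]] Suc.IH]])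
         (use Suc.prems in auto)
    show ?case
    proof (rule Ck_on_SucI[OF uV])
      show "(\<theta> has_derivative \<theta>' z) (at z within V)" if "z \<in> V" for z
        using *(7)[OF that] by (rule has_derivative_at_withinI)
      have "Ck_on n (\<lambda>z. \<chi> k. det (\<chi> i j. if j = k then v $ i else J (\<theta> z) $ i $ j) / det (J (\<theta> z))) V" for v
      proof (intro Ck_on_vec_lambda Ck_on_divide Ck_on_det uV)
        show "Ck_on n (\<lambda>x. (\<chi> i j. if j = k then v $ i else J (\<theta> x) $ i $ j) $ i $ j) V" for i j k
          by (cases "j = k") (simp_all add: J_Ck Ck_on_const[OF uV])
      qed (use det J_Ck in auto)
      moreover have "Ck_on n (\<lambda>z. \<theta>' z v) V = Ck_on n (\<lambda>z. \<chi> k. det (\<chi> i j. if j = k then v $ i else J (\<theta> z) $ i $ j) / det (J (\<theta> z))) V" for v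
        by (rule Ck_on_cong) (rule \<theta>')
      ultimately show "Ck_on n (\<lambda>z. \<theta>' z v) V" for v by simp
    qed
  qed
  from this[OF order_refl] have "Ck_on (Suc m) \<theta> V" .
  moreover have "\<theta> (y u0) = u0" "\<And>z. z \<in> V \<Longrightarrow> y (\<theta> z) = z"
    using *(3,6) by (auto simp: homeomorphism_def)
  ultimately show thesis using that *(4,5) \<theta>U by blast
qed

section \<open>Second-order jets\<close>

text \<open>Value, slope and second derivative at 0, together with differentiability nearby: just
  what the second derivative test needs. The rules below let the jets of long expressions be
  computed by resolution.\<close>

definition jet2 :: "(real \<Rightarrow> real) \<Rightarrow> real \<Rightarrow> real \<Rightarrow> real \<Rightarrow> bool" where
  "jet2 f a b c \<longleftrightarrow> f 0 = a \<and> (\<exists>f'. (\<forall>\<^sub>F s in nhds 0. (f has_real_derivative f' s) (at s)) \<and>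
     f' 0 = b \<and> (f' has_real_derivative c) (at 0))"

lemma jet2I:
  "\<forall>\<^sub>F s in nhds 0. (f has_real_derivative f' s) (at s) \<Longrightarrow> f 0 = a \<Longrightarrow> f' 0 = b \<Longrightarrow>
   (f' has_real_derivative c) (at 0) \<Longrightarrow> jet2 f a b c"
  unfolding jet2_def by blast

lemma jet2_eq: "jet2 f a b c \<Longrightarrow> a = a' \<Longrightarrow> b = b' \<Longrightarrow> c = c' \<Longrightarrow> jet2 f a' b' c'"
  by simp

lemma jet2_const: "jet2 (\<lambda>s. k) k 0 0"
  by (rule jet2I[where f' = "\<lambda>_. 0"]) auto

lemma jet2_add:
  assumes "jet2 f a b c" "jet2 g a' b' c'"
  shows "jet2 (\<lambda>s. f s + g s) (a + a') (b + b') (c + c')"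
proof -
  obtain f' g' where f: "\<forall>\<^sub>F s in nhds 0. (f has_real_derivative f' s) (at s)"
      "f 0 = a" "f' 0 = b" "(f' has_real_derivative c) (at 0)"
    and g: "\<forall>\<^sub>F s in nhds 0. (g has_real_derivative g' s) (at s)"
      "g 0 = a'" "g' 0 = b'" "(g' has_real_derivative c') (at 0)"
    using assms unfolding jet2_def by blast
  show ?thesis
  proof (rule jet2I[where f' = "\<lambda>s. f' s + g' s"])
    show "\<forall>\<^sub>F s in nhds 0. ((\<lambda>s. f s + g s) has_real_derivative f' s + g' s) (at s)"
      using f(1) g(1) by eventually_elim (rule DERIV_add)
  qed (auto intro!: DERIV_add simp: f g)
qed

lemma jet2_mult:
  assumes "jet2 f a b c" "jet2 g a' b' c'"
  shows "jet2 (\<lambda>s. f s * g s) (a * a') (b * a' + a * b') (c * a' + 2 * b * b' + a * c')"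
proof -
  obtain f' g' where f: "\<forall>\<^sub>F s in nhds 0. (f has_real_derivative f' s) (at s)"
      "f 0 = a" "f' 0 = b" "(f' has_real_derivative c) (at 0)"
    and g: "\<forall>\<^sub>F s in nhds 0. (g has_real_derivative g' s) (at s)"
      "g 0 = a'" "g' 0 = b'" "(g' has_real_derivative c') (at 0)"
    using assms unfolding jet2_def by blast
  have f0: "(f has_real_derivative f' 0) (at 0)" and g0: "(g has_real_derivative g' 0) (at 0)"
    using eventually_nhds_x_imp_x[OF f(1)] eventually_nhds_x_imp_x[OF g(1)] by auto
  show ?thesis
  proof (rule jet2I[where f' = "\<lambda>s. f' s * g s + g' s * f s"])
    show "\<forall>\<^sub>F s in nhds 0. ((\<lambda>s. f s * g s) has_real_derivative f' s * g s + g' s * f s) (at s)"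
      using f(1) g(1) by eventually_elim (rule DERIV_mult)
    show "((\<lambda>s. f' s * g s + g' s * f s) has_real_derivative c * a' + 2 * b * b' + a * c') (at 0)"
      by (rule derivative_eq_intros refl f(4) g(4) f0 g0)+ (simp add: f g algebra_simps)
  qed (simp_all add: f g)
qed

lemma jet2_cmult: "jet2 f a b c \<Longrightarrow> jet2 (\<lambda>s. k * f s) (k * a) (k * b) (k * c)"
  using jet2_mult[OF jet2_const, of f a b c k] by simp

lemma jet2_uminus: "jet2 f a b c \<Longrightarrow> jet2 (\<lambda>s. - f s) (- a) (- b) (- c)"
  using jet2_cmult[of f a b c "-1"] by simp

lemma jet2_diff:
  "jet2 f a b c \<Longrightarrow> jet2 g a' b' c' \<Longrightarrow> jet2 (\<lambda>s. f s - g s) (a - a') (b - b') (c - c')"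
  using jet2_add[OF _ jet2_uminus, of f a b c g a' b' c'] by simp

lemma jet2_inverse:
  assumes "jet2 f a b c" "a \<noteq> 0"
  shows "jet2 (\<lambda>s. inverse (f s)) (inverse a) (- b / a\<^sup>2) (2 * b\<^sup>2 / a ^ 3 - c / a\<^sup>2)"
proof -
  obtain f' where f: "\<forall>\<^sub>F s in nhds 0. (f has_real_derivative f' s) (at s)"
      "f 0 = a" "f' 0 = b" "(f' has_real_derivative c) (at 0)"
    using assms unfolding jet2_def by blast
  have f0: "(f has_real_derivative f' 0) (at 0)" using eventually_nhds_x_imp_x[OF f(1)] .
  then have "isCont f 0" by (rule DERIV_isCont)
  then have nz: "\<forall>\<^sub>F s in nhds 0. f s \<noteq> 0"
    using f(2) assms(2) unfolding isCont_def by (simp add: eventually_nhds_conv_at tendsto_imp_eventually_ne)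
  show ?thesis
  proof (rule jet2I[where f' = "\<lambda>s. - (inverse (f s) * f' s * inverse (f s))"])
    show "\<forall>\<^sub>F s in nhds 0. ((\<lambda>s. inverse (f s)) has_real_derivative
        - (inverse (f s) * f' s * inverse (f s))) (at s)"
      using f(1) nz by eventually_elim (rule DERIV_inverse')
    show "((\<lambda>s. - (inverse (f s) * f' s * inverse (f s))) has_real_derivative
        2 * b\<^sup>2 / a ^ 3 - c / a\<^sup>2) (at 0)"
      using assms(2)
      by (auto intro!: derivative_eq_intros f(4) f0 simp: f)
        (simp add: field_simps power2_eq_square power3_eq_cube)
  qed (simp_all add: f field_simps power2_eq_square)
qed

text \<open>The case of value 1 and slope 0 is the one that occurs: the gradient of the graph
  function vanishes at the base point.\<close>

lemma jet2_sqrt1: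
  assumes "jet2 f 1 0 c"
  shows "jet2 (\<lambda>s. sqrt (f s)) 1 0 (c / 2)"
proof -
  obtain f' where f: "\<forall>\<^sub>F s in nhds 0. (f has_real_derivative f' s) (at s)"
      "f 0 = 1" "f' 0 = 0" "(f' has_real_derivative c) (at 0)"
    using assms unfolding jet2_def by blast
  have f0: "(f has_real_derivative f' 0) (at 0)" using eventually_nhds_x_imp_x[OF f(1)] .
  then have "isCont f 0" by (rule DERIV_isCont)
  then have "(f \<longlongrightarrow> f 0) (nhds 0)" unfolding isCont_def tendsto_at_iff_tendsto_nhds .
  then have pos: "\<forall>\<^sub>F s in nhds 0. f s > 0"
    using f(2) by (auto intro: order_tendstoD(1))
  show ?thesis
  proof (rule jet2I[where f' = "\<lambda>s. f' s * (inverse (sqrt (f s)) / 2)"])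
    show "\<forall>\<^sub>F s in nhds 0. ((\<lambda>s. sqrt (f s)) has_real_derivative f' s * (inverse (sqrt (f s)) / 2)) (at s)"
      using f(1) pos
    proof eventually_elim
      case (elim s)
      show ?case
        using DERIV_chain2[OF DERIV_real_sqrt[OF elim(2)] elim(1)] by (simp add: mult.commute)
    qed
    show "((\<lambda>s. f' s * (inverse (sqrt (f s)) / 2)) has_real_derivative c / 2) (at 0)"
      by (rule derivative_eq_intros refl f(4) f0 | simp add: f)+
  qed (simp_all add: f)
qed

lemma jet2_cong:
  assumes "\<forall>\<^sub>F s in nhds 0. f s = g s" "jet2 f a b c"
  shows "jet2 g a b c"
proof -
  obtain f' where f: "\<forall>\<^sub>F s in nhds 0. (f has_real_derivative f' s) (at s)"
      "f 0 = a" "f' 0 = b" "(f' has_real_derivative c) (at 0)"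
    using assms unfolding jet2_def by blast
  \<comment> \<open>The derivatives at all nearby points are compared, so the two functions have to
    agree near each such point and not only at it.\<close>
  have "\<forall>\<^sub>F s in nhds 0. \<forall>\<^sub>F r in nhds s. f r = g r"
    using assms(1) by (simp add: eventually_eventually)
  then have "\<forall>\<^sub>F s in nhds 0. (g has_real_derivative f' s) (at s)"
    using f(1) by eventually_elim (use DERIV_cong_ev in blast)
  then show ?thesis
    using f eventually_nhds_x_imp_x[OF assms(1)] by (intro jet2I[where f' = f']) auto
qed

lemma jet2_D1: "jet2 f a b c \<Longrightarrow> (f has_real_derivative b) (at 0)"
  unfolding jet2_def by (auto dest: eventually_nhds_x_imp_x)

text \<open>Used to identify the derivatives of an abstract \<open>C^2\<close> function with those
  computed from an explicit formula for it.\<close>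

lemma jet2_unique:
  assumes "jet2 f a b c" "jet2 f a' b' c'"
  shows "a = a' \<and> b = b' \<and> c = c'"
proof -
  obtain f' where f: "\<forall>\<^sub>F s in nhds 0. (f has_real_derivative f' s) (at s)"
      "f 0 = a" "f' 0 = b" "(f' has_real_derivative c) (at 0)"
    using assms unfolding jet2_def by blast
  obtain g' where g: "\<forall>\<^sub>F s in nhds 0. (f has_real_derivative g' s) (at s)"
      "f 0 = a'" "g' 0 = b'" "(g' has_real_derivative c') (at 0)"
    using assms unfolding jet2_def by blast
  have ev: "\<forall>\<^sub>F s in nhds 0. f' s = g' s"
    using f(1) g(1) by eventually_elim (rule DERIV_unique)
  then have "(g' has_real_derivative c) (at 0)" using f(4) DERIV_cong_ev by blast
  then have "c = c'" using g(4) by (rule DERIV_unique)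
  then show ?thesis using f g eventually_nhds_x_imp_x[OF ev] by auto
qed

lemma jet2_local_max:
  assumes j: "jet2 f a b c" and max: "\<forall>\<^sub>F s in nhds 0. f s \<le> f 0"
  shows "b = 0 \<and> c \<le> 0"
proof -
  obtain f' where f: "\<forall>\<^sub>F s in nhds 0. (f has_real_derivative f' s) (at s)"
      "f 0 = a" "f' 0 = b" "(f' has_real_derivative c) (at 0)"
    using j unfolding jet2_def by blast
  obtain d where d: "d > 0" "\<And>s. \<bar>s\<bar> < d \<Longrightarrow> f s \<le> f 0 \<and> (f has_real_derivative f' s) (at s)"
    using eventually_conj[OF max f(1)] unfolding eventually_nhds_metric by (auto simp: dist_real_def)
  have b0: "b = 0"
    by (rule DERIV_local_max[OF jet2_D1[OF j] d(1)]) (use d(2) in auto)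
  have "c \<le> 0"
  proof (rule ccontr)
    assume "\<not> c \<le> 0"
    then obtain e where e: "e > 0" "\<And>h. 0 < h \<Longrightarrow> h < e \<Longrightarrow> f' 0 < f' (0 + h)"
      using DERIV_pos_inc_right[OF f(4)] by auto
    define h where "h = min d e / 2"
    have h: "0 < h" "h < d" "h < e" using d(1) e(1) by (auto simp: h_def)
    obtain z where z: "0 < z" "z < h" "f h - f 0 = (h - 0) * f' z"
      using MVT2[of 0 h f f'] h d(2) by auto
    have "f' z > 0" using e(2)[of z] z h f(3) b0 by auto
    then have "f h > f 0" using z h by (smt (verit) mult_pos_pos)
    then show False using d(2)[of h] h by auto
  qed
  then show ?thesis using b0 by simp
qed

lemma jet2_Ck_line:
  fixes f :: "'a::euclidean_space \<Rightarrow> real"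
  assumes S: "open S" "x \<in> S" and C: "Ck_on (Suc (Suc k)) f S"
  shows "jet2 (\<lambda>s. f (x + s *\<^sub>R v)) (f x) (dirD S v f x) (dirD S v (dirD S v f) x)"
proof -
  have "((\<lambda>s. x + s *\<^sub>R v) \<longlongrightarrow> x + 0 *\<^sub>R v) (nhds 0)"
    by (intro tendsto_intros) (simp add: filterlim_ident)
  then have "\<forall>\<^sub>F s in nhds 0. x + s *\<^sub>R v \<in> S"
    using S by (auto dest: topological_tendstoD)
  then obtain d where d: "d > 0" "\<And>s. \<bar>s\<bar> < d \<Longrightarrow> x + s *\<^sub>R v \<in> S"
    unfolding eventually_nhds_metric by (auto simp: dist_real_def)
  have *: "((\<lambda>s. g (x + s *\<^sub>R v)) has_real_derivative dirD S v g (x + s *\<^sub>R v)) (at s)"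
    if "\<bar>s\<bar> < d" "Ck_on (Suc m) g S" for s m and g :: "'a \<Rightarrow> real"
  proof -
    have "((\<lambda>s. g (x + s *\<^sub>R v)) has_vector_derivative dirD S v g (x + s *\<^sub>R v)) (at s within ball 0 d)"
      using d that by (intro Ck_on_line_derivative) auto
    then show ?thesis
      using that(1) at_within_open[of s "ball 0 d"]
      by (simp add: has_real_derivative_iff_has_vector_derivative)
  qed
  show ?thesis
  proof (rule jet2I[where f' = "\<lambda>s. dirD S v f (x + s *\<^sub>R v)"])
    show "\<forall>\<^sub>F s in nhds 0. ((\<lambda>s. f (x + s *\<^sub>R v)) has_real_derivative dirD S v f (x + s *\<^sub>R v)) (at s)"
      unfolding eventually_nhds_metric using d(1) *[OF _ C] by (auto simp: dist_real_def)
    show "((\<lambda>s. dirD S v f (x + s *\<^sub>R v)) has_real_derivative dirD S v (dirD S v f) x) (at 0)"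
      using *[OF _ Ck_on_dirD[OF C], of 0] d(1) by simp
  qed simp_all
qed

section \<open>Linear algebra\<close>

text \<open>The 3 by 3 determinant as a trilinear function of its rows. Below, \<open>pE1\<close>,
  \<open>pE2\<close> and \<open>pE3\<close> are coefficients of det (h + s g); divided by det g they
  are the elementary symmetric functions of the eigenvalues, with no eigenvalue having to be
  chosen.\<close>

definition md :: "real^3 \<Rightarrow> real^3 \<Rightarrow> real^3 \<Rightarrow> real" where
  "md x y z = x$1 * y$2 * z$3 + x$2 * y$3 * z$1 + x$3 * y$1 * z$2
     - x$1 * y$3 * z$2 - x$2 * y$1 * z$3 - x$3 * y$2 * z$1"

definition pE1 :: "real^3^3 \<Rightarrow> real^3^3 \<Rightarrow> real" where
  "pE1 g h = md (h$1) (g$2) (g$3) + md (g$1) (h$2) (g$3) + md (g$1) (g$2) (h$3)"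

definition pE2 :: "real^3^3 \<Rightarrow> real^3^3 \<Rightarrow> real" where
  "pE2 g h = md (g$1) (h$2) (h$3) + md (h$1) (g$2) (h$3) + md (h$1) (h$2) (g$3)"

definition pE3 :: "real^3^3 \<Rightarrow> real" where
  "pE3 h = md (h$1) (h$2) (h$3)"

definition esym1 :: "real^3 \<Rightarrow> real" where "esym1 l = l$1 + l$2 + l$3"
definition esym2 :: "real^3 \<Rightarrow> real" where "esym2 l = l$1 * l$2 + l$1 * l$3 + l$2 * l$3"
definition esym3 :: "real^3 \<Rightarrow> real" where "esym3 l = l$1 * l$2 * l$3"

lemma det_md: "det A = md (A$1) (A$2) (A$3)"
  by (simp add: det_3 md_def algebra_simps)

lemma det_pencil:
  "det (h + s *\<^sub>R g) = pE3 h + s * pE2 g h + s\<^sup>2 * pE1 g h + s ^ 3 * pE3 g"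
  by (simp add: det_md pE1_def pE2_def pE3_def md_def power2_eq_square power3_eq_cube algebra_simps)

text \<open>Congruence by the matrix \<open>P\<close> of eigenvectors turns \<open>g\<close> into
  the identity and \<open>h + s g\<close> into a diagonal matrix; the factor (det P)^2 is the same
  for both.\<close>

lemma eigenvalues_wrt_det:
  assumes "eigenvalues_wrt g h l"
  shows "det g > 0" "det (h + s *\<^sub>R g) = det g * ((l$1 + s) * (l$2 + s) * (l$3 + s))"
proof -
  obtain e :: "3 \<Rightarrow> real^3" where e: "\<And>i j. e i \<bullet> (g *v e j) = (if i = j then 1 else 0)"
    "\<And>i. h *v e i = l $ i *\<^sub>R (g *v e i)"
    using assms unfolding eigenvalues_wrt_def by blast
  define P :: "real^3^3" where "P = (\<chi> a i. e i $ a)"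
  have col: "(transpose P ** B ** P) $ i $ j = e i \<bullet> (B *v e j)" for B i j
    by (simp add: P_def matrix_matrix_mult_def matrix_vector_mult_def transpose_def inner_vec_def
        sum_distrib_left sum_distrib_right sum_3 algebra_simps)
  have 1: "transpose P ** g ** P = mat 1"
    by (simp add: vec_eq_iff col e mat_def)
  have "det (transpose P ** g ** P) = 1" by (simp add: 1)
  then have dg: "(det P)\<^sup>2 * det g = 1"
    by (simp add: det_mul power2_eq_square mult_ac)
  have P0: "(det P)\<^sup>2 > 0" using dg by (cases "det P = 0") auto
  show "det g > 0" using dg P0 by (metis zero_less_mult_pos zero_less_one)
  have 2: "(h + s *\<^sub>R g) *v e j = (l$j + s) *\<^sub>R (g *v e j)" for j
    by (simp add: matrix_vector_mult_add_rdistrib e scaleR_matrix_vector_assoc[symmetric] scaleR_left_distrib)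
  have 3: "(transpose P ** (h + s *\<^sub>R g) ** P) $ i $ j = (if i = j then l$i + s else 0)" for i j
    by (auto simp: col 2 e)
  have "det (transpose P ** (h + s *\<^sub>R g) ** P) = (l$1 + s) * (l$2 + s) * (l$3 + s)"
    by (simp add: det_3 3)
  then have "(det P)\<^sup>2 * det (h + s *\<^sub>R g) = (l$1 + s) * (l$2 + s) * (l$3 + s)"
    by (simp add: det_mul power2_eq_square mult_ac)
  then have "(det P)\<^sup>2 * det (h + s *\<^sub>R g) = (det P)\<^sup>2 * (det g * ((l$1 + s) * (l$2 + s) * (l$3 + s)))"
    using dg by (metis mult.assoc mult.left_neutral)
  then show "det (h + s *\<^sub>R g) = det g * ((l$1 + s) * (l$2 + s) * (l$3 + s))" using P0 by simp
qed

text \<open>Both expressions for det (h + s g) are cubic in \<open>s\<close> with leading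
  coefficient det g, so their values at 0, 1 and -1 determine the other three coefficients.\<close>

lemma eigenvalues_wrt_esym:
  assumes "eigenvalues_wrt g h l"
  shows "pE1 g h = det g * esym1 l" "pE2 g h = det g * esym2 l" "pE3 h = det g * esym3 l"
proof -
  have p: "pE3 h + s * pE2 g h + s\<^sup>2 * pE1 g h + s ^ 3 * det g =
      det g * ((l$1 + s) * (l$2 + s) * (l$3 + s))" for s
    using eigenvalues_wrt_det(2)[OF assms, of s] det_pencil[of h s g] by (simp add: pE3_def det_md)
  show 3: "pE3 h = det g * esym3 l" using p[of 0] by (simp add: esym3_def)
  show "pE1 g h = det g * esym1 l" "pE2 g h = det g * esym2 l"
    using p[of 1] p[of "-1"] 3 by (simp_all add: esym1_def esym2_def esym3_def algebra_simps)
qed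

lemma pE_scale:
  "pE1 g (c *\<^sub>R h) = c * pE1 g h" "pE2 g (c *\<^sub>R h) = c\<^sup>2 * pE2 g h" "pE3 (c *\<^sub>R h) = c ^ 3 * pE3 h"
  by (simp_all add: pE1_def pE2_def pE3_def md_def power2_eq_square power3_eq_cube algebra_simps)

section \<open>Orthonormal frames and normal vectors in four dimensions\<close>

lemma orthonormal_expand_4:
  fixes E :: "3 \<Rightarrow> real^4"
  assumes "\<And>i j. E i \<bullet> E j = (if i = j then 1 else 0)" "\<And>i. E i \<bullet> N = 0" "N \<bullet> N = 1"
  shows "x = (\<Sum>i\<in>UNIV. (x \<bullet> E i) *\<^sub>R E i) + (x \<bullet> N) *\<^sub>R N"
proof -
  define Q :: "real^4^4" where
    "Q = (\<chi> i. if i = 1 then E 1 else if i = 2 then E 2 else if i = 3 then E 3 else N)"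
  have "(Q ** transpose Q) $ i $ j = Q $ i \<bullet> Q $ j" for i j
    by (simp add: matrix_matrix_mult_def transpose_def inner_vec_def)
  then have "Q ** transpose Q = mat 1"
    using assms by (simp add: vec_eq_iff forall_4 mat_def Q_def inner_commute)
  then have "transpose Q ** Q = mat 1" by (simp only: matrix_left_right_inverse)
  then have "x = transpose Q *v (Q *v x)" by (simp add: matrix_vector_mul_assoc)
  also have "\<dots> = (\<Sum>i\<in>UNIV. (x \<bullet> Q $ i) *\<^sub>R Q $ i)"
    by (simp add: vec_eq_iff matrix_vector_mult_def transpose_def inner_vec_def mult.commute)
  also have "\<dots> = (\<Sum>i\<in>UNIV. (x \<bullet> E i) *\<^sub>R E i) + (x \<bullet> N) *\<^sub>R N"
    by (simp add: sum_4 sum_3 Q_def)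
  finally show ?thesis .
qed

lemma orthonormal_inner_4:
  fixes E :: "3 \<Rightarrow> real^4"
  assumes "\<And>i j. E i \<bullet> E j = (if i = j then 1 else 0)" "\<And>i. E i \<bullet> N = 0" "N \<bullet> N = 1"
  shows "x \<bullet> y = (\<Sum>i\<in>UNIV. (x \<bullet> E i) * (y \<bullet> E i)) + (x \<bullet> N) * (y \<bullet> N)"
proof -
  have "x \<bullet> y = x \<bullet> ((\<Sum>i\<in>UNIV. (y \<bullet> E i) *\<^sub>R E i) + (y \<bullet> N) *\<^sub>R N)"
    using orthonormal_expand_4[OF assms, of y] by simp
  then show ?thesis by (simp add: inner_add_right inner_sum_right mult.commute)
qed

text \<open>The triple vector product of four-dimensional space, given by signed 3 by 3 minors.
  Applied to coordinate tangent vectors it yields a normal that is polynomial in the first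
  derivatives.\<close>

definition cross4 :: "real^4 \<Rightarrow> real^4 \<Rightarrow> real^4 \<Rightarrow> real^4" where
  "cross4 x y z = (\<chi> k.
     if k = 1 then md (\<chi> j. if j = 1 then x$2 else if j = 2 then x$3 else x$4)
       (\<chi> j. if j = 1 then y$2 else if j = 2 then y$3 else y$4) (\<chi> j. if j = 1 then z$2 else if j = 2 then z$3 else z$4)
     else if k = 2 then - md (\<chi> j. if j = 1 then x$1 else if j = 2 then x$3 else x$4)
       (\<chi> j. if j = 1 then y$1 else if j = 2 then y$3 else y$4) (\<chi> j. if j = 1 then z$1 else if j = 2 then z$3 else z$4)
     else if k = 3 then md (\<chi> j. if j = 1 then x$1 else if j = 2 then x$2 else x$4)
       (\<chi> j. if j = 1 then y$1 else if j = 2 then y$2 else y$4) (\<chi> j. if j = 1 then z$1 else if j = 2 then z$2 else z$4)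
     else - md (\<chi> j. if j = 1 then x$1 else if j = 2 then x$2 else x$3)
       (\<chi> j. if j = 1 then y$1 else if j = 2 then y$2 else y$3) (\<chi> j. if j = 1 then z$1 else if j = 2 then z$2 else z$3))"

lemma cross4_orthogonal:
  "cross4 x y z \<bullet> x = 0" "cross4 x y z \<bullet> y = 0" "cross4 x y z \<bullet> z = 0"
  by (simp_all add: cross4_def md_def inner_vec_def sum_4 algebra_simps)

text \<open>The right-hand side is the Gram determinant of the three vectors.\<close>

lemma cross4_norm:
  "cross4 x y z \<bullet> cross4 x y z =
    (x \<bullet> x) * (y \<bullet> y) * (z \<bullet> z) + 2 * (x \<bullet> y) * (y \<bullet> z) * (x \<bullet> z)
    - (x \<bullet> x) * (y \<bullet> z)\<^sup>2 - (y \<bullet> y) * (x \<bullet> z)\<^sup>2 - (z \<bullet> z) * (x \<bullet> y)\<^sup>2"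
  unfolding cross4_def md_def inner_vec_def sum_4 by (simp, algebra)

lemma cross4_nth:
  "cross4 x y z $ k =
    (if k = 1 then x$2*y$3*z$4 + x$3*y$4*z$2 + x$4*y$2*z$3 - x$2*y$4*z$3 - x$3*y$2*z$4 - x$4*y$3*z$2
     else if k = 2 then -(x$1*y$3*z$4 + x$3*y$4*z$1 + x$4*y$1*z$3 - x$1*y$4*z$3 - x$3*y$1*z$4 - x$4*y$3*z$1)
     else if k = 3 then x$1*y$2*z$4 + x$2*y$4*z$1 + x$4*y$1*z$2 - x$1*y$4*z$2 - x$2*y$1*z$4 - x$4*y$2*z$1
     else -(x$1*y$2*z$3 + x$2*y$3*z$1 + x$3*y$1*z$2 - x$1*y$3*z$2 - x$2*y$1*z$3 - x$3*y$2*z$1))"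
  by (simp add: cross4_def md_def)

section \<open>Jets of the elementary symmetric functions of the curvatures\<close>

lemma jet2_md:
  assumes "\<And>j. jet2 (\<lambda>s. x s $ j) (x0 $ j) (x1 $ j) (x2 $ j)"
    and "\<And>j. jet2 (\<lambda>s. y s $ j) (y0 $ j) (y1 $ j) (y2 $ j)"
    and "\<And>j. jet2 (\<lambda>s. z s $ j) (z0 $ j) (z1 $ j) (z2 $ j)"
  shows "jet2 (\<lambda>s. md (x s) (y s) (z s)) (md x0 y0 z0) (md x1 y0 z0 + md x0 y1 z0 + md x0 y0 z1)
    (md x2 y0 z0 + md x0 y2 z0 + md x0 y0 z2 + 2 * (md x1 y1 z0 + md x1 y0 z1 + md x0 y1 z1))"
  unfolding md_def
  by (rule jet2_eq, (rule jet2_diff jet2_add jet2_mult assms)+, simp_all add: algebra_simps)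

lemma derivative_md:
  assumes "\<And>j. ((\<lambda>s. x s $ j) has_real_derivative x1 $ j) (at t within I)"
    and "\<And>j. ((\<lambda>s. y s $ j) has_real_derivative y1 $ j) (at t within I)"
    and "\<And>j. ((\<lambda>s. z s $ j) has_real_derivative z1 $ j) (at t within I)"
  shows "((\<lambda>s. md (x s) (y s) (z s)) has_real_derivative
     md x1 (y t) (z t) + md (x t) y1 (z t) + md (x t) (y t) z1) (at t within I)"
  unfolding md_def
  by (rule DERIV_cong, (rule DERIV_diff DERIV_add DERIV_mult assms)+, simp add: algebra_simps)

context
  fixes g h :: "real \<Rightarrow> real^3^3" and l :: "real^3" and c A B :: "real^3^3"
  assumes jg: "\<And>i j. jet2 (\<lambda>s. g s $ i $ j) (if i = j then 1 else 0) 0 (c $ i $ j)"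
    and jh: "\<And>i j. jet2 (\<lambda>s. h s $ i $ j) (if i = j then l $ i else 0) (A $ i $ j) (B $ i $ j)"
    and symA: "\<And>i j. A $ i $ j = A $ j $ i"
begin

private definition g0 :: "real^3^3" where "g0 = (\<chi> i j. if i = j then 1 else 0)"
private definition h0 :: "real^3^3" where "h0 = (\<chi> i j. if i = j then l $ i else 0)"
private definition z0 :: "real^3^3" where "z0 = (\<chi> i j. 0)"

private lemma jg': "jet2 (\<lambda>s. g s $ i $ j) (g0 $ i $ j) (z0 $ i $ j) (c $ i $ j)" for i j :: 3
  using jg[of i j] by (simp add: g0_def z0_def)

private lemma jh': "jet2 (\<lambda>s. h s $ i $ j) (h0 $ i $ j) (A $ i $ j) (B $ i $ j)" for i j :: 3
  using jh[of i j] by (simp add: h0_def)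

text \<open>The second derivative of the \<open>i\<close>-th diagonal entry of the Weingarten map,
  the inverse of \<open>g\<close> times \<open>h\<close>: at 0 the metric is the identity with zero
  first derivative, so the inverse contributes only its second derivative, which is
  \<open>- c\<close>.\<close>

private abbreviation (input) "W i \<equiv> B $ i $ i - c $ i $ i * l $ i"

private lemmas jets = jet2_md[OF jg' jg' jg'] jet2_md[OF jg' jg' jh'] jet2_md[OF jg' jh' jg']
  jet2_md[OF jg' jh' jh'] jet2_md[OF jh' jg' jg'] jet2_md[OF jh' jg' jh'] jet2_md[OF jh' jh' jg']
  jet2_md[OF jh' jh' jh']

private lemma jD: "jet2 (\<lambda>s. pE3 (g s)) 1 0 (c$1$1 + c$2$2 + c$3$3)"
  unfolding pE3_def by (rule jet2_eq, rule jets) (simp_all add: md_def g0_def z0_def)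

lemma jet2_esym1:
  "jet2 (\<lambda>s. pE1 (g s) (h s) / pE3 (g s)) (l$1 + l$2 + l$3) (A$1$1 + A$2$2 + A$3$3) (W 1 + W 2 + W 3)"
  unfolding pE1_def divide_inverse
  by (rule jet2_eq, (rule jet2_mult jet2_add jets jet2_inverse[OF jD])+)
     (simp_all add: md_def g0_def z0_def h0_def algebra_simps)

text \<open>The part quadratic in \<open>A\<close> is twice its sum of principal 2 by 2 minors. No
  differences of eigenvalues appear in denominators, so coinciding curvatures need no separate
  treatment.\<close>

lemma jet2_esym2:
  "jet2 (\<lambda>s. pE2 (g s) (h s) / pE3 (g s)) (l$1 * l$2 + l$1 * l$3 + l$2 * l$3)
    ((l$2 + l$3) * A$1$1 + (l$1 + l$3) * A$2$2 + (l$1 + l$2) * A$3$3)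
    ((l$2 + l$3) * W 1 + (l$1 + l$3) * W 2 + (l$1 + l$2) * W 3 +
     2 * (A$1$1 * A$2$2 - (A$1$2)\<^sup>2 + A$1$1 * A$3$3 - (A$1$3)\<^sup>2 + A$2$2 * A$3$3 - (A$2$3)\<^sup>2))"
  unfolding pE2_def divide_inverse
  by (rule jet2_eq, (rule jet2_mult jet2_add jets jet2_inverse[OF jD])+)
     (simp_all add: md_def g0_def z0_def h0_def symA[of 2 1] symA[of 3 1] symA[of 3 2] power2_eq_square
       algebra_simps)

lemma jet2_esym3:
  "jet2 (\<lambda>s. pE3 (h s) / pE3 (g s)) (l$1 * l$2 * l$3)
    (l$2 * l$3 * A$1$1 + l$1 * l$3 * A$2$2 + l$1 * l$2 * A$3$3)
    (l$2 * l$3 * W 1 + l$1 * l$3 * W 2 + l$1 * l$2 * W 3 +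
     2 * (l$3 * (A$1$1 * A$2$2 - (A$1$2)\<^sup>2) + l$2 * (A$1$1 * A$3$3 - (A$1$3)\<^sup>2)
        + l$1 * (A$2$2 * A$3$3 - (A$2$3)\<^sup>2)))"
  unfolding pE3_def[of "h _"] divide_inverse
  by (rule jet2_eq, (rule jet2_mult jet2_add jets jet2_inverse[OF jD])+)
     (simp_all add: md_def g0_def z0_def h0_def symA[of 2 1] symA[of 3 1] symA[of 3 2] power2_eq_square
       algebra_simps)

end

section \<open>First derivatives of the symmetric functions in time\<close>

context
  fixes g h :: "real \<Rightarrow> real^3^3" and l :: "real^3" and G H :: "real^3^3" and t :: real and I :: "real set"
  assumes g: "\<And>i j. ((\<lambda>s. g s $ i $ j) has_real_derivative G $ i $ j) (at t within I)"
    and h: "\<And>i j. ((\<lambda>s. h s $ i $ j) has_real_derivative H $ i $ j) (at t within I)"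
    and g0: "\<And>i j. g t $ i $ j = (if i = j then 1 else 0)"
    and h0: "\<And>i j. h t $ i $ j = (if i = j then l $ i else 0)"
begin

private lemmas ders = derivative_md[OF g g g] derivative_md[OF g g h] derivative_md[OF g h g]
  derivative_md[OF g h h] derivative_md[OF h g g] derivative_md[OF h g h] derivative_md[OF h h g]
  derivative_md[OF h h h]

private lemma D1: "pE3 (g t) = 1" by (simp add: pE3_def md_def g0)

private lemma D: "((\<lambda>s. pE3 (g s)) has_real_derivative (G$1$1 + G$2$2 + G$3$3)) (at t within I)"
  unfolding pE3_def by (rule DERIV_cong, rule ders) (simp add: md_def g0)

lemma derivative_esym1:
  "((\<lambda>s. pE1 (g s) (h s) / pE3 (g s)) has_real_derivative
     (H$1$1 - G$1$1 * l$1) + (H$2$2 - G$2$2 * l$2) + (H$3$3 - G$3$3 * l$3)) (at t within I)"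
  unfolding pE1_def
  by (rule DERIV_cong, rule DERIV_divide, (rule DERIV_add ders D)+)
     (simp_all add: D1, simp add: md_def g0 h0 algebra_simps)

lemma derivative_esym2:
  "((\<lambda>s. pE2 (g s) (h s) / pE3 (g s)) has_real_derivative
     (l$2 + l$3) * (H$1$1 - G$1$1 * l$1) + (l$1 + l$3) * (H$2$2 - G$2$2 * l$2)
      + (l$1 + l$2) * (H$3$3 - G$3$3 * l$3)) (at t within I)"
  unfolding pE2_def
  by (rule DERIV_cong, rule DERIV_divide, (rule DERIV_add ders D)+)
     (simp_all add: D1, simp add: md_def g0 h0 algebra_simps)

lemma derivative_esym3:
  "((\<lambda>s. pE3 (h s) / pE3 (g s)) has_real_derivative
     l$2 * l$3 * (H$1$1 - G$1$1 * l$1) + l$1 * l$3 * (H$2$2 - G$2$2 * l$2)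
      + l$1 * l$2 * (H$3$3 - G$3$3 * l$3)) (at t within I)"
  unfolding pE3_def[of "h _"]
  by (rule DERIV_cong, rule DERIV_divide, (rule DERIV_add ders D)+)
     (simp_all add: D1, simp add: md_def g0 h0 algebra_simps)

end

section \<open>Parametrized solutions of the flow\<close>

lemma dirD_sum:
  fixes f :: "'i \<Rightarrow> 'a::euclidean_space \<Rightarrow> 'b::real_normed_vector"
  assumes "uniq_diff S" "\<And>i. i \<in> J \<Longrightarrow> Ck_on (Suc k) (f i) S" "x \<in> S"
  shows "dirD S v (\<lambda>x. \<Sum>i\<in>J. f i x) x = (\<Sum>i\<in>J. dirD S v (f i) x)"
  by (rule uniq_diff_deriv_eq[OF assms(1,3)], rule has_derivative_sum)
     (rule Ck_on_has_derivative[OF assms(2) assms(3)])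

lemma Ck_on_fst: "uniq_diff S \<Longrightarrow> Ck_on k fst S"
  by (rule Ck_on_linear[OF _ bounded_linear_fst])

lemma Ck_on_snd: "uniq_diff S \<Longrightarrow> Ck_on k snd S"
  by (rule Ck_on_linear[OF _ bounded_linear_snd])

lemma Ck_on_Pair:
  fixes f :: "'a::euclidean_space \<Rightarrow> 'b::euclidean_space" and g :: "'a \<Rightarrow> 'c::euclidean_space"
  assumes u: "uniq_diff S" and "Ck_on k f S" "Ck_on k g S"
  shows "Ck_on k (\<lambda>x. (f x, g x)) S"
proof -
  have "Ck_on k (\<lambda>x. (f x, 0) + (0, g x)) S"
    using assms
    by (intro Ck_on_add Ck_on_linear_comp[OF u, of "\<lambda>y. (y, 0)"] Ck_on_linear_comp[OF u, of "\<lambda>y. (0, y)"])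
       (auto intro: bounded_linear_Pair bounded_linear_ident bounded_linear_zero)
  then show ?thesis by simp
qed

lemma dirD_Pair:
  fixes f :: "'a::euclidean_space \<Rightarrow> 'b::euclidean_space" and g :: "'a \<Rightarrow> 'c::euclidean_space"
  assumes "uniq_diff S" "Ck_on (Suc k) f S" "Ck_on (Suc k) g S" "x \<in> S"
  shows "dirD S v (\<lambda>x. (f x, g x)) x = (dirD S v f x, dirD S v g x)"
  by (rule uniq_diff_deriv_eq[OF assms(1,4)], rule has_derivative_Pair)
     (rule Ck_on_has_derivative[OF assms(2,4)], rule Ck_on_has_derivative[OF assms(3,4)])

lemma dirD_const: "uniq_diff S \<Longrightarrow> x \<in> S \<Longrightarrow> dirD S v (\<lambda>x. c) x = 0"
  using uniq_diff_deriv_eq[of S x "\<lambda>x. c" "\<lambda>_. 0" v] by simp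

section \<open>Restriction of space-time maps to a fixed time or a fixed point\<close>

lemma Ck_on_slice:
  fixes F :: "'a::euclidean_space \<times> real \<Rightarrow> 'b::real_normed_vector"
  assumes "open V" "t \<in> I" "Ck_on k F (V \<times> I)"
  shows "Ck_on k (\<lambda>z. F (z, t)) V"
proof -
  have u: "uniq_diff V" by (rule uniq_diff_open[OF assms(1)])
  show ?thesis
    by (rule Ck_on_compose[OF u _ assms(3) Ck_on_Pair[OF u Ck_on_id[OF u] Ck_on_const[OF u]]])
       (use assms(2) in auto)
qed

lemma dirD_slice:
  fixes F :: "'a::euclidean_space \<times> real \<Rightarrow> 'b::real_normed_vector"
  assumes V: "open V" and t: "t \<in> I" and F: "Ck_on (Suc k) F (V \<times> I)" and z: "z \<in> V"
  shows "dirD V v (\<lambda>z. F (z, t)) z = dirD (V \<times> I) (v, 0) F (z, t)"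
proof -
  have u: "uniq_diff V" by (rule uniq_diff_open[OF V])
  have id: "Ck_on (Suc k) (\<lambda>z. z) V" and c: "Ck_on (Suc k) (\<lambda>z. t) V"
    by (rule Ck_on_id[OF u], rule Ck_on_const[OF u])
  have "dirD V v (\<lambda>z. z) z = v"
    using uniq_diff_deriv_eq[OF u z, of "\<lambda>z. z" "\<lambda>v. v"] by simp
  then have "dirD V v (\<lambda>z. (z, t)) z = (v, 0)"
    using dirD_Pair[OF u id c z] dirD_const[OF u z] by simp
  then show ?thesis
    using dirD_compose[OF u _ F Ck_on_Pair[OF u id c] z, of v] t by auto
qed

lemma Ck_on_time_derivative:
  fixes F :: "'a::euclidean_space \<times> real \<Rightarrow> 'b::real_normed_vector"
  assumes "Ck_on (Suc k) F (V \<times> I)" "z \<in> V" "t \<in> I"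
  shows "((\<lambda>s. F (z, s)) has_vector_derivative dirD (V \<times> I) (0, 1) F (z, t)) (at t within I)"
  using Ck_on_line_derivative[OF assms(1), of "(z, 0)" t "(0, 1)" I] assms(2,3) by simp

definition par :: "((real^3) \<times> real) set \<Rightarrow> ((real^3) \<times> real \<Rightarrow> real^4) \<Rightarrow> 3 \<Rightarrow> (real^3) \<times> real \<Rightarrow> real^4" where
  "par S Y i = dirD S (axis i 1, 0) Y"

definition par2 :: "((real^3) \<times> real) set \<Rightarrow> ((real^3) \<times> real \<Rightarrow> real^4) \<Rightarrow> 3 \<Rightarrow> 3 \<Rightarrow> (real^3) \<times> real \<Rightarrow> real^4" where
  "par2 S Y i j = dirD S (axis j 1, 0) (par S Y i)"

definition gram :: "((real^3) \<times> real) set \<Rightarrow> ((real^3) \<times> real \<Rightarrow> real^4) \<Rightarrow> (real^3) \<times> real \<Rightarrow> real^3^3" where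
  "gram S Y p = (\<chi> i j. par S Y i p \<bullet> par S Y j p)"

definition sff :: "((real^3) \<times> real) set \<Rightarrow> ((real^3) \<times> real \<Rightarrow> real^4) \<Rightarrow> real^4 \<Rightarrow> (real^3) \<times> real \<Rightarrow> real^3^3" where
  "sff S Y n p = (\<chi> i j. - (par2 S Y i j p \<bullet> n))"

text \<open>A change of coordinates acts on both forms by congruence with its Jacobian; the inverse
  Jacobian carries the eigenvectors along and leaves the eigenvalues alone.\<close>

lemma eigenvalues_wrt_congruence:
  assumes "eigenvalues_wrt g h l" "invertible A"
  shows "eigenvalues_wrt (transpose A ** g ** A) (transpose A ** h ** A) l"
proof -
  obtain e :: "3 \<Rightarrow> real^3" where e: "\<And>i j. e i \<bullet> (g *v e j) = (if i = j then 1 else 0)"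
    "\<And>i. h *v e i = l $ i *\<^sub>R (g *v e i)"
    using assms unfolding eigenvalues_wrt_def by blast
  obtain B where B: "A ** B = mat 1" using assms(2) unfolding invertible_def by blast
  have AB: "A *v (B *v x) = x" for x by (simp add: matrix_vector_mul_assoc B)
  have tr: "x \<bullet> (transpose A *v y) = (A *v x) \<bullet> y" for x y
    by (metis dot_lmul_matrix inner_commute vector_transpose_matrix)
  have 1: "(transpose A ** g ** A) *v (B *v x) = transpose A *v (g *v x)" for x g
    by (simp add: AB flip: matrix_vector_mul_assoc)
  have "(B *v e i) \<bullet> ((transpose A ** g ** A) *v (B *v e j)) = (if i = j then 1 else 0)" for i j
    by (simp only: 1 tr AB e(1))
  moreover have "(transpose A ** h ** A) *v (B *v e i) = l $ i *\<^sub>R ((transpose A ** g ** A) *v (B *v e i))" for i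
    by (simp only: 1 e(2) matrix_vector_mult_scaleR)
  ultimately show ?thesis unfolding eigenvalues_wrt_def by (intro exI[of _ "\<lambda>i. B *v e i"]) auto
qed

text \<open>The flow as seen in one chart, as a map on space-time. \<open>N\<close> and \<kappa> are
  constrained only pointwise, as in the definition of the flow. Assumption \<open>fwd\<close> makes
  room for the forward squares on which mixed space-time derivatives are compared.\<close>

locale flow_param =
  fixes V :: "(real^3) set" and I :: "real set" and Y N :: "(real^3) \<times> real \<Rightarrow> real^4"
    and \<kappa> :: "(real^3) \<times> real \<Rightarrow> real^3"
  assumes openV: "open V" and I: "uniq_diff I"
    and fwd: "\<And>t. t \<in> I \<Longrightarrow> \<exists>e>0. \<forall>s. 0 \<le> s \<and> s < e \<longrightarrow> t + s \<in> I"
    and Y: "Ck_on 6 Y (V \<times> I)"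
    and N1: "\<And>p. p \<in> V \<times> I \<Longrightarrow> N p \<bullet> N p = 1"
    and tang: "\<And>p i. p \<in> V \<times> I \<Longrightarrow> par (V \<times> I) Y i p \<bullet> N p = 0"
    and eig: "\<And>p. p \<in> V \<times> I \<Longrightarrow> eigenvalues_wrt (gram (V \<times> I) Y p) (sff (V \<times> I) Y (N p) p) (\<kappa> p)"
    and pos: "\<And>p i. p \<in> V \<times> I \<Longrightarrow> \<kappa> p $ i > 0"
    and flow: "\<And>p. p \<in> V \<times> I \<Longrightarrow> dirD (V \<times> I) (0, 1) Y p = - norm_A_squared (\<kappa> p) *\<^sub>R N p"
begin

abbreviation "S \<equiv> V \<times> I"
abbreviation "pr \<equiv> par S Y"
abbreviation "pr2 \<equiv> par2 S Y"
abbreviation "gm \<equiv> gram S Y"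
abbreviation "hm p \<equiv> sff S Y (N p) p"

lemma uS: "uniq_diff S" by (rule uniq_diff_Times[OF uniq_diff_open[OF openV] I])
lemma uV: "uniq_diff V" by (rule uniq_diff_open[OF openV])

lemma Y_Ck: "k \<le> 6 \<Longrightarrow> Ck_on k Y S" by (rule Ck_on_le[OF Y])

lemma pr_Ck: "k \<le> 5 \<Longrightarrow> Ck_on k (pr i) S"
  unfolding par_def by (rule Ck_on_dirD[OF Y_Ck]) simp

lemma pr2_Ck: "k \<le> 4 \<Longrightarrow> Ck_on k (pr2 i j) S"
  unfolding par2_def by (rule Ck_on_dirD[OF pr_Ck]) simp

text \<open>An unnormalized normal that is visibly differentiable, in contrast to \<open>N\<close>.
  \<open>hc\<close> is the second fundamental form taken with it, and \<open>D\<close> is its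
  squared length.\<close>

definition "cr p = cross4 (pr 1 p) (pr 2 p) (pr 3 p)"
definition "hc p = sff S Y (cr p) p"
definition "D p = pE3 (gm p)"

lemma cr_Ck: "k \<le> 5 \<Longrightarrow> Ck_on k cr S"
proof -
  assume k: "k \<le> 5"
  have "Ck_on k (\<lambda>p. cr p $ i) S" for i
    unfolding cr_def cross4_nth using exhaust_4[of i]
    by (auto intro!: Ck_on_diff Ck_on_add Ck_on_mult Ck_on_uminus Ck_on_vec_nth uS pr_Ck[OF k])
  from Ck_on_vec_lambda[OF uS, of k "\<lambda>p i. cr p $ i", OF this] show ?thesis by (simp add: vec_lambda_eta)
qed

lemma gm_Ck: "k \<le> 5 \<Longrightarrow> Ck_on k (\<lambda>p. gm p $ i $ j) S"
  by (simp add: gram_def Ck_on_inner uS pr_Ck)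

lemma hc_Ck: "k \<le> 4 \<Longrightarrow> Ck_on k (\<lambda>p. hc p $ i $ j) S"
  by (simp add: hc_def sff_def Ck_on_inner Ck_on_uminus uS pr2_Ck cr_Ck)

lemma D_Ck: "k \<le> 5 \<Longrightarrow> Ck_on k D S"
  unfolding D_def pE3_def md_def by (intro Ck_on_diff Ck_on_add Ck_on_mult uS gm_Ck)

lemma pE_Ck: assumes "k \<le> 4"
  shows "Ck_on k (\<lambda>p. pE1 (gm p) (hc p)) S" "Ck_on k (\<lambda>p. pE2 (gm p) (hc p)) S" "Ck_on k (\<lambda>p. pE3 (hc p)) S"
proof -
  have *: "Ck_on k (\<lambda>p. gm p $ i $ j) S" "Ck_on k (\<lambda>p. hc p $ i $ j) S" for i j
    using assms gm_Ck[of k] hc_Ck[of k] by auto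
  show "Ck_on k (\<lambda>p. pE1 (gm p) (hc p)) S" "Ck_on k (\<lambda>p. pE2 (gm p) (hc p)) S" "Ck_on k (\<lambda>p. pE3 (hc p)) S"
    unfolding pE1_def pE2_def pE3_def md_def by (intro Ck_on_diff Ck_on_add Ck_on_mult uS *)+
qed

lemma D_pos: "p \<in> S \<Longrightarrow> D p > 0"
  using eigenvalues_wrt_det(1)[OF eig] by (simp add: D_def pE3_def det_md)

lemma cr_sq: "cr p \<bullet> cr p = D p"
  by (simp add: cr_def cross4_norm D_def pE3_def md_def gram_def inner_commute power2_eq_square algebra_simps)

lemma tangent_frame:
  assumes "p \<in> S"
  obtains e :: "3 \<Rightarrow> real^3" and E :: "3 \<Rightarrow> real^4"
  where "\<And>i j. e i \<bullet> (gm p *v e j) = (if i = j then 1 else 0)"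
    "\<And>i. hm p *v e i = \<kappa> p $ i *\<^sub>R (gm p *v e i)"
    "\<And>i. E i = (\<Sum>a\<in>UNIV. e i $ a *\<^sub>R pr a p)"
    "\<And>i j. E i \<bullet> E j = (if i = j then 1 else 0)" "\<And>i. E i \<bullet> N p = 0"
proof -
  obtain e :: "3 \<Rightarrow> real^3" where e: "\<And>i j. e i \<bullet> (gm p *v e j) = (if i = j then 1 else 0)"
    "\<And>i. hm p *v e i = \<kappa> p $ i *\<^sub>R (gm p *v e i)"
    using eig[OF assms] unfolding eigenvalues_wrt_def by blast
  define E where "E i = (\<Sum>a\<in>UNIV. e i $ a *\<^sub>R pr a p)" for i
  have "E i \<bullet> E j = e i \<bullet> (gm p *v e j)" for i j
    by (simp add: E_def inner_sum_left inner_sum_right gram_def matrix_vector_mult_def inner_vec_def[of "e i"]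
        sum_distrib_left sum_3 algebra_simps inner_commute)
  then have "E i \<bullet> E j = (if i = j then 1 else 0)" for i j using e by simp
  moreover have "E i \<bullet> N p = 0" for i
    by (simp add: E_def inner_sum_left tang[OF assms])
  ultimately show thesis using that[OF e E_def] by blast
qed

text \<open>Both vectors are orthogonal to the three-dimensional tangent space, so they are
  proportional; the length of \<open>cr p\<close> is the square root of \<open>D p\<close>.\<close>

lemma normal_cr:
  assumes p: "p \<in> S"
  shows "\<exists>\<sigma>. \<sigma>\<^sup>2 = 1 \<and> N p = (\<sigma> / sqrt (D p)) *\<^sub>R cr p"
proof -
  obtain e :: "3 \<Rightarrow> real^3" and E :: "3 \<Rightarrow> real^4" where E: "\<And>i. E i = (\<Sum>a\<in>UNIV. e i $ a *\<^sub>R pr a p)"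
    "\<And>i j. E i \<bullet> E j = (if i = j then 1 else 0)" "\<And>i. E i \<bullet> N p = 0"
    by (rule tangent_frame[OF p]) blast
  have "cr p \<bullet> pr a p = 0" for a
    using exhaust_3[of a] by (auto simp: cr_def cross4_orthogonal)
  then have "cr p \<bullet> E i = 0" for i by (simp add: E inner_sum_right)
  then have c: "cr p = (cr p \<bullet> N p) *\<^sub>R N p"
    using orthonormal_expand_4[OF E(2,3) N1[OF p], of "cr p"] by simp
  then have "cr p \<bullet> cr p = (cr p \<bullet> N p)\<^sup>2"
    by (metis N1[OF p] inner_scaleR_left inner_scaleR_right mult.right_neutral power2_eq_square)
  then have sq: "(cr p \<bullet> N p)\<^sup>2 = D p" by (simp add: cr_sq)
  define \<sigma> where "\<sigma> = (cr p \<bullet> N p) / sqrt (D p)"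
  have "\<sigma>\<^sup>2 = 1" using sq D_pos[OF p] by (simp add: \<sigma>_def power_divide)
  moreover have "N p = (\<sigma> / sqrt (D p)) *\<^sub>R cr p"
  proof -
    have "(\<sigma> / sqrt (D p)) *\<^sub>R cr p = ((cr p \<bullet> N p)\<^sup>2 / D p) *\<^sub>R N p"
      using D_pos[OF p] by (subst c) (simp add: \<sigma>_def power2_eq_square)
    then show ?thesis using sq D_pos[OF p] by simp
  qed
  ultimately show ?thesis by blast
qed

lemma esym_pos: "p \<in> S \<Longrightarrow> esym1 (\<kappa> p) > 0" "p \<in> S \<Longrightarrow> esym2 (\<kappa> p) > 0" "p \<in> S \<Longrightarrow> esym3 (\<kappa> p) > 0"
  by (simp_all add: esym1_def esym2_def esym3_def pos add_pos_pos)

text \<open>The mean curvature with respect to \<open>N\<close> is positive by convexity, so the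
  sign of \<open>pE1 (gm p) (hc p)\<close> tells whether \<open>cr p\<close> points along
  \<open>N p\<close> or against it. Functions of odd degree in the curvatures feel this sign and
  take absolute values; \<open>esym2\<close> does not.\<close>

lemma normal_eq:
  assumes p: "p \<in> S"
  shows "pE1 (gm p) (hc p) \<noteq> 0"
    "N p = (sgn (pE1 (gm p) (hc p)) / sqrt (D p)) *\<^sub>R cr p"
    "esym1 (\<kappa> p) = \<bar>pE1 (gm p) (hc p)\<bar> / (D p * sqrt (D p))"
    "esym2 (\<kappa> p) = pE2 (gm p) (hc p) / (D p)\<^sup>2"
    "esym3 (\<kappa> p) = \<bar>pE3 (hc p)\<bar> / ((D p)\<^sup>2 * sqrt (D p))"
proof -
  obtain \<sigma> where \<sigma>: "\<sigma>\<^sup>2 = 1" "N p = (\<sigma> / sqrt (D p)) *\<^sub>R cr p" using normal_cr[OF p] by blast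
  have Dp: "D p > 0" "sqrt (D p) > 0" "sqrt (D p) * sqrt (D p) = D p" using D_pos[OF p] by auto
  have \<sigma>': "\<sigma> = 1 \<or> \<sigma> = -1" using \<sigma>(1) by (simp add: power2_eq_1_iff)
  have hm: "hm p = (\<sigma> / sqrt (D p)) *\<^sub>R hc p"
    by (simp add: vec_eq_iff sff_def hc_def \<sigma>(2))
  have dD: "det (gm p) = D p" by (simp add: D_def pE3_def det_md)
  note es = eigenvalues_wrt_esym[OF eig[OF p], unfolded hm pE_scale dD]
  have "\<sigma> * pE1 (gm p) (hc p) / sqrt (D p) > 0"
    using es(1) esym_pos(1)[OF p] Dp by simp
  then have s1: "\<sigma> * pE1 (gm p) (hc p) > 0" using Dp(2) by (simp add: zero_less_divide_iff)
  then show "pE1 (gm p) (hc p) \<noteq> 0" by auto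
  have sg: "\<sigma> = sgn (pE1 (gm p) (hc p))" using s1 \<sigma>' by (auto simp: sgn_if)
  then show "N p = (sgn (pE1 (gm p) (hc p)) / sqrt (D p)) *\<^sub>R cr p" using \<sigma>(2) by simp
  have a1: "\<sigma> * pE1 (gm p) (hc p) = \<bar>pE1 (gm p) (hc p)\<bar>" using s1 \<sigma>' by auto
  show "esym1 (\<kappa> p) = \<bar>pE1 (gm p) (hc p)\<bar> / (D p * sqrt (D p))"
    using es(1) Dp unfolding a1[symmetric] by (simp add: field_simps)
  show "esym2 (\<kappa> p) = pE2 (gm p) (hc p) / (D p)\<^sup>2"
    using es(2) Dp by (simp add: power_divide \<sigma>(1)) (simp add: field_simps power2_eq_square)
  have \<sigma>3: "\<sigma> ^ 3 = \<sigma>" using \<sigma>' by auto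
  have "sqrt (D p) ^ 3 = D p * sqrt (D p)" using Dp by (simp add: power3_eq_cube)
  then have e3: "\<sigma> * pE3 (hc p) / (D p * sqrt (D p)) = D p * esym3 (\<kappa> p)"
    using es(3) by (simp add: power_divide \<sigma>3)
  then have "\<sigma> * pE3 (hc p) = D p * esym3 (\<kappa> p) * (D p * sqrt (D p))"
    using Dp(1,2) by (simp add: divide_eq_eq)
  then have "\<sigma> * pE3 (hc p) > 0" using esym_pos(3)[OF p] Dp(1,2) by simp
  then have a3: "\<sigma> * pE3 (hc p) = \<bar>pE3 (hc p)\<bar>" using \<sigma>' by auto
  show "esym3 (\<kappa> p) = \<bar>pE3 (hc p)\<bar> / ((D p)\<^sup>2 * sqrt (D p))"
    using e3 Dp unfolding a3[symmetric] by (simp add: field_simps power2_eq_square)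
qed

lemma esym_continuous:
  "continuous_on S (\<lambda>p. esym1 (\<kappa> p))" "continuous_on S (\<lambda>p. esym2 (\<kappa> p))" "continuous_on S (\<lambda>p. esym3 (\<kappa> p))"
proof -
  have c: "continuous_on S D" "continuous_on S (\<lambda>p. pE1 (gm p) (hc p))"
    "continuous_on S (\<lambda>p. pE2 (gm p) (hc p))" "continuous_on S (\<lambda>p. pE3 (hc p))"
    using Ck_on_imp_continuous D_Ck[of 0] pE_Ck[of 0] by blast+
  have nz: "p \<in> S \<Longrightarrow> D p \<noteq> 0" for p using D_pos[of p] by simp
  have "continuous_on S (\<lambda>p. \<bar>pE1 (gm p) (hc p)\<bar> / (D p * sqrt (D p)))"
    "continuous_on S (\<lambda>p. pE2 (gm p) (hc p) / (D p)\<^sup>2)"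
    "continuous_on S (\<lambda>p. \<bar>pE3 (hc p)\<bar> / ((D p)\<^sup>2 * sqrt (D p)))"
    by (intro continuous_intros c; use nz in force)+
  note * = this
  show "continuous_on S (\<lambda>p. esym1 (\<kappa> p))"
    by (rule continuous_on_eq[OF *(1)]) (simp only: normal_eq(3))
  show "continuous_on S (\<lambda>p. esym2 (\<kappa> p))"
    by (rule continuous_on_eq[OF *(2)]) (simp only: normal_eq(4))
  show "continuous_on S (\<lambda>p. esym3 (\<kappa> p))"
    by (rule continuous_on_eq[OF *(3)]) (simp only: normal_eq(5))
qed

text \<open>Only even degrees enter, so square roots and absolute values cancel and a rational
  expression with denominators in \<open>D\<close> remains.\<close>

lemma pinching_Ck: "Ck_on 1 (\<lambda>p. 7 * (esym1 (\<kappa> p))\<^sup>2 - 25 * esym2 (\<kappa> p)) S"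
proof -
  have nz: "p \<in> S \<Longrightarrow> D p \<noteq> 0" for p using D_pos[of p] by simp
  have "Ck_on 1 (\<lambda>p. 7 * (pE1 (gm p) (hc p) * pE1 (gm p) (hc p) / (D p * (D p * D p)))
      - 25 * (pE2 (gm p) (hc p) / (D p * D p))) S"
    by (intro Ck_on_diff Ck_on_mult Ck_on_divide Ck_on_const uS D_Ck pE_Ck) (use nz in auto)
  moreover have "7 * (esym1 (\<kappa> p))\<^sup>2 - 25 * esym2 (\<kappa> p) =
     7 * (pE1 (gm p) (hc p) * pE1 (gm p) (hc p) / (D p * (D p * D p)))
      - 25 * (pE2 (gm p) (hc p) / (D p * D p))" if p: "p \<in> S" for p
    using D_pos[OF p]
    by (simp add: normal_eq[OF p] power_divide power_mult_distrib power2_eq_square mult_ac)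
  ultimately show ?thesis using Ck_on_cong[of S] by (metis (no_types, lifting))
qed

text \<open>The sign in \<open>normal_eq\<close> is that of a continuous function without zeros,
  hence constant near \<open>p0\<close>. Freezing it at \<open>p0\<close> gives a differentiable
  field that agrees with \<open>N\<close> near \<open>p0\<close>.\<close>

lemma normal_locally_Ck:
  assumes p0: "p0 \<in> S"
  obtains m where "Ck_on 1 m S" "\<forall>\<^sub>F p in at p0 within S. N p = m p" "N p0 = m p0"
proof -
  define \<sigma> where "\<sigma> = sgn (pE1 (gm p0) (hc p0))"
  define m where "m p = (\<sigma> * inverse (sqrt (D p))) *\<^sub>R cr p" for p
  have nz: "p \<in> S \<Longrightarrow> sqrt (D p) \<noteq> 0" for p using D_pos[of p] by simp
  have sD: "Ck_on 1 (\<lambda>p. sqrt (D p)) S"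
    unfolding One_nat_def
  proof (rule Ck_on_SucI[OF uS, where f' = "\<lambda>p v. dirD S v D p * (inverse (sqrt (D p)) / 2)"])
    fix p assume p: "p \<in> S"
    have "((\<lambda>x. sqrt (D x)) has_derivative (\<lambda>v. (inverse (sqrt (D p)) / 2) * dirD S v D p)) (at p within S)"
      using has_derivative_compose[OF Ck_on_has_derivative[OF D_Ck[of "Suc 4"] p]
          has_field_derivative_imp_has_derivative[OF DERIV_real_sqrt[OF D_pos[OF p]]]] by simp
    then show "((\<lambda>x. sqrt (D x)) has_derivative (\<lambda>v. dirD S v D p * (inverse (sqrt (D p)) / 2))) (at p within S)"
      by (simp add: mult.commute)
  next
    show "Ck_on 0 (\<lambda>p. dirD S v D p * (inverse (sqrt (D p)) / 2)) S" for v
    proof -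
      have "continuous_on S (dirD S v D)" "continuous_on S D"
        using Ck_on_imp_continuous[OF Ck_on_dirD[OF D_Ck[of "Suc 0"]]] Ck_on_imp_continuous[OF D_Ck[of 0]] by auto
      then show ?thesis using nz by (auto intro!: continuous_intros)
    qed
  qed
  have "Ck_on 1 m S" unfolding m_def
    by (intro Ck_on_scaleR Ck_on_mult Ck_on_inverse Ck_on_const uS sD nz cr_Ck) simp_all
  moreover have m: "N p = m p" if "p \<in> S" "sgn (pE1 (gm p) (hc p)) = \<sigma>" for p
    using normal_eq(2)[OF that(1)] that(2) by (simp add: m_def divide_inverse)
  moreover have "\<forall>\<^sub>F p in at p0 within S. N p = m p"
  proof -
    have "continuous_on S (\<lambda>p. \<sigma> * pE1 (gm p) (hc p))"
      by (intro continuous_intros Ck_on_imp_continuous[OF pE_Ck(1)[of 0]]) simp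
    then have "((\<lambda>p. \<sigma> * pE1 (gm p) (hc p)) \<longlongrightarrow> \<sigma> * pE1 (gm p0) (hc p0)) (at p0 within S)"
      using p0 unfolding continuous_on_def by blast
    moreover have "\<sigma> * pE1 (gm p0) (hc p0) > 0"
      using normal_eq(1)[OF p0] by (auto simp: \<sigma>_def sgn_if)
    ultimately have "\<forall>\<^sub>F p in at p0 within S. \<sigma> * pE1 (gm p) (hc p) > 0" by (rule order_tendstoD(1))
    moreover have "\<forall>\<^sub>F p in at p0 within S. p \<in> S" by (simp add: eventually_at_filter)
    ultimately show ?thesis
    proof eventually_elim
      case (elim p)
      then have "sgn (pE1 (gm p) (hc p)) = \<sigma>"
        by (auto simp: \<sigma>_def sgn_if zero_less_mult_iff split: if_splits)
      then show ?case using m elim by blast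
    qed
  qed
  ultimately show thesis using that p0 \<sigma>_def by blast
qed

end

section \<open>Change of spatial coordinates\<close>

context flow_param
begin

lemma reparam_derivatives:
  fixes \<theta> :: "real^3 \<Rightarrow> real^3"
  assumes V': "open V'" and \<theta>: "Ck_on 6 \<theta> V'" "\<theta> ` V' \<subseteq> V" and p: "p \<in> V' \<times> I"
    and F: "Ck_on (Suc k) F S"
  shows "dirD (V' \<times> I) (v, r) (\<lambda>q. F (\<theta> (fst q), snd q)) p
     = dirD S (dirD V' v \<theta> (fst p), r) F (\<theta> (fst p), snd p)"
proof -
  let ?S = "V' \<times> I"
  have u: "uniq_diff ?S" by (rule uniq_diff_Times[OF uniq_diff_open[OF V'] I])
  have \<theta>1: "Ck_on (Suc 0) \<theta> V'" by (rule Ck_on_le[OF \<theta>(1)]) simp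
  have C1: "Ck_on (Suc 0) (\<lambda>q. \<theta> (fst q)) ?S"
    by (rule Ck_on_compose[OF u _ \<theta>1 Ck_on_fst[OF u]]) auto
  have C2: "Ck_on (Suc 0) snd ?S" by (rule Ck_on_snd[OF u])
  have fst: "dirD ?S (v, r) fst p = v" and snd: "dirD ?S (v, r) snd p = r"
    using uniq_diff_deriv_eq[OF u p bounded_linear_imp_has_derivative[OF bounded_linear_fst]]
      uniq_diff_deriv_eq[OF u p bounded_linear_imp_has_derivative[OF bounded_linear_snd]] by auto
  have "dirD ?S (v, r) (\<lambda>q. \<theta> (fst q)) p = dirD V' v \<theta> (fst p)"
    by (subst dirD_compose[OF u _ \<theta>1 Ck_on_fst[OF u] p]) (auto simp: fst)
  then have "dirD ?S (v, r) (\<lambda>q. (\<theta> (fst q), snd q)) p = (dirD V' v \<theta> (fst p), r)"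
    using dirD_Pair[OF u C1 C2 p] snd by simp
  moreover have "(\<lambda>q. (\<theta> (fst q), snd q)) ` ?S \<subseteq> S" using \<theta>(2) by auto
  ultimately show ?thesis
    using dirD_compose[OF u _ F Ck_on_Pair[OF u C1 C2] p] by simp
qed

lemma reparam_Ck:
  fixes \<theta> :: "real^3 \<Rightarrow> real^3"
  assumes V': "open V'" and \<theta>: "Ck_on 6 \<theta> V'" "\<theta> ` V' \<subseteq> V" and k: "k \<le> 6" and F: "Ck_on k F S"
  shows "Ck_on k (\<lambda>q. F (\<theta> (fst q), snd q)) (V' \<times> I)"
proof -
  let ?S = "V' \<times> I"
  have u: "uniq_diff ?S" by (rule uniq_diff_Times[OF uniq_diff_open[OF V'] I])
  have C1: "Ck_on k (\<lambda>q. \<theta> (fst q)) ?S"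
    by (rule Ck_on_compose[OF u _ Ck_on_le[OF \<theta>(1) k] Ck_on_fst[OF u]]) auto
  have "(\<lambda>q. (\<theta> (fst q), snd q)) ` ?S \<subseteq> S" using \<theta>(2) by auto
  then show ?thesis
    by (rule Ck_on_compose[OF u _ F Ck_on_Pair[OF u C1 Ck_on_snd[OF u]]])
qed

text \<open>The map \<open>\<theta>\<close> does not involve time, so the velocity remains normal
  with the same speed, while both fundamental forms change by congruence with the Jacobian.\<close>

lemma reparam:
  fixes \<theta> :: "real^3 \<Rightarrow> real^3"
  assumes V': "open V'" and \<theta>: "Ck_on 6 \<theta> V'" "\<theta> ` V' \<subseteq> V"
    and inj: "\<And>z. z \<in> V' \<Longrightarrow> inj (\<lambda>v. dirD V' v \<theta> z)"
  shows "flow_param V' I (\<lambda>q. Y (\<theta> (fst q), snd q)) (\<lambda>q. N (\<theta> (fst q), snd q)) (\<lambda>q. \<kappa> (\<theta> (fst q), snd q))" (is ?P)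
    and "q \<in> V' \<times> I \<Longrightarrow> sff (V' \<times> I) (\<lambda>q. Y (\<theta> (fst q), snd q)) (N (\<theta> (fst q), snd q)) q =
       transpose (\<chi> a i. dirD V' (axis i 1) \<theta> (fst q) $ a) ** hm (\<theta> (fst q), snd q) **
         (\<chi> a i. dirD V' (axis i 1) \<theta> (fst q) $ a)"
proof -
  let ?S = "V' \<times> I" and ?Y = "\<lambda>q. Y (\<theta> (fst q), snd q)" and ?\<Theta> = "\<lambda>q::(real^3) \<times> real. (\<theta> (fst q), snd q)"
  have u: "uniq_diff ?S" by (rule uniq_diff_Times[OF uniq_diff_open[OF V'] I])
  have \<Theta>S: "?\<Theta> q \<in> S" if "q \<in> ?S" for q using that \<theta>(2) by auto
  note chain = reparam_derivatives[OF V' \<theta>]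
  define A where "A q = (\<chi> a i. dirD V' (axis i 1) \<theta> (fst q) $ a)" for q :: "(real^3) \<times> real"
  have A_Ck: "Ck_on (Suc 0) (\<lambda>q. A q $ a $ i) ?S" for a i
  proof -
    have "Ck_on (Suc 0) (dirD V' (axis i 1) \<theta>) V'"
      by (rule Ck_on_le[OF Ck_on_dirD[of 5]]) (use \<theta>(1) in simp_all)
    from Ck_on_compose[OF u _ this Ck_on_fst[OF u]]
    have "Ck_on (Suc 0) (\<lambda>q. dirD V' (axis i 1) \<theta> (fst q)) ?S" by auto
    then show ?thesis by (simp add: A_def Ck_on_vec_nth[OF u])
  qed
  have tv: "dirD S (w, 0) F q = (\<Sum>a\<in>UNIV. w $ a *\<^sub>R dirD S (axis a 1, 0) F q)"
    if "Ck_on (Suc k) F S" "q \<in> S" for w q k and F :: "(real^3) \<times> real \<Rightarrow> real^4"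
  proof -
    have l: "linear (\<lambda>v. dirD S v F q)" by (rule dirD_linear[OF that])
    have "(w, 0) = (\<Sum>a\<in>UNIV. w $ a *\<^sub>R (axis a 1, 0 :: real))"
      by (simp add: sum_3 vec_eq_iff forall_3 axis_def)
    then have "dirD S (w, 0) F q = dirD S (\<Sum>a\<in>UNIV. w $ a *\<^sub>R (axis a 1, 0 :: real)) F q" by simp
    also have "\<dots> = (\<Sum>a\<in>UNIV. w $ a *\<^sub>R dirD S (axis a 1, 0) F q)"
      by (simp only: linear_sum[OF l] linear_scale[OF l])
    finally show ?thesis .
  qed
  have Y1: "Ck_on (Suc 5) Y S" using Y by simp
  have pr: "par ?S ?Y i q = (\<Sum>a\<in>UNIV. A q $ a $ i *\<^sub>R pr a (?\<Theta> q))" if q: "q \<in> ?S" for i q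
    using trans[OF chain[OF q Y1, of "axis i 1" 0] tv[OF Y1 \<Theta>S[OF q]]] by (simp add: A_def par_def)
  have pr1: "Ck_on (Suc 0) (pr a) S" for a by (rule pr_Ck) simp
  have pra_Ck: "Ck_on (Suc 0) (\<lambda>q. pr a (?\<Theta> q)) ?S" for a
    by (rule reparam_Ck[OF V' \<theta> _ pr_Ck]) simp_all
  have pr2: "par2 ?S ?Y i j q \<bullet> N (?\<Theta> q) =
      (\<Sum>a\<in>UNIV. \<Sum>b\<in>UNIV. A q $ a $ i * A q $ b $ j * (pr2 a b (?\<Theta> q) \<bullet> N (?\<Theta> q)))" if q: "q \<in> ?S" for i j q
  proof -
    have "par2 ?S ?Y i j q = dirD ?S (axis j 1, 0) (\<lambda>q. \<Sum>a\<in>UNIV. A q $ a $ i *\<^sub>R pr a (?\<Theta> q)) q"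
      unfolding par2_def by (rule dirD_cong[OF q pr])
    also have "\<dots> = (\<Sum>a\<in>UNIV. dirD ?S (axis j 1, 0) (\<lambda>q. A q $ a $ i *\<^sub>R pr a (?\<Theta> q)) q)"
      by (rule dirD_sum[OF u Ck_on_scaleR[OF u A_Ck pra_Ck] q])
    also have "\<dots> = (\<Sum>a\<in>UNIV. A q $ a $ i *\<^sub>R dirD ?S (axis j 1, 0) (\<lambda>q. pr a (?\<Theta> q)) q
        + dirD ?S (axis j 1, 0) (\<lambda>q. A q $ a $ i) q *\<^sub>R pr a (?\<Theta> q))"
      by (simp only: dirD_bilinear[OF u bounded_bilinear_scaleR A_Ck pra_Ck q])
    \<comment> \<open>The terms in which the Jacobian is differentiated are tangential and vanish
      when paired with the normal.\<close>
    finally have 1: "par2 ?S ?Y i j q \<bullet> N (?\<Theta> q) =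
       (\<Sum>a\<in>UNIV. A q $ a $ i * (dirD ?S (axis j 1, 0) (\<lambda>q. pr a (?\<Theta> q)) q \<bullet> N (?\<Theta> q)))"
      by (simp add: inner_sum_left inner_add_left tang[OF \<Theta>S[OF q]])
    have 2: "dirD ?S (axis j 1, 0) (\<lambda>q. pr a (?\<Theta> q)) q = (\<Sum>b\<in>UNIV. A q $ b $ j *\<^sub>R pr2 a b (?\<Theta> q))" for a
      using trans[OF chain[OF q pr1, of "axis j 1" 0] tv[OF pr1 \<Theta>S[OF q]]] by (simp add: A_def par2_def)
    show ?thesis
      unfolding 1 2 by (simp add: inner_sum_left sum_distrib_left mult.assoc)
  qed
  have gram: "gram ?S ?Y q = transpose (A q) ** gm (?\<Theta> q) ** A q" if q: "q \<in> ?S" for q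
    by (simp add: vec_eq_iff gram_def pr[OF q] matrix_matrix_mult_def transpose_def sum_3
        inner_add_left inner_add_right algebra_simps inner_commute)
  have sff: "sff ?S ?Y (N (?\<Theta> q)) q = transpose (A q) ** hm (?\<Theta> q) ** A q" if q: "q \<in> ?S" for q
    by (simp add: vec_eq_iff sff_def pr2[OF q] matrix_matrix_mult_def transpose_def sum_3 algebra_simps)
  have inv: "invertible (A q)" if q: "q \<in> ?S" for q
  proof -
    have lin: "linear (\<lambda>v. dirD V' v \<theta> (fst q))"
      by (rule dirD_linear[of 5]) (use \<theta>(1) q in auto)
    have "A q = matrix (\<lambda>v. dirD V' v \<theta> (fst q))" by (simp add: A_def matrix_def)
    then have "(\<lambda>v. A q *v v) = (\<lambda>v. dirD V' v \<theta> (fst q))"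
      using lin by simp
    then have "inj (\<lambda>v. A q *v v)" using inj[of "fst q"] q by auto
    then show ?thesis by (simp add: invertible_left_inverse matrix_left_invertible_injective)
  qed
  show "q \<in> V' \<times> I \<Longrightarrow> sff (V' \<times> I) (\<lambda>q. Y (\<theta> (fst q), snd q)) (N (\<theta> (fst q), snd q)) q =
       transpose (\<chi> a i. dirD V' (axis i 1) \<theta> (fst q) $ a) ** hm (\<theta> (fst q), snd q) **
         (\<chi> a i. dirD V' (axis i 1) \<theta> (fst q) $ a)"
    using sff unfolding A_def by simp
  show ?P
  proof
    show "open V'" by fact
    show "uniq_diff I" by (rule I)
    show "\<And>t. t \<in> I \<Longrightarrow> \<exists>e>0. \<forall>s. 0 \<le> s \<and> s < e \<longrightarrow> t + s \<in> I" by (rule fwd)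
    show "Ck_on 6 ?Y ?S" by (rule reparam_Ck[OF V' \<theta> _ Y]) simp
    fix q assume q: "q \<in> ?S"
    note q' = \<Theta>S[OF q]
    show "N (?\<Theta> q) \<bullet> N (?\<Theta> q) = 1" by (rule N1[OF q'])
    show "par ?S ?Y i q \<bullet> N (?\<Theta> q) = 0" for i
      by (simp add: pr[OF q] inner_sum_left tang[OF q'])
    show "eigenvalues_wrt (gram ?S ?Y q) (sff ?S ?Y (N (?\<Theta> q)) q) (\<kappa> (?\<Theta> q))"
      unfolding gram[OF q] sff[OF q] by (rule eigenvalues_wrt_congruence[OF eig[OF q'] inv[OF q]])
    show "\<kappa> (?\<Theta> q) $ i > 0" for i by (rule pos[OF q'])
    have "linear (\<lambda>v. dirD V' v \<theta> (fst q))"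
      by (rule dirD_linear[of 5]) (use \<theta>(1) q in auto)
    then have "dirD V' 0 \<theta> (fst q) = 0" by (rule linear_0)
    then show "dirD ?S (0, 1) ?Y q = - norm_A_squared (\<kappa> (?\<Theta> q)) *\<^sub>R N (?\<Theta> q)"
      using chain[OF q Y1, of 0 1] flow[OF q'] by simp
  qed
qed

end

text \<open>Only the slice at \<open>t0\<close> is required to be a graph over the principal frame
  \<open>E\<close>. At other times the points keep following the flow, so no tangential velocity has
  to be compensated.\<close>

locale graph_param = flow_param +
  fixes t0 :: real and E :: "3 \<Rightarrow> real^4" and y0 :: "real^3"
  assumes t0: "t0 \<in> I" and origin: "0 \<in> V"
    and ortho: "\<And>i j. E i \<bullet> E j = (if i = j then 1 else 0)" "\<And>i. E i \<bullet> N (0, t0) = 0"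
    and graph: "\<And>z i. z \<in> V \<Longrightarrow> Y (z, t0) \<bullet> E i = z $ i + y0 $ i"
    and diag: "\<And>i j. sff (V \<times> I) Y (N (0, t0)) (0, t0) $ i $ j = (if i = j then \<kappa> (0, t0) $ i else 0)"
begin

text \<open>
  Up to a translation, the hypersurface at time \<open>t0\<close> is the graph of the convex function \<open>w\<close> over
  its tangent space at the base point, with \<open>- N (0, t0)\<close> as the vertical direction.
\<close>

definition "l = \<kappa> (0, t0)"
definition "w z = - (Y (z, t0) \<bullet> N (0, t0))"
definition "dw i = dirD V (axis i 1) w"
definition "ddw i j = dirD V (axis j 1) (dw i)"
definition "W3 i j k = dirD V (axis k 1) (ddw i j) 0"
definition "W4 i k = dirD V (axis k 1) (dirD V (axis k 1) (ddw i i)) 0"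

lemma NN: "N (0, t0) \<bullet> N (0, t0) = 1" using N1 origin t0 by auto

lemma p0: "(0, t0) \<in> S" using origin t0 by simp

lemma w_Ck: "k \<le> 6 \<Longrightarrow> Ck_on k w V"
  unfolding w_def
  by (intro Ck_on_uminus Ck_on_inner Ck_on_const uV Ck_on_slice[OF openV t0 Y_Ck])

lemma dw_Ck: "k \<le> 5 \<Longrightarrow> Ck_on k (dw i) V"
  unfolding dw_def by (rule Ck_on_dirD[OF w_Ck]) simp

lemma ddw_Ck: "k \<le> 4 \<Longrightarrow> Ck_on k (ddw i j) V"
  unfolding ddw_def by (rule Ck_on_dirD[OF dw_Ck]) simp

lemma ddw_sym: "z \<in> V \<Longrightarrow> ddw i j z = ddw j i z"
  unfolding ddw_def dw_def by (rule dirD_commute_open[OF openV w_Ck[of "Suc (Suc 0)"]]) auto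

lemma W3_sym: "W3 i j k = W3 j i k" "W3 i j k = W3 i k j"
proof -
  show "W3 i j k = W3 j i k"
    unfolding W3_def by (rule dirD_cong[OF origin ddw_sym])
  show "W3 i j k = W3 i k j"
    unfolding W3_def ddw_def
    by (rule dirD_commute_open[OF openV dw_Ck[of "Suc (Suc 0)"] origin]) simp
qed

lemma W4_sym: "W4 i k = W4 k i"
proof -
  let ?d = "\<lambda>i. dirD V (axis i 1)"
  have c1: "z \<in> V \<Longrightarrow> ?d k (ddw i i) z = ?d i (ddw i k) z" for z i k
    unfolding ddw_def by (rule dirD_commute_open[OF openV dw_Ck[of "Suc (Suc 0)"]]) simp_all
  have "W4 i k = ?d k (?d i (ddw i k)) 0"
    unfolding W4_def by (rule dirD_cong[OF origin c1])
  also have "\<dots> = ?d i (?d k (ddw i k)) 0"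
    by (rule dirD_commute_open[OF openV ddw_Ck[of "Suc (Suc 0)"] origin]) simp
  also have "\<dots> = ?d i (?d k (ddw k i)) 0"
    by (rule dirD_cong[OF origin], rule dirD_cong, assumption) (rule ddw_sym)
  also have "\<dots> = ?d i (?d i (ddw k k)) 0"
    by (rule dirD_cong[OF origin]) (rule c1[symmetric])
  finally show ?thesis by (simp add: W4_def)
qed

lemma slice_inner:
  assumes "Ck_on (Suc k) F S" "z \<in> V" "\<And>z. z \<in> V \<Longrightarrow> F (z, t0) \<bullet> a = f z"
  shows "dirD S (v, 0) F (z, t0) \<bullet> a = dirD V v f z"
proof -
  have "dirD S (v, 0) F (z, t0) \<bullet> a = dirD V v (\<lambda>z. F (z, t0)) z \<bullet> a"
    by (simp add: dirD_slice[OF openV t0 assms(1,2)])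
  also have "\<dots> = dirD V v (\<lambda>z. F (z, t0) \<bullet> a) z"
    by (rule dirD_linear_comp[OF uV bounded_linear_inner_left Ck_on_slice[OF openV t0 assms(1)] assms(2), symmetric])
  also have "\<dots> = dirD V v f z" by (rule dirD_cong[OF assms(2,3)])
  finally show ?thesis .
qed

lemma pr_N0: "z \<in> V \<Longrightarrow> pr i (z, t0) \<bullet> N (0, t0) = - dw i z"
proof -
  assume z: "z \<in> V"
  have "pr i (z, t0) \<bullet> N (0, t0) = dirD V (axis i 1) (\<lambda>z. - w z) z"
    unfolding par_def by (rule slice_inner[OF Y_Ck[of "Suc 0"] z]) (simp_all add: w_def)
  also have "\<dots> = - dw i z"
    unfolding dw_def by (rule dirD_linear_comp[OF uV _ w_Ck[of "Suc 0"] z])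
      (auto intro: bounded_linear_minus bounded_linear_ident)
  finally show ?thesis .
qed

lemma pr_E: "z \<in> V \<Longrightarrow> pr i (z, t0) \<bullet> E j = (if i = j then 1 else 0)"
proof -
  assume z: "z \<in> V"
  have "pr i (z, t0) \<bullet> E j = dirD V (axis i 1) (\<lambda>z. z $ j + y0 $ j) z"
    unfolding par_def by (rule slice_inner[OF Y_Ck[of "Suc 0"] z graph]) simp_all
  also have "\<dots> = axis i 1 $ j"
    by (rule uniq_diff_deriv_eq[OF uV z]) (auto intro!: derivative_eq_intros bounded_linear.has_derivative[OF bounded_linear_vec_nth])
  finally show ?thesis by (auto simp: axis_def)
qed

lemma pr2_N0: "z \<in> V \<Longrightarrow> pr2 i j (z, t0) \<bullet> N (0, t0) = - ddw i j z"
proof -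
  assume z: "z \<in> V"
  have "pr2 i j (z, t0) \<bullet> N (0, t0) = dirD V (axis j 1) (\<lambda>z. - dw i z) z"
    unfolding par2_def by (rule slice_inner[OF pr_Ck[of "Suc 0"] z pr_N0]) simp_all
  also have "\<dots> = - ddw i j z"
    unfolding ddw_def by (rule dirD_linear_comp[OF uV _ dw_Ck[of "Suc 0"] z])
      (auto intro: bounded_linear_minus bounded_linear_ident)
  finally show ?thesis .
qed

lemma pr2_E: "z \<in> V \<Longrightarrow> pr2 i j (z, t0) \<bullet> E k = 0"
proof -
  assume z: "z \<in> V"
  have "pr2 i j (z, t0) \<bullet> E k = dirD V (axis j 1) (\<lambda>z. if i = k then 1 else 0) z"
    unfolding par2_def by (rule slice_inner[OF pr_Ck[of "Suc 0"] z pr_E]) simp_all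
  then show ?thesis by (simp add: dirD_const[OF uV z])
qed

lemma dw_0: "dw i 0 = 0"
  using pr_N0[OF origin, of i] tang[OF p0, of i] by simp

lemma ddw_0: "ddw i j 0 = (if i = j then l $ i else 0)"
  using pr2_N0[OF origin, of i j] diag[of i j] by (simp add: sff_def l_def)

text \<open>The area factor of the graph; its inverse is the cosine of the angle between the normals
  over \<open>z\<close> and over 0.\<close>

definition "v z = sqrt (1 + (dw 1 z)\<^sup>2 + (dw 2 z)\<^sup>2 + (dw 3 z)\<^sup>2)"

lemma expand: "x \<bullet> y = (\<Sum>i\<in>UNIV. (x \<bullet> E i) * (y \<bullet> E i)) + (x \<bullet> N (0, t0)) * (y \<bullet> N (0, t0))"
  by (rule orthonormal_inner_4[OF ortho NN])

lemma gm_graph: "z \<in> V \<Longrightarrow> gm (z, t0) $ i $ j = (if i = j then 1 else 0) + dw i z * dw j z"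
  using expand[of "pr i (z, t0)" "pr j (z, t0)"] exhaust_3[of i] exhaust_3[of j]
  by (auto simp: gram_def pr_E pr_N0 sum_3)

lemma v_pos: "v z > 0" and v_sq: "(v z)\<^sup>2 = 1 + (dw 1 z)\<^sup>2 + (dw 2 z)\<^sup>2 + (dw 3 z)\<^sup>2"
proof -
  have "1 + (dw 1 z)\<^sup>2 + (dw 2 z)\<^sup>2 + (dw 3 z)\<^sup>2 > 0" by (smt (verit) zero_le_power2)
  then show "v z > 0" "(v z)\<^sup>2 = 1 + (dw 1 z)\<^sup>2 + (dw 2 z)\<^sup>2 + (dw 3 z)\<^sup>2"
    unfolding v_def by simp_all
qed

text \<open>Tangency and unit length determine the normal up to sign. Near 0 the sign is fixed by
  continuity of the local field \<open>m\<close>: the inner product with \<open>N (0, t0)\<close>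
  stays close to 1. Hence the statement holds only eventually.\<close>

lemma N_graph:
  "\<forall>\<^sub>F z in nhds 0. z \<in> V \<and> N (z, t0) \<bullet> N (0, t0) = inverse (v z) \<and>
     (\<forall>i. N (z, t0) \<bullet> E i = dw i z * inverse (v z))"
proof -
  obtain m where m: "Ck_on 1 m S" "\<forall>\<^sub>F p in at (0, t0) within S. N p = m p" "N (0, t0) = m (0, t0)"
    using normal_locally_Ck[OF p0] .
  have sl: "filterlim (\<lambda>z. (z, t0)) (at (0, t0) within S) (at 0 within V)"
    unfolding filterlim_at using t0 openV origin
    by (auto intro!: tendsto_eq_intros simp: eventually_at_filter)
  have "\<forall>\<^sub>F z in at 0 within V. N (z, t0) = m (z, t0)"
    using filterlim_iff[THEN iffD1, OF sl, rule_format, OF m(2)] .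
  then have ev: "\<forall>\<^sub>F z in nhds 0. z \<in> V \<longrightarrow> N (z, t0) = m (z, t0)"
    using m(3) by (auto simp: eventually_at_filter elim!: eventually_mono)
  have inV: "\<forall>\<^sub>F z in nhds 0. z \<in> V" using openV origin by (rule eventually_nhds_in_open)
  have "continuous_on V (\<lambda>z. m (z, t0) \<bullet> N (0, t0))"
    by (intro continuous_intros Ck_on_imp_continuous[OF Ck_on_slice[OF openV t0 m(1)]])
  then have "isCont (\<lambda>z. m (z, t0) \<bullet> N (0, t0)) 0"
    using openV origin by (simp add: continuous_on_eq_continuous_at)
  then have "((\<lambda>z. m (z, t0) \<bullet> N (0, t0)) \<longlongrightarrow> m (0, t0) \<bullet> N (0, t0)) (nhds 0)"
    unfolding isCont_def by (rule tendsto_at_iff_tendsto_nhds[THEN iffD1])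
  then have "((\<lambda>z. m (z, t0) \<bullet> N (0, t0)) \<longlongrightarrow> 1) (nhds 0)"
    by (simp only: m(3)[symmetric] NN)
  then have "\<forall>\<^sub>F z in nhds 0. m (z, t0) \<bullet> N (0, t0) > 0" by (rule order_tendstoD(1)) simp
  then show ?thesis using ev inV
  proof eventually_elim
    case (elim z)
    define c where "c = N (z, t0) \<bullet> N (0, t0)"
    have c0: "c > 0" using elim by (simp add: c_def)
    have pz: "(z, t0) \<in> S" using elim t0 by simp
    have NE: "N (z, t0) \<bullet> E i = c * dw i z" for i
    proof -
      have "pr i (z, t0) \<bullet> N (z, t0) = N (z, t0) \<bullet> E i - dw i z * c"
        using expand[of "pr i (z, t0)" "N (z, t0)"] exhaust_3[of i] elim
        by (auto simp: pr_E pr_N0 sum_3 c_def)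
      then show ?thesis using tang[OF pz, of i] by simp
    qed
    have "1 = c\<^sup>2 * (v z)\<^sup>2"
      using N1[OF pz] expand[of "N (z, t0)" "N (z, t0)"] unfolding v_sq
      by (simp add: NE sum_3 c_def[symmetric] power2_eq_square algebra_simps)
    then have "(c * v z)\<^sup>2 = 1" by (simp add: power_mult_distrib)
    then have "c * v z = 1" using c0 v_pos[of z] by (simp add: power2_eq_1_iff) (smt (verit) mult_pos_pos)
    then have "c = inverse (v z)" using v_pos[of z] by (simp add: field_simps)
    then show ?case using NE elim by (simp add: c_def mult.commute)
  qed
qed

lemma hm_graph: "\<forall>\<^sub>F z in nhds 0. \<forall>i j. hm (z, t0) $ i $ j = ddw i j z * inverse (v z)"
  using N_graph
proof eventually_elim
  case (elim z)
  then have "pr2 i j (z, t0) \<bullet> N (z, t0) = - ddw i j z * inverse (v z)" for i j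
    using expand[of "pr2 i j (z, t0)" "N (z, t0)"] by (simp add: pr2_E pr2_N0)
  then show ?case by (simp add: sff_def)
qed

end

lemma norm_A_squared_esym: "norm_A_squared k = (esym1 k)\<^sup>2 - 2 * esym2 k"
  by (simp add: norm_A_squared_def esym1_def esym2_def power2_eq_square algebra_simps)

lemma eventually_line:
  assumes "\<forall>\<^sub>F z in nhds (0::'a::real_normed_vector). P z"
  shows "\<forall>\<^sub>F s in nhds (0::real). P (s *\<^sub>R a)"
proof -
  have "isCont (\<lambda>s::real. s *\<^sub>R a) 0" by (intro continuous_intros)
  then have "((\<lambda>s::real. s *\<^sub>R a) \<longlongrightarrow> 0 *\<^sub>R a) (nhds 0)"
    unfolding isCont_def by (rule tendsto_at_iff_tendsto_nhds[THEN iffD1])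
  then have "filterlim (\<lambda>s::real. s *\<^sub>R a) (nhds 0) (nhds 0)" by simp
  then show ?thesis using assms by (rule eventually_compose_filterlim[rotated])
qed

text \<open>Small steps along \<open>u\<close> combined with forward steps in time stay inside
  \<open>V \<times> I\<close>, also when \<open>t\<close> is the initial time.\<close>

lemma (in flow_param) dirD_time_commute:
  fixes F :: "(real^3) \<times> real \<Rightarrow> real^4"
  assumes p: "p \<in> S" and F: "Ck_on (Suc (Suc k)) F S"
  shows "dirD S (0, 1) (dirD S (u, 0) F) p = dirD S (u, 0) (dirD S (0, 1) F) p"
proof -
  obtain z t where zt: "p = (z, t)" "z \<in> V" "t \<in> I" using p by auto
  obtain e where e: "e > 0" "\<And>s. 0 \<le> s \<Longrightarrow> s < e \<Longrightarrow> t + s \<in> I" using fwd[OF zt(3)] by blast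
  have "isCont (\<lambda>s::real. z + s *\<^sub>R u) 0" by (intro continuous_intros)
  then have "((\<lambda>s::real. z + s *\<^sub>R u) \<longlongrightarrow> z + 0 *\<^sub>R u) (nhds 0)"
    unfolding isCont_def by (rule tendsto_at_iff_tendsto_nhds[THEN iffD1])
  then have "\<forall>\<^sub>F s in nhds (0::real). z + s *\<^sub>R u \<in> V"
    by (rule topological_tendstoD[OF _ openV]) (use zt in simp)
  then obtain d where d: "d > 0" "\<And>s. \<bar>s\<bar> < d \<Longrightarrow> z + s *\<^sub>R u \<in> V"
    unfolding eventually_nhds_metric by (auto simp: dist_real_def)
  show ?thesis
    by (rule dirD_commute[OF uS F, of "min d e"]) (use d e zt in auto)
qed

section \<open>Second-order expansions along the coordinate axes\<close>

context graph_param
begin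

abbreviation "ax k \<equiv> axis k (1::real) :: real^3"

lemma jet_dw: "jet2 (\<lambda>s. dw i (s *\<^sub>R ax k)) 0 (if i = k then l $ i else 0) (W3 i k k)"
proof -
  have "jet2 (\<lambda>s. dw i (0 + s *\<^sub>R ax k)) (dw i 0) (dirD V (ax k) (dw i) 0) (dirD V (ax k) (dirD V (ax k) (dw i)) 0)"
    by (rule jet2_Ck_line[OF openV origin dw_Ck[of "Suc (Suc 0)"]]) simp
  then show ?thesis by (simp add: dw_0 W3_def ddw_0 flip: ddw_def)
qed

definition "B4 i j k = dirD V (ax k) (dirD V (ax k) (ddw i j)) 0"

lemma jet_ddw: "jet2 (\<lambda>s. ddw i j (s *\<^sub>R ax k)) (if i = j then l $ i else 0) (W3 i j k) (B4 i j k)"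
proof -
  have "jet2 (\<lambda>s. ddw i j (0 + s *\<^sub>R ax k)) (ddw i j 0) (dirD V (ax k) (ddw i j) 0) (dirD V (ax k) (dirD V (ax k) (ddw i j)) 0)"
    by (rule jet2_Ck_line[OF openV origin ddw_Ck[of "Suc (Suc 0)"]]) simp
  then show ?thesis by (simp add: ddw_0 W3_def B4_def)
qed

lemma jet_v: "jet2 (\<lambda>s. inverse (v (s *\<^sub>R ax k))) 1 0 (- (l $ k)\<^sup>2)"
proof -
  have "jet2 (\<lambda>s. 1 + dw 1 (s *\<^sub>R ax k) * dw 1 (s *\<^sub>R ax k) + dw 2 (s *\<^sub>R ax k) * dw 2 (s *\<^sub>R ax k)
      + dw 3 (s *\<^sub>R ax k) * dw 3 (s *\<^sub>R ax k)) 1 0 (2 * (l $ k)\<^sup>2)"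
    by (rule jet2_eq, (rule jet2_add jet2_mult jet_dw jet2_const)+)
       (use exhaust_3[of k] in \<open>auto simp: power2_eq_square\<close>)
  from jet2_sqrt1[OF this] have "jet2 (\<lambda>s. v (s *\<^sub>R ax k)) 1 0 ((l $ k)\<^sup>2)"
    by (simp add: v_def power2_eq_square)
  from jet2_inverse[OF this] show ?thesis by simp
qed

lemma jet_gm: "jet2 (\<lambda>s. gm (s *\<^sub>R ax k, t0) $ i $ j) (if i = j then 1 else 0) 0
    ((\<chi> i j. if i = k \<and> j = k then 2 * (l $ k)\<^sup>2 else 0) $ i $ j)"
proof (rule jet2_cong)
  have "\<forall>\<^sub>F z in nhds 0. (if i = j then 1 else 0) + dw i z * dw j z = gm (z, t0) $ i $ j"
    using eventually_nhds_in_open[OF openV origin] by eventually_elim (simp add: gm_graph)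
  from eventually_line[OF this] show "\<forall>\<^sub>F s in nhds 0. (if i = j then 1 else 0) + dw i (s *\<^sub>R ax k) * dw j (s *\<^sub>R ax k) =
      gm (s *\<^sub>R ax k, t0) $ i $ j" .
  show "jet2 (\<lambda>s. (if i = j then 1 else 0) + dw i (s *\<^sub>R ax k) * dw j (s *\<^sub>R ax k)) (if i = j then 1 else 0) 0
     ((\<chi> i j. if i = k \<and> j = k then 2 * (l $ k)\<^sup>2 else 0) $ i $ j)"
    by (rule jet2_eq, (rule jet2_add jet2_mult jet_dw jet2_const)+) (auto simp: power2_eq_square)
qed

lemma jet_hm: "jet2 (\<lambda>s. hm (s *\<^sub>R ax k, t0) $ i $ j) (if i = j then l $ i else 0) ((\<chi> i j. W3 i j k) $ i $ j)
    ((\<chi> i j. B4 i j k - (if i = j then l $ i * (l $ k)\<^sup>2 else 0)) $ i $ j)"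
proof (rule jet2_cong)
  have "\<forall>\<^sub>F z in nhds 0. ddw i j z * inverse (v z) = hm (z, t0) $ i $ j"
    using hm_graph by eventually_elim simp
  from eventually_line[OF this] show "\<forall>\<^sub>F s in nhds 0. ddw i j (s *\<^sub>R ax k) * inverse (v (s *\<^sub>R ax k)) = hm (s *\<^sub>R ax k, t0) $ i $ j" .
  show "jet2 (\<lambda>s. ddw i j (s *\<^sub>R ax k) * inverse (v (s *\<^sub>R ax k))) (if i = j then l $ i else 0) ((\<chi> i j. W3 i j k) $ i $ j)
    ((\<chi> i j. B4 i j k - (if i = j then l $ i * (l $ k)\<^sup>2 else 0)) $ i $ j)"
    by (rule jet2_eq, (rule jet2_mult jet_ddw jet_v)+) auto
qed

lemma esym_pE:
  assumes "p \<in> S"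
  shows "esym1 (\<kappa> p) = pE1 (gm p) (hm p) / pE3 (gm p)" "esym2 (\<kappa> p) = pE2 (gm p) (hm p) / pE3 (gm p)"
    "esym3 (\<kappa> p) = pE3 (hm p) / pE3 (gm p)"
proof -
  have "det (gm p) = pE3 (gm p)" "pE3 (gm p) > 0"
    using D_pos[OF assms] by (simp_all add: D_def pE3_def det_md)
  then show "esym1 (\<kappa> p) = pE1 (gm p) (hm p) / pE3 (gm p)" "esym2 (\<kappa> p) = pE2 (gm p) (hm p) / pE3 (gm p)"
    "esym3 (\<kappa> p) = pE3 (hm p) / pE3 (gm p)"
    using eigenvalues_wrt_esym[OF eig[OF assms]] by simp_all
qed

text \<open>
  \<open>DD i k\<close> is the second derivative in direction \<open>k\<close> of the \<open>i\<close>-th diagonal entry of the Weingarten map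
  at the base point, and \<open>Tm i\<close> below is the time derivative of that entry.
\<close>

definition "DD i k = W4 i k - l $ i * (l $ k)\<^sup>2 - (if i = k then 2 * (l $ k) ^ 3 else 0)"

lemma line_S: "\<forall>\<^sub>F s in nhds 0. (s *\<^sub>R ax k, t0) \<in> S"
  using eventually_line[OF eventually_nhds_in_open[OF openV origin]] t0 by simp

lemma B4_diag: "B4 i i k = W4 i k"
  by (simp add: B4_def W4_def)

lemma jet_esym1: "jet2 (\<lambda>s. esym1 (\<kappa> (s *\<^sub>R ax k, t0))) (l$1 + l$2 + l$3) (W3 1 1 k + W3 2 2 k + W3 3 3 k)
    (DD 1 k + DD 2 k + DD 3 k)"
  by (rule jet2_cong[OF _ jet2_eq[OF jet2_esym1[OF jet_gm[where k = k] jet_hm[where k = k]]]], use line_S[of k] in eventually_elim)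
     (use exhaust_3[of k] in \<open>auto simp: esym_pE DD_def B4_diag W3_sym(1) algebra_simps power2_eq_square power3_eq_cube\<close>)

lemma jet_esym2: "jet2 (\<lambda>s. esym2 (\<kappa> (s *\<^sub>R ax k, t0))) (l$1 * l$2 + l$1 * l$3 + l$2 * l$3)
    ((l$2 + l$3) * W3 1 1 k + (l$1 + l$3) * W3 2 2 k + (l$1 + l$2) * W3 3 3 k)
    ((l$2 + l$3) * DD 1 k + (l$1 + l$3) * DD 2 k + (l$1 + l$2) * DD 3 k +
     2 * (W3 1 1 k * W3 2 2 k - (W3 1 2 k)\<^sup>2 + W3 1 1 k * W3 3 3 k - (W3 1 3 k)\<^sup>2 + W3 2 2 k * W3 3 3 k - (W3 2 3 k)\<^sup>2))"
  by (rule jet2_cong[OF _ jet2_eq[OF jet2_esym2[OF jet_gm[where k = k] jet_hm[where k = k]]]], use line_S[of k] in eventually_elim)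
     (use exhaust_3[of k] in \<open>auto simp: esym_pE DD_def B4_diag W3_sym(1) algebra_simps power2_eq_square power3_eq_cube\<close>)

lemma jet_esym3: "jet2 (\<lambda>s. esym3 (\<kappa> (s *\<^sub>R ax k, t0))) (l$1 * l$2 * l$3)
    (l$2 * l$3 * W3 1 1 k + l$1 * l$3 * W3 2 2 k + l$1 * l$2 * W3 3 3 k)
    (l$2 * l$3 * DD 1 k + l$1 * l$3 * DD 2 k + l$1 * l$2 * DD 3 k +
     2 * (l$3 * (W3 1 1 k * W3 2 2 k - (W3 1 2 k)\<^sup>2) + l$2 * (W3 1 1 k * W3 3 3 k - (W3 1 3 k)\<^sup>2)
        + l$1 * (W3 2 2 k * W3 3 3 k - (W3 2 3 k)\<^sup>2)))"
  by (rule jet2_cong[OF _ jet2_eq[OF jet2_esym3[OF jet_gm[where k = k] jet_hm[where k = k]]]], use line_S[of k] in eventually_elim)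
     (use exhaust_3[of k] in \<open>auto simp: esym_pE DD_def B4_diag W3_sym(1) algebra_simps power2_eq_square power3_eq_cube\<close>)

text \<open>\<open>S0\<close>, \<open>SF1 k\<close> and \<open>SF k\<close> are the value and the
  first two derivatives of the speed |A|^2 in direction \<open>k\<close> at the base point.\<close>

definition "S0 = (l$1)\<^sup>2 + (l$2)\<^sup>2 + (l$3)\<^sup>2"
definition "SF k = 2 * (l$1 * DD 1 k + l$2 * DD 2 k + l$3 * DD 3 k) + 2 * ((W3 1 1 k)\<^sup>2 + (W3 2 2 k)\<^sup>2 + (W3 3 3 k)\<^sup>2
   + 2 * (W3 1 2 k)\<^sup>2 + 2 * (W3 1 3 k)\<^sup>2 + 2 * (W3 2 3 k)\<^sup>2)"
definition "SF1 k = 2 * (l$1 * W3 1 1 k + l$2 * W3 2 2 k + l$3 * W3 3 3 k)"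

lemma jet_speed: "jet2 (\<lambda>s. norm_A_squared (\<kappa> (s *\<^sub>R ax k, t0))) S0 (SF1 k) (SF k)"
  unfolding norm_A_squared_esym power2_eq_square[of "esym1 _"]
  by (rule jet2_eq, (rule jet2_diff jet2_mult jet2_const jet_esym1 jet_esym2)+)
     (simp_all add: S0_def SF_def SF1_def power2_eq_square algebra_simps)

section \<open>Evolution of the metric and the second fundamental form\<close>

definition "Yt = dirD S (0, 1) Y"

lemma Yt_Ck: "k \<le> 5 \<Longrightarrow> Ck_on k Yt S"
  unfolding Yt_def by (rule Ck_on_dirD[OF Y_Ck]) simp

lemma Yt_inner: "z \<in> V \<Longrightarrow> Yt (z, t0) \<bullet> a = - (norm_A_squared (\<kappa> (z, t0)) * (N (z, t0) \<bullet> a))"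
  using flow[of "(z, t0)"] t0 by (simp add: Yt_def)

text \<open>Neither factor is known to be differentiable on all of \<open>V\<close>, but up to sign
  their product is a component of the velocity, which is a derivative of \<open>Y\<close>.\<close>

lemma Yt_slice_Ck: "k \<le> 5 \<Longrightarrow> Ck_on k (\<lambda>z. - (norm_A_squared (\<kappa> (z, t0)) * (N (z, t0) \<bullet> a))) V"
proof -
  assume "k \<le> 5"
  then have "Ck_on k (\<lambda>z. Yt (z, t0) \<bullet> a) V"
    by (intro Ck_on_inner Ck_on_const uV Ck_on_slice[OF openV t0 Yt_Ck])
  moreover have "Ck_on k (\<lambda>z. Yt (z, t0) \<bullet> a) V = Ck_on k (\<lambda>z. - (norm_A_squared (\<kappa> (z, t0)) * (N (z, t0) \<bullet> a))) V"
    by (rule Ck_on_cong) (rule Yt_inner)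
  ultimately show ?thesis by simp
qed

lemma pr_t: "p \<in> S \<Longrightarrow> dirD S (0, 1) (pr i) p = dirD S (ax i, 0) Yt p"
  unfolding par_def Yt_def by (rule dirD_time_commute[OF _ Y_Ck[of "Suc (Suc 0)"]]) simp_all

lemma pr2_t: "p \<in> S \<Longrightarrow> dirD S (0, 1) (pr2 i j) p = dirD S (ax j, 0) (dirD S (ax i, 0) Yt) p"
proof -
  assume p: "p \<in> S"
  have "dirD S (0, 1) (pr2 i j) p = dirD S (ax j, 0) (dirD S (0, 1) (pr i)) p"
    unfolding par2_def by (rule dirD_time_commute[OF p pr_Ck[of "Suc (Suc 0)"]]) simp
  also have "\<dots> = dirD S (ax j, 0) (dirD S (ax i, 0) Yt) p" by (rule dirD_cong[OF p pr_t])
  finally show ?thesis .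
qed

text \<open>The tangential component of the velocity has an abstract jet because it is
  \<open>C^2\<close>, and an explicit one from the graph formulas; uniqueness of jets equates them.
  The same scheme gives the normal component in \<open>speed_N\<close>.\<close>

lemma speed_E: "dirD S (0, 1) (pr i) (0, t0) \<bullet> E i = - S0 * l $ i"
proof -
  let ?f = "\<lambda>z. - (norm_A_squared (\<kappa> (z, t0)) * (N (z, t0) \<bullet> E i))"
  have "dirD S (0, 1) (pr i) (0, t0) \<bullet> E i = dirD V (ax i) ?f 0"
    unfolding pr_t[OF p0] by (rule slice_inner[OF Yt_Ck[of "Suc 0"] origin Yt_inner]) simp_all
  moreover have J1: "jet2 (\<lambda>s. ?f (0 + s *\<^sub>R ax i)) (?f 0) (dirD V (ax i) ?f 0) (dirD V (ax i) (dirD V (ax i) ?f) 0)"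
    by (rule jet2_Ck_line[OF openV origin Yt_slice_Ck[of "Suc (Suc 0)"]]) simp
  moreover have J2: "jet2 (\<lambda>s. ?f (0 + s *\<^sub>R ax i)) 0 (- S0 * l $ i)
      (- (S0 * (W3 i i i) + 2 * SF1 i * l $ i))"
  proof (rule jet2_cong)
    show "\<forall>\<^sub>F s in nhds 0. - (norm_A_squared (\<kappa> (s *\<^sub>R ax i, t0)) * (dw i (s *\<^sub>R ax i) * inverse (v (s *\<^sub>R ax i)))) =
        ?f (0 + s *\<^sub>R ax i)"
      using eventually_line[OF N_graph, of "ax i"] by eventually_elim simp
    show "jet2 (\<lambda>s. - (norm_A_squared (\<kappa> (s *\<^sub>R ax i, t0)) * (dw i (s *\<^sub>R ax i) * inverse (v (s *\<^sub>R ax i)))))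
       0 (- S0 * l $ i) (- (S0 * (W3 i i i) + 2 * SF1 i * l $ i))"
      by (rule jet2_eq, (rule jet2_uminus jet2_mult jet_speed jet_dw jet_v)+) (auto simp: algebra_simps)
  qed
  ultimately show ?thesis using jet2_unique[OF J1 J2] by linarith
qed

lemma speed_N: "dirD S (0, 1) (pr2 i i) (0, t0) \<bullet> N (0, t0) = - (SF i - S0 * (l $ i)\<^sup>2)"
proof -
  let ?f = "\<lambda>z. - (norm_A_squared (\<kappa> (z, t0)) * (N (z, t0) \<bullet> N (0, t0)))"
  have 1: "dirD S (ax i, 0) Yt (z, t0) \<bullet> N (0, t0) = dirD V (ax i) ?f z" if "z \<in> V" for z
    by (rule slice_inner[OF Yt_Ck[of "Suc 0"] that Yt_inner]) simp_all
  have "dirD S (0, 1) (pr2 i i) (0, t0) \<bullet> N (0, t0) = dirD V (ax i) (dirD V (ax i) ?f) 0"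
    unfolding pr2_t[OF p0]
    by (rule slice_inner[OF Ck_on_dirD[OF Yt_Ck[of "Suc (Suc 0)"]] origin 1]) simp_all
  moreover have J1: "jet2 (\<lambda>s. ?f (0 + s *\<^sub>R ax i)) (?f 0) (dirD V (ax i) ?f 0) (dirD V (ax i) (dirD V (ax i) ?f) 0)"
    by (rule jet2_Ck_line[OF openV origin Yt_slice_Ck[of "Suc (Suc 0)"]]) simp
  moreover have J2: "jet2 (\<lambda>s. ?f (0 + s *\<^sub>R ax i)) (- S0) (- SF1 i) (- (SF i - S0 * (l $ i)\<^sup>2))"
  proof (rule jet2_cong)
    show "\<forall>\<^sub>F s in nhds 0. - (norm_A_squared (\<kappa> (s *\<^sub>R ax i, t0)) * inverse (v (s *\<^sub>R ax i))) =
        ?f (0 + s *\<^sub>R ax i)"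
      using eventually_line[OF N_graph, of "ax i"] by eventually_elim simp
    show "jet2 (\<lambda>s. - (norm_A_squared (\<kappa> (s *\<^sub>R ax i, t0)) * inverse (v (s *\<^sub>R ax i))))
       (- S0) (- SF1 i) (- (SF i - S0 * (l $ i)\<^sup>2))"
      by (rule jet2_eq, (rule jet2_uminus jet2_mult jet_speed jet_v)+) auto
  qed
  ultimately show ?thesis using jet2_unique[OF J1 J2] by linarith
qed

definition "Tm i = SF i + S0 * (l $ i)\<^sup>2"

text \<open>The metric changes at rate \<open>- 2 * S0 * l $ i\<close> and the second fundamental
  form at rate \<open>SF i - S0 * (l $ i)\<^sup>2\<close>. Raising an index therefore turns the last
  term into \<open>+ S0 * (l $ i)\<^sup>2\<close>, as in \<open>Tm\<close>.\<close>

lemma esym_time: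
  "((\<lambda>t. esym1 (\<kappa> (0, t))) has_real_derivative Tm 1 + Tm 2 + Tm 3) (at t0 within I)" (is ?e1)
  "((\<lambda>t. esym2 (\<kappa> (0, t))) has_real_derivative
     (l$2 + l$3) * Tm 1 + (l$1 + l$3) * Tm 2 + (l$1 + l$2) * Tm 3) (at t0 within I)" (is ?e2)
  "((\<lambda>t. esym3 (\<kappa> (0, t))) has_real_derivative
     l$2 * l$3 * Tm 1 + l$1 * l$3 * Tm 2 + l$1 * l$2 * Tm 3) (at t0 within I)" (is ?e3)
proof -
  obtain m where m: "Ck_on 1 m S" "\<forall>\<^sub>F p in at (0, t0) within S. N p = m p" "N (0, t0) = m (0, t0)"
    using normal_locally_Ck[OF p0] .
  have m1: "Ck_on (Suc 0) m S" using m(1) by simp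
  have "filterlim (\<lambda>t. (0, t)) (at (0::real^3, t0) within S) (at t0 within I)"
    unfolding filterlim_at using origin by (auto intro!: tendsto_eq_intros simp: eventually_at_filter)
  from filterlim_iff[THEN iffD1, OF this, rule_format, OF m(2)]
  have ev: "\<forall>\<^sub>F t in at t0 within I. N (0, t) = m (0, t)" .
  have evI: "\<forall>\<^sub>F t in at t0 within I. t \<in> I" by (simp add: eventually_at_filter)
  define g where "g t = gm (0, t)" for t
  define h where "h t = sff S Y (m (0, t)) (0, t)" for t
  define G :: "real^3^3" where "G = (\<chi> i j. dirD S (0, 1) (\<lambda>p. gm p $ i $ j) (0, t0))"
  define H :: "real^3^3" where "H = (\<chi> i j. - dirD S (0, 1) (\<lambda>p. pr2 i j p \<bullet> m p) (0, t0))"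
  have pm: "Ck_on (Suc 0) (\<lambda>p. pr2 i j p \<bullet> m p) S" for i j
    by (rule Ck_on_inner[OF uS pr2_Ck m1]) simp
  have gd: "((\<lambda>t. g t $ i $ j) has_real_derivative G $ i $ j) (at t0 within I)" for i j
    using Ck_on_time_derivative[OF gm_Ck[of "Suc 0" i j] origin t0]
    by (simp add: g_def G_def has_real_derivative_iff_has_vector_derivative)
  have hd: "((\<lambda>t. h t $ i $ j) has_real_derivative H $ i $ j) (at t0 within I)" for i j
    using has_vector_derivative_minus[OF Ck_on_time_derivative[OF pm[of i j] origin t0]]
    by (simp add: h_def H_def sff_def has_real_derivative_iff_has_vector_derivative)
  have g0: "g t0 $ i $ j = (if i = j then 1 else 0)" for i j
    using gm_graph[OF origin] by (simp add: g_def dw_0)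
  have h0: "h t0 $ i $ j = (if i = j then l $ i else 0)" for i j
    using diag[of i j] m(3) by (simp add: h_def l_def)
  \<comment> \<open>Since the normal has constant length, its time derivative is tangential. Second
    spatial derivatives of a graph at the base point are normal, so this term will drop out of the
    product rule for \<open>H\<close>.\<close>
  have Nm: "dirD S (0, 1) m (0, t0) \<bullet> N (0, t0) = 0"
  proof -
    have A: "((\<lambda>t. m (0, t) \<bullet> m (0, t)) has_vector_derivative
        m (0, t0) \<bullet> dirD S (0, 1) m (0, t0) + dirD S (0, 1) m (0, t0) \<bullet> m (0, t0)) (at t0 within I)"
      using bounded_bilinear.has_vector_derivative[OF bounded_bilinear_inner
          Ck_on_time_derivative[OF m1 origin t0] Ck_on_time_derivative[OF m1 origin t0]] .
    have B: "((\<lambda>t. m (0, t) \<bullet> m (0, t)) has_vector_derivative 0) (at t0 within I)"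
    proof -
      have "\<forall>\<^sub>F t in at t0 within I. m (0, t) \<bullet> m (0, t) = 1"
        using ev evI by eventually_elim (metis N1 SigmaI origin)
      moreover have "m (0, t0) \<bullet> m (0, t0) = 1" using NN m(3) by simp
      ultimately have "((\<lambda>t. m (0, t) \<bullet> m (0, t)) has_real_derivative 0) (at t0 within I) \<longleftrightarrow>
          ((\<lambda>t. 1::real) has_real_derivative 0) (at t0 within I)"
        by (intro has_field_derivative_cong_eventually) auto
      then show ?thesis by (simp add: has_real_derivative_iff_has_vector_derivative)
    qed
    have "m (0, t0) \<bullet> dirD S (0, 1) m (0, t0) + dirD S (0, 1) m (0, t0) \<bullet> m (0, t0) = 0"
      using trans[OF uniq_diff_deriv_eq[OF I t0 A[unfolded has_vector_derivative_def], of 1, symmetric]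
          uniq_diff_deriv_eq[OF I t0 B[unfolded has_vector_derivative_def], of 1]] by simp
    then show ?thesis using m(3) by (simp add: inner_commute)
  qed
  have Gi: "G $ i $ i = - 2 * S0 * l $ i" for i
  proof -
    have "G $ i $ i = 2 * (dirD S (0, 1) (pr i) (0, t0) \<bullet> pr i (0, t0))"
      by (simp add: G_def gram_def dirD_inner[OF uS pr_Ck[of "Suc 0"] pr_Ck[of "Suc 0"] p0] inner_commute)
    also have "dirD S (0, 1) (pr i) (0, t0) \<bullet> pr i (0, t0) = dirD S (0, 1) (pr i) (0, t0) \<bullet> E i"
      using expand[of "dirD S (0, 1) (pr i) (0, t0)" "pr i (0, t0)"] exhaust_3[of i]
      by (auto simp: pr_E[OF origin] pr_N0[OF origin] dw_0 sum_3)
    finally show ?thesis by (simp add: speed_E)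
  qed
  have Hi: "H $ i $ i = SF i - S0 * (l $ i)\<^sup>2" for i
  proof -
    have "H $ i $ i = - (pr2 i i (0, t0) \<bullet> dirD S (0, 1) m (0, t0)) - dirD S (0, 1) (pr2 i i) (0, t0) \<bullet> N (0, t0)"
      using m(3) by (simp add: H_def dirD_inner[OF uS pr2_Ck[of "Suc 0"] m1 p0])
    moreover have "pr2 i i (0, t0) \<bullet> dirD S (0, 1) m (0, t0) = 0"
      using expand[of "pr2 i i (0, t0)" "dirD S (0, 1) m (0, t0)"] Nm by (simp add: pr2_E[OF origin])
    ultimately show ?thesis using speed_N[of i] by simp
  qed
  have HG: "H $ i $ i - G $ i $ i * l $ i = Tm i" for i
    by (simp add: Hi Gi Tm_def power2_eq_square)
  have eqs: "\<forall>\<^sub>F t in at t0 within I. esym1 (\<kappa> (0, t)) = pE1 (g t) (h t) / pE3 (g t) \<and>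
     esym2 (\<kappa> (0, t)) = pE2 (g t) (h t) / pE3 (g t) \<and> esym3 (\<kappa> (0, t)) = pE3 (h t) / pE3 (g t)"
    using ev evI
  proof eventually_elim
    case (elim t)
    then have "(0, t) \<in> S" using origin by simp
    then show ?case using esym_pE[of "(0, t)"] elim(1) by (simp add: g_def h_def)
  qed
  have eq0: "esym1 (\<kappa> (0, t0)) = pE1 (g t0) (h t0) / pE3 (g t0)"
     "esym2 (\<kappa> (0, t0)) = pE2 (g t0) (h t0) / pE3 (g t0)" "esym3 (\<kappa> (0, t0)) = pE3 (h t0) / pE3 (g t0)"
    using esym_pE[OF p0] m(3) by (simp_all add: g_def h_def)
  show ?e1
    using derivative_esym1[OF gd hd g0 h0] eqs eq0 unfolding HG
    by (subst has_field_derivative_cong_eventually) (auto elim: eventually_mono)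
  show ?e2
    using derivative_esym2[OF gd hd g0 h0] eqs eq0 unfolding HG
    by (subst has_field_derivative_cong_eventually) (auto elim: eventually_mono)
  show ?e3
    using derivative_esym3[OF gd hd g0 h0] eqs eq0 unfolding HG
    by (subst has_field_derivative_cong_eventually) (auto elim: eventually_mono)
qed

end

text \<open>Inner products with a principal frame at the point serve as new coordinates. Their
  differential is injective because the Gram matrix is invertible, so the inverse function theorem
  applies.\<close>

lemma (in flow_param) graph_at:
  assumes p: "(z0, t0) \<in> S"
  obtains V' \<theta> E y0 where "graph_param V' I (\<lambda>q. Y (\<theta> (fst q), snd q)) (\<lambda>q. N (\<theta> (fst q), snd q))
      (\<lambda>q. \<kappa> (\<theta> (fst q), snd q)) t0 E y0"
    "\<theta> 0 = z0" "\<theta> ` V' \<subseteq> V"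
proof -
  have z0: "z0 \<in> V" and t0: "t0 \<in> I" using p by auto
  obtain e :: "3 \<Rightarrow> real^3" and E :: "3 \<Rightarrow> real^4" where
    e: "\<And>i j. e i \<bullet> (gm (z0, t0) *v e j) = (if i = j then 1 else 0)"
      "\<And>i. hm (z0, t0) *v e i = \<kappa> (z0, t0) $ i *\<^sub>R (gm (z0, t0) *v e i)"
    and E: "\<And>i. E i = (\<Sum>a\<in>UNIV. e i $ a *\<^sub>R pr a (z0, t0))"
      "\<And>i j. E i \<bullet> E j = (if i = j then 1 else 0)" "\<And>i. E i \<bullet> N (z0, t0) = 0"
    by (rule tangent_frame[OF p]) blast
  define y where "y u = (\<chi> i. (Y (u, t0) - Y (z0, t0)) \<bullet> E i)" for u
  have y_Ck: "Ck_on (Suc 5) y V"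
    unfolding y_def
    by (intro Ck_on_vec_lambda Ck_on_inner Ck_on_diff Ck_on_const uV Ck_on_slice[OF openV t0]) (use Y in simp)
  have Y1: "Ck_on (Suc 0) Y S" by (rule Y_Ck) simp
  have dY: "dirD S (u, 0) Y (z0, t0) = (\<Sum>a\<in>UNIV. u $ a *\<^sub>R pr a (z0, t0))" for u
  proof -
    have l: "linear (\<lambda>v. dirD S v Y (z0, t0))" by (rule dirD_linear[OF Y1 p])
    have "(u, 0) = (\<Sum>a\<in>UNIV. u $ a *\<^sub>R (axis a 1, 0 :: real))"
      by (simp add: sum_3 vec_eq_iff forall_3 axis_def)
    then have "dirD S (u, 0) Y (z0, t0) = dirD S (\<Sum>a\<in>UNIV. u $ a *\<^sub>R (axis a 1, 0 :: real)) Y (z0, t0)" by simp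
    also have "\<dots> = (\<Sum>a\<in>UNIV. u $ a *\<^sub>R pr a (z0, t0))"
      by (simp only: linear_sum[OF l] linear_scale[OF l] par_def)
    finally show ?thesis .
  qed
  have dy: "dirD V u y z0 $ i = dirD S (u, 0) Y (z0, t0) \<bullet> E i" for u i
  proof -
    have Ys: "Ck_on (Suc 0) (\<lambda>z. Y (z, t0)) V" by (rule Ck_on_slice[OF openV t0 Y1])
    have "((\<lambda>u. y u $ i) has_derivative (\<lambda>u. dirD V u (\<lambda>z. Y (z, t0)) z0 \<bullet> E i)) (at z0 within V)"
      unfolding y_def vec_lambda_beta
      by (auto intro!: derivative_eq_intros Ck_on_has_derivative[OF Ys z0])
    from uniq_diff_deriv_eq[OF uV z0 this, of u] show ?thesis
      by (simp add: dirD_slice[OF openV t0 Y1 z0] dirD_linear_comp[OF uV bounded_linear_vec_nth y_Ck z0])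
  qed
  have lin_y: "linear (\<lambda>u. dirD V u y z0)" by (rule dirD_linear[OF y_Ck z0])
  have inj_y: "inj (\<lambda>u. dirD V u y z0)"
    unfolding linear_injective_0[OF lin_y]
  proof (intro allI impI)
    fix u assume u: "dirD V u y z0 = 0"
    let ?x = "\<Sum>a\<in>UNIV. u $ a *\<^sub>R pr a (z0, t0)"
    have "?x \<bullet> E i = 0" for i using dy[of u i] u by (simp add: dY)
    moreover have "?x \<bullet> N (z0, t0) = 0" by (simp add: inner_sum_left tang[OF p])
    ultimately have "?x \<bullet> ?x = 0"
      using orthonormal_inner_4[OF E(2,3) N1[OF p], of ?x ?x] by simp
    then have x0: "?x = 0" by simp
    have "(gm (z0, t0) *v u) $ i = pr i (z0, t0) \<bullet> ?x" for i
      by (simp add: gram_def matrix_vector_mult_def inner_sum_right mult.commute)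
    then have "gm (z0, t0) *v u = 0" by (simp add: x0 vec_eq_iff)
    moreover have "invertible (gm (z0, t0))"
      using eigenvalues_wrt_det(1)[OF eig[OF p]] by (simp add: invertible_det_nz)
    ultimately show "u = 0"
      by (metis invertible_def matrix_vector_mul_assoc matrix_vector_mul_lid matrix_vector_mult_0_right)
  qed
  have y0: "y z0 = 0" by (simp add: y_def vec_eq_iff)
  obtain V' \<theta> where \<theta>: "open V'" "0 \<in> V'" "\<theta> ` V' \<subseteq> V" "\<theta> 0 = z0" "\<And>z. z \<in> V' \<Longrightarrow> y (\<theta> z) = z"
      "Ck_on (Suc 5) \<theta> V'"
    using inverse_function_Ck[OF openV y_Ck z0 inj_y] unfolding y0 by metis
  have \<theta>6: "Ck_on 6 \<theta> V'" using \<theta>(6) by simp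
  have uV': "uniq_diff V'" by (rule uniq_diff_open[OF \<theta>(1)])
  have inv: "dirD V (dirD V' u \<theta> z) y (\<theta> z) = u" if z: "z \<in> V'" for u z
  proof -
    have "dirD V (dirD V' u \<theta> z) y (\<theta> z) = dirD V' u (\<lambda>z. y (\<theta> z)) z"
      by (rule dirD_compose[OF uV' \<theta>(3) y_Ck \<theta>(6) z, symmetric])
    also have "\<dots> = dirD V' u (\<lambda>z. z) z" by (rule dirD_cong[OF z \<theta>(5)])
    also have "\<dots> = u" using uniq_diff_deriv_eq[OF uV' z, of "\<lambda>z. z" "\<lambda>u. u"] by simp
    finally show ?thesis .
  qed
  have inj_\<theta>: "inj (\<lambda>u. dirD V' u \<theta> z)" if "z \<in> V'" for z
    by (rule inj_on_inverseI[where g = "\<lambda>u. dirD V u y (\<theta> z)"]) (rule inv[OF that])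
  note rep = reparam[OF \<theta>(1) \<theta>6 \<theta>(3) inj_\<theta>]
  \<comment> \<open>The Jacobian of \<open>\<theta>\<close> at 0 has the principal vectors as
    columns, so congruence with it diagonalizes the second fundamental form.\<close>
  have \<theta>e: "dirD V' (axis i 1) \<theta> 0 = e i" for i
  proof -
    have "dirD V (e i) y z0 = axis i 1"
      by (simp add: vec_eq_iff dy dY E(2) axis_def flip: E(1))
    moreover have "dirD V (dirD V' (axis i 1) \<theta> 0) y z0 = axis i 1" using inv[OF \<theta>(2)] \<theta>(4) by simp
    ultimately show ?thesis using inj_y by (metis injD)
  qed
  have "graph_param V' I (\<lambda>q. Y (\<theta> (fst q), snd q)) (\<lambda>q. N (\<theta> (fst q), snd q))
      (\<lambda>q. \<kappa> (\<theta> (fst q), snd q)) t0 E (\<chi> i. Y (z0, t0) \<bullet> E i)"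
  proof (intro graph_param.intro rep(1) graph_param_axioms.intro)
    show "t0 \<in> I" "0 \<in> V'" by fact+
    show "E i \<bullet> E j = (if i = j then 1 else 0)" for i j by (rule E(2))
    show "E i \<bullet> N (\<theta> (fst (0, t0)), snd (0, t0)) = 0" for i using E(3) \<theta>(4) by simp
    show "Y (\<theta> (fst (z, t0)), snd (z, t0)) \<bullet> E i = z $ i + (\<chi> i. Y (z0, t0) \<bullet> E i) $ i" if "z \<in> V'" for z i
      using arg_cong[OF \<theta>(5)[OF that], of "\<lambda>x. x $ i"] by (simp add: y_def inner_diff_left)
    fix i j :: 3
    have "(0, t0) \<in> V' \<times> I" using \<theta>(2) t0 by simp
    from rep(2)[OF _ this]
    have "sff (V' \<times> I) (\<lambda>q. Y (\<theta> (fst q), snd q)) (N (\<theta> (fst (0, t0)), snd (0, t0))) (0, t0) $ i $ j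
       = (transpose (\<chi> a i. e i $ a) ** hm (z0, t0) ** (\<chi> a i. e i $ a)) $ i $ j"
      by (simp add: \<theta>e \<theta>(4))
    also have "\<dots> = e i \<bullet> (hm (z0, t0) *v e j)"
      by (simp add: matrix_matrix_mult_def matrix_vector_mult_def transpose_def inner_vec_def
        sum_distrib_left sum_distrib_right sum_3 algebra_simps)
    also have "\<dots> = (if i = j then \<kappa> (z0, t0) $ i else 0)"
      by (auto simp: e)
    finally show "sff (V' \<times> I) (\<lambda>q. Y (\<theta> (fst q), snd q)) (N (\<theta> (fst (0, t0)), snd (0, t0))) (0, t0) $ i $ j
       = (if i = j then \<kappa> (\<theta> (fst (0, t0)), snd (0, t0)) $ i else 0)"
      by (simp add: \<theta>(4))
  qed
  then show thesis using that \<theta>(3,4) by blast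
qed

section \<open>Algebraic inequalities\<close>

text \<open>(\<alpha>, \<beta>, \<gamma>) stands for the gradient of a function F of the three
  symmetric functions, so \<open>g1\<close>, \<open>g2\<close>, \<open>g3\<close> are its
  derivatives by the curvatures. \<open>T1\<close>, \<open>T2\<close>, \<open>T3\<close> are the
  time derivatives of the Weingarten entries, and \<open>G1\<close>, \<open>G2\<close>,
  \<open>G3\<close> the second space derivatives of F without the part coming from the Hessian of F.
  The mixed fourth derivatives \<open>z12\<close>, \<open>z13\<close>, \<open>z23\<close> are shared
  by \<open>D12\<close> and \<open>D21\<close> and so on, hence they cancel and leave the cubic
  terms behind as a reaction.\<close>

lemma gradient_identity:
  fixes a b c \<alpha> \<beta> \<gamma> :: real
  defines "H \<equiv> a + b + c" and "S \<equiv> a\<^sup>2 + b\<^sup>2 + c\<^sup>2" and "C \<equiv> a ^ 3 + b ^ 3 + c ^ 3"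
  defines "g1 \<equiv> \<alpha> + \<beta> * (b + c) + \<gamma> * (b * c)" and "g2 \<equiv> \<alpha> + \<beta> * (a + c) + \<gamma> * (a * c)"
    and "g3 \<equiv> \<alpha> + \<beta> * (a + b) + \<gamma> * (a * b)"
  assumes D: "D12 = z12 - a * b\<^sup>2" "D21 = z12 - b * a\<^sup>2" "D13 = z13 - a * c\<^sup>2" "D31 = z13 - c * a\<^sup>2"
    "D23 = z23 - b * c\<^sup>2" "D32 = z23 - c * b\<^sup>2"
  assumes T1: "T1 = 2 * (a * D11 + b * D21 + c * D31) + 2 * (x111\<^sup>2 + x122\<^sup>2 + x133\<^sup>2 + 2 * x112\<^sup>2 + 2 * x113\<^sup>2 + 2 * x123\<^sup>2) + S * a\<^sup>2"
    and T2: "T2 = 2 * (a * D12 + b * D22 + c * D32) + 2 * (x112\<^sup>2 + x222\<^sup>2 + x233\<^sup>2 + 2 * x122\<^sup>2 + 2 * x123\<^sup>2 + 2 * x223\<^sup>2) + S * b\<^sup>2"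
    and T3: "T3 = 2 * (a * D13 + b * D23 + c * D33) + 2 * (x113\<^sup>2 + x223\<^sup>2 + x333\<^sup>2 + 2 * x123\<^sup>2 + 2 * x133\<^sup>2 + 2 * x233\<^sup>2) + S * c\<^sup>2"
  assumes G1: "G1 = g1 * D11 + g2 * D21 + g3 * D31
      + 2 * \<beta> * (x111 * x122 - x112\<^sup>2 + x111 * x133 - x113\<^sup>2 + x122 * x133 - x123\<^sup>2)
      + 2 * \<gamma> * (c * (x111 * x122 - x112\<^sup>2) + b * (x111 * x133 - x113\<^sup>2) + a * (x122 * x133 - x123\<^sup>2))"
    and G2: "G2 = g1 * D12 + g2 * D22 + g3 * D32
      + 2 * \<beta> * (x112 * x222 - x122\<^sup>2 + x112 * x233 - x123\<^sup>2 + x222 * x233 - x223\<^sup>2)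
      + 2 * \<gamma> * (c * (x112 * x222 - x122\<^sup>2) + b * (x112 * x233 - x123\<^sup>2) + a * (x222 * x233 - x223\<^sup>2))"
    and G3: "G3 = g1 * D13 + g2 * D23 + g3 * D33
      + 2 * \<beta> * (x113 * x223 - x123\<^sup>2 + x113 * x333 - x133\<^sup>2 + x223 * x333 - x233\<^sup>2)
      + 2 * \<gamma> * (c * (x113 * x223 - x123\<^sup>2) + b * (x113 * x333 - x133\<^sup>2) + a * (x223 * x333 - x233\<^sup>2))"
  defines "B \<equiv> \<lambda>x y z :: real. x\<^sup>2 + 3 * y\<^sup>2 + 3 * z\<^sup>2"
  defines "Q \<equiv> \<lambda>p q r x y z. \<alpha> * B x y z + \<beta> * (H * B x y z - p * (x + y + z)\<^sup>2)
      + \<gamma> * (q * r * B x y z + 2 * p * r * y\<^sup>2 + 2 * p * q * z\<^sup>2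
         - 2 * (p * r * x * y + p * q * x * z + p\<^sup>2 * y * z))"
  shows "g1 * T1 + g2 * T2 + g3 * T3 = 2 * (a * G1 + b * G2 + c * G3)
     - S * (g1 * a\<^sup>2 + g2 * b\<^sup>2 + g3 * c\<^sup>2) + 2 * C * (g1 * a + g2 * b + g3 * c)
     + 2 * (Q a b c x111 x122 x133 + Q b a c x222 x112 x233 + Q c a b x333 x113 x223)
     + (4 * (g1 + g2 + g3) + 4 * \<beta> * H + 4 * \<gamma> * S) * x123\<^sup>2"
  unfolding T1 T2 T3 G1 G2 G3 D Q_def B_def H_def S_def C_def g1_def g2_def g3_def
  by algebra

text \<open>For given \<open>a\<close> and sum H, the product \<open>b * c\<close> is largest at
  \<open>b = c\<close>. The cone condition then becomes a quadratic inequality for a/H with roots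
  3/5 and 1/15, attained at (3, 1, 1) and (1, 7, 7).\<close>

lemma cone_bounds:
  fixes a b c :: real
  assumes "a > 0" "b > 0" "c > 0" and cone: "7 * (a + b + c)\<^sup>2 \<le> 25 * (a * b + a * c + b * c)"
  shows "5 * a \<le> 3 * (a + b + c)" "a + b + c \<le> 15 * a"
proof -
  define H where "H = a + b + c"
  have "4 * (b * c) \<le> (b + c)\<^sup>2" using zero_le_power2[of "b - c"] by (simp add: power2_eq_square algebra_simps)
  then have "28 * H\<^sup>2 \<le> 100 * a * (H - a) + 25 * (H - a)\<^sup>2"
    using cone by (simp add: H_def power2_eq_square algebra_simps)
  then have *: "(3 * H - 5 * a) * (H - 15 * a) \<le> 0" by (simp add: power2_eq_square algebra_simps)
  have pos: "H > 0" "a > 0" using assms by (auto simp: H_def)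
  have "3 * H - 5 * a \<ge> 0 \<and> H - 15 * a \<le> 0"
    using * pos by (auto simp: mult_le_0_iff)
  then show "5 * a \<le> 3 * (a + b + c)" "a + b + c \<le> 15 * a" by (auto simp: H_def)
qed

text \<open>Cauchy-Schwarz with weights 1, 1/3, 1/3, whose sum is 5/3. This is the reciprocal of the
  largest value of a/H in the cone, so the two bounds cancel in \<open>cone_sum_sq\<close>.\<close>

lemma sum_sq_le: "3 * (x + y + z)\<^sup>2 \<le> 5 * (x\<^sup>2 + 3 * y\<^sup>2 + 3 * z\<^sup>2)" for x y z :: real
proof -
  have "5 * (x\<^sup>2 + 3 * y\<^sup>2 + 3 * z\<^sup>2) - 3 * (x + y + z)\<^sup>2 = (x - 3 * y)\<^sup>2 + (x - 3 * z)\<^sup>2 + 3 * (y - z)\<^sup>2"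
    by (simp add: power2_eq_square algebra_simps)
  then show ?thesis by (smt (verit) zero_le_power2)
qed

lemma cone_sum_sq:
  fixes a b c :: real
  assumes "a > 0" "b > 0" "c > 0" "7 * (a + b + c)\<^sup>2 \<le> 25 * (a * b + a * c + b * c)"
  shows "a * (x + y + z)\<^sup>2 \<le> (a + b + c) * (x\<^sup>2 + 3 * y\<^sup>2 + 3 * z\<^sup>2)"
proof -
  have "5 * a * (x + y + z)\<^sup>2 \<le> 3 * (a + b + c) * (x + y + z)\<^sup>2"
    by (rule mult_right_mono[OF cone_bounds(1)[OF assms]]) simp
  also have "\<dots> = (a + b + c) * (3 * (x + y + z)\<^sup>2)" by simp
  also have "\<dots> \<le> (a + b + c) * (5 * (x\<^sup>2 + 3 * y\<^sup>2 + 3 * z\<^sup>2))"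
    using assms by (intro mult_left_mono sum_sq_le) auto
  finally have "5 * (a * (x + y + z)\<^sup>2) \<le> 5 * ((a + b + c) * (x\<^sup>2 + 3 * y\<^sup>2 + 3 * z\<^sup>2))"
    by (simp only: mult.assoc mult.left_commute)
  then show ?thesis by simp
qed

text \<open>On the boundary 25 S = 11 H^2, which reduces the claim to C H > S^2. This is the
  Cauchy-Schwarz inequality for power sums, with equality for positive entries only if all are
  equal; equal entries lie inside the cone and not on its boundary.\<close>

lemma pinching_reaction:
  fixes a b c :: real
  assumes p: "a > 0" "b > 0" "c > 0" and eq: "7 * (a + b + c)\<^sup>2 = 25 * (a * b + a * c + b * c)"
  shows "25 * (a ^ 3 + b ^ 3 + c ^ 3) > 11 * (a + b + c) * (a\<^sup>2 + b\<^sup>2 + c\<^sup>2)"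
proof -
  define H where "H = a + b + c"
  define S where "S = a\<^sup>2 + b\<^sup>2 + c\<^sup>2"
  define C where "C = a ^ 3 + b ^ 3 + c ^ 3"
  have HS: "11 * H\<^sup>2 = 25 * S" using eq by (simp add: H_def S_def power2_eq_square algebra_simps)
  have "C * H - S\<^sup>2 = a * b * (a - b)\<^sup>2 + a * c * (a - c)\<^sup>2 + b * c * (b - c)\<^sup>2"
    by (simp add: H_def S_def C_def power2_eq_square power3_eq_cube algebra_simps)
  also have "\<dots> > 0"
  proof (rule ccontr)
    assume "\<not> ?thesis"
    moreover have "a * b * (a - b)\<^sup>2 \<ge> 0" "a * c * (a - c)\<^sup>2 \<ge> 0" "b * c * (b - c)\<^sup>2 \<ge> 0" using p by simp_all
    ultimately have "a * b * (a - b)\<^sup>2 = 0" "a * c * (a - c)\<^sup>2 = 0" by linarith+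
    then have "a = b" "a = c" using p by simp_all
    then show False using eq p by (simp add: power2_eq_square)
  qed
  finally have "25 * (C * H) > 25 * S\<^sup>2" by simp
  also have "25 * S\<^sup>2 = 11 * H * S * H" using HS by (simp add: power2_eq_square)
  finally have "H * (25 * C) > H * (11 * H * S)" by (simp add: mult_ac)
  moreover have "H > 0" using p by (simp add: H_def)
  ultimately show ?thesis by (simp add: H_def S_def C_def mult_less_cancel_left_pos)
qed

text \<open>In terms of the smallest entry and the two gaps every coefficient is positive.\<close>

lemma psi_reaction_sorted:
  fixes a b c :: real
  assumes "0 \<le> a" "a \<le> b" "b \<le> c"
  shows "0 \<le> 6 * (a\<^sup>2 + b\<^sup>2 + c\<^sup>2) ^ 3 - 7 * (a\<^sup>2 + b\<^sup>2 + c\<^sup>2)\<^sup>2 * (a + b + c)\<^sup>2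
    + (a\<^sup>2 + b\<^sup>2 + c\<^sup>2) * (a + b + c) ^ 4 + 2 * (a ^ 3 + b ^ 3 + c ^ 3) * (a + b + c) ^ 3"
proof -
  define u where "u = b - a"
  define v where "v = c - b"
  have uv: "0 \<le> u" "0 \<le> v" "b = a + u" "c = a + u + v" using assms by (auto simp: u_def v_def)
  have "6 * (a\<^sup>2 + b\<^sup>2 + c\<^sup>2) ^ 3 - 7 * (a\<^sup>2 + b\<^sup>2 + c\<^sup>2)\<^sup>2 * (a + b + c)\<^sup>2
    + (a\<^sup>2 + b\<^sup>2 + c\<^sup>2) * (a + b + c) ^ 4 + 2 * (a ^ 3 + b ^ 3 + c ^ 3) * (a + b + c) ^ 3 =
    18 * a^4 * u^2 + 18 * a^4 * u * v + 18 * a^4 * v^2 + 36 * a^3 * u^3 + 54 * a^3 * u^2 * v + 90 * a^3 * u * v^2 + 20 * a^2 * u^4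
    + 40 * a^2 * u^3 * v + 114 * a^2 * u^2 * v^2 + 36 * a^3 * v^3 + 94 * a^2 * u * v^3 + 20 * a^2 * v^4 + 44 * a * u^3 * v^2
    + 66 * a * u^2 * v^3 + 30 * a * u * v^4 + 12 * u^4 * v^2 + 24 * u^3 * v^3 + 20 * u^2 * v^4 + 4 * a * v^5 + 8 * u * v^5 + 2 * v^6"
    unfolding uv(3,4) by algebra
  also have "\<dots> \<ge> 0" using assms(1) uv(1,2) by (intro add_nonneg_nonneg mult_nonneg_nonneg zero_le_power) auto
  finally show ?thesis .
qed

lemma psi_reaction:
  fixes a b c :: real
  assumes "0 \<le> a" "0 \<le> b" "0 \<le> c"
  shows "0 \<le> 6 * (a\<^sup>2 + b\<^sup>2 + c\<^sup>2) ^ 3 - 7 * (a\<^sup>2 + b\<^sup>2 + c\<^sup>2)\<^sup>2 * (a + b + c)\<^sup>2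
    + (a\<^sup>2 + b\<^sup>2 + c\<^sup>2) * (a + b + c) ^ 4 + 2 * (a ^ 3 + b ^ 3 + c ^ 3) * (a + b + c) ^ 3"
proof -
  consider "a \<le> b" "b \<le> c" | "a \<le> c" "c \<le> b" | "b \<le> a" "a \<le> c" | "b \<le> c" "c \<le> a" | "c \<le> a" "a \<le> b" | "c \<le> b" "b \<le> a"
    by linarith
  then show ?thesis
    using psi_reaction_sorted[of a b c] psi_reaction_sorted[of a c b] psi_reaction_sorted[of b a c]
      psi_reaction_sorted[of b c a] psi_reaction_sorted[of c a b] psi_reaction_sorted[of c b a] assms
    by cases (simp_all add: add_ac)
qed

text \<open>The positive coefficients in the proof are Bernstein coefficients on the three intervals.\<close>

lemma discriminant_pos:
  fixes x :: real
  assumes "1 \<le> x" "x \<le> 9"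
  shows "0 \<le> -765450000 + 15203295000 * x + 7060273875 * x^2 - 1807105950 * x^3 + 50943735 * x^4
    - 17053308 * x^5 + 4921080 * x^6 - 278516 * x^7" (is "0 \<le> ?p")
proof -
  consider "x \<le> 5" | "5 \<le> x" "x \<le> 7" | "7 \<le> x" by linarith
  then show ?thesis
  proof cases
    case 1
    define u v where "u = x - 1" and "v = 5 - x"
    have uv: "u \<ge> 0" "v \<ge> 0" using 1 assms by (auto simp: u_def v_def)
    \<comment> \<open>As \<open>u + v\<close> equals the interval length 4, multiplying by 4^7 makes
      the polynomial homogeneous of degree 7 in \<open>u\<close> and \<open>v\<close>. The factor
      128 in the other two cases is 2^7 for the same reason.\<close>
    have "16384 * ?p = 19729545916 * v^7 + 234301262084 * u * v^6 + 1020959951772 * u^2 * v^5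
        + 2172962739460 * u^3 * v^4 + 2485357380500 * u^4 * v^3 + 1534480075500 * u^5 * v^2
        + 479811092500 * u^6 * v + 59550687500 * u^7"
      unfolding u_def v_def by algebra
    also have "\<dots> \<ge> 0" using uv by (intro add_nonneg_nonneg mult_nonneg_nonneg zero_le_power) auto
    finally show ?thesis by simp
  next
    case 2
    define u v where "u = x - 5" and "v = 7 - x"
    have uv: "u \<ge> 0" "v \<ge> 0" using 2 by (auto simp: u_def v_def)
    have "128 * ?p = 59550687500 * v^7 + 385376672500 * u * v^6 + 1038240087000 * u^2 * v^5
        + 1504093244000 * u^3 * v^4 + 1261255630060 * u^4 * v^3 + 611022108324 * u^5 * v^2
        + 158546163248 * u^6 * v + 17064892936 * u^7"
      unfolding u_def v_def by algebra
    also have "\<dots> \<ge> 0" using uv by (intro add_nonneg_nonneg mult_nonneg_nonneg zero_le_power) auto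
    finally show ?thesis by simp
  next
    case 3
    define u v where "u = x - 7" and "v = 9 - x"
    have uv: "u \<ge> 0" "v \<ge> 0" using 3 assms by (auto simp: u_def v_def)
    have "128 * ?p = 17064892936 * v^7 + 80362337856 * u * v^6 + 141919155972 * u^2 * v^5
        + 114365680380 * u^3 * v^4 + 43886460960 * u^4 * v^3 + 14481794952 * u^5 * v^2
        + 7332448212 * u^6 * v + 957494844 * u^7"
      unfolding u_def v_def by algebra
    also have "\<dots> \<ge> 0" using uv by (intro add_nonneg_nonneg mult_nonneg_nonneg zero_le_power) auto
    finally show ?thesis by simp
  qed
qed

section \<open>Positivity of the third-derivative forms on the cone\<close>

lemma quadratic_nonneg:
  fixes p q r t :: real
  assumes "0 < p" "q\<^sup>2 \<le> 4 * p * r"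
  shows "0 \<le> p * t\<^sup>2 + q * t + r"
proof -
  have "0 \<le> (2 * p * t + q)\<^sup>2 + (4 * p * r - q\<^sup>2)" using assms(2) by simp
  also have "\<dots> = 4 * p * (p * t\<^sup>2 + q * t + r)" by (simp add: power2_eq_square algebra_simps)
  finally show ?thesis using assms(1) by (simp add: zero_le_mult_iff)
qed

text \<open>
  As a function of \<open>t = 1 / b\<close> the difference of both sides is a quadratic polynomial, and the cone
  condition becomes the quadratic inequality \<open>m t\<^sup>2 - (1 - a) t + 1 \<le> 0\<close>. Adding this constraint with
  multiplier \<open>\<sigma>\<close> makes the discriminant nonpositive.
\<close>

lemma cone_form_entry:
  fixes a b c :: real
  assumes p: "a > 0" "b > 0" "c > 0" and H: "a + b + c = 1"
    and cone: "7 \<le> 25 * (a * b + a * c + b * c)"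
  shows "(49/4 * a - 2 - 2 * a / b + 1 / b)\<^sup>2
     \<le> (33/4 - 49/4 * a + 1 / a) / 2 * (9/4 + 3 / a + 2 / b - 49/4 * a + 4 * a / b)"
proof -
  have cone': "7 * (a + b + c)\<^sup>2 \<le> 25 * (a * b + a * c + b * c)" using cone H by simp
  have a: "1/15 \<le> a" "a \<le> 3/5" using cone_bounds[OF p cone'] H by auto
  define t where "t = 1 / b"
  have bt: "b * t = 1" "t > 0" using p by (auto simp: t_def)
  \<comment> \<open>With sum 1 the cone condition says precisely that \<open>b * c\<close> is at
    least \<open>m\<close>.\<close>
  define m where "m = a\<^sup>2 - a + 7/25"
  have c: "c = 1 - a - b" using H by simp
  have "m \<le> b * (1 - a - b)"
    using cone unfolding m_def c by (simp add: power2_eq_square algebra_simps)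
  then have "m * t\<^sup>2 \<le> (b * (1 - a - b)) * t\<^sup>2" by (rule mult_right_mono) simp
  also have "\<dots> = (b * t) * ((1 - a) * t - b * t)" by (simp add: power2_eq_square algebra_simps)
  finally have con: "m * t\<^sup>2 - (1 - a) * t + 1 \<le> 0" by (simp add: bt)
  \<comment> \<open>\<open>q2\<close>, \<open>q1\<close> and \<open>q0\<close> are the coefficients,
    in powers of \<open>a * t\<close>, of a^2 times the difference of both sides plus
    \<open>\<sigma> * a\<^sup>2\<close> times the constraint. The factor a^2 removes the reciprocals
    of \<open>a\<close>.\<close>
  define \<sigma> where "\<sigma> = 4 + 58 * a"
  define q2 where "q2 = 3/25 + 406/25 * a - 58 * a\<^sup>2 + 58 * a^3"
  define q1 where "q1 = 1 + 41/4 * a - 329/4 * a\<^sup>2 + 165/2 * a^3"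
  define q0 where "q0 = 3/2 + 27/2 * a - 487/32 * a\<^sup>2 + 683/16 * a^3 - 2401/32 * a^4"
  have "q2 = 3/25 + 58 * a * ((a - 1/2)\<^sup>2 + 3/100)"
    by (simp add: q2_def power2_eq_square power3_eq_cube algebra_simps)
  also have "\<dots> > 0"
  proof -
    have "58 * a * ((a - 1/2)\<^sup>2 + 3/100) \<ge> 0" using p by (intro mult_nonneg_nonneg add_nonneg_nonneg) auto
    then show ?thesis by linarith
  qed
  finally have q2: "q2 > 0" .
  \<comment> \<open>The cone bounds put \<open>15 * a\<close> into [1, 9], and the constant is 16
    times 15^7, which makes all coefficients in this variable integers.\<close>
  have "2733750000 * (4 * q2 * q0 - q1\<^sup>2) = -765450000 + 15203295000 * (15 * a) + 7060273875 * (15 * a)^2 - 1807105950 * (15 * a)^3 + 50943735 * (15 * a)^4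
    - 17053308 * (15 * a)^5 + 4921080 * (15 * a)^6 - 278516 * (15 * a)^7"
    unfolding q2_def q1_def q0_def by (simp add: power2_eq_square power3_eq_cube power_numeral_reduce algebra_simps)
  also have "\<dots> \<ge> 0" by (rule discriminant_pos) (use a in auto)
  finally have "0 \<le> 2733750000 * (4 * q2 * q0 - q1\<^sup>2)" .
  moreover have "0 \<le> 2733750000 * r \<Longrightarrow> 0 \<le> r" for r :: real by simp
  ultimately have "0 \<le> 4 * q2 * q0 - q1\<^sup>2" by blast
  then have "q1\<^sup>2 \<le> 4 * q2 * q0" by (simp only: diff_ge_0_iff_ge)
  from quadratic_nonneg[OF q2 this, of "a * t"]
  have "0 \<le> q2 * (a * t)\<^sup>2 + q1 * (a * t) + q0" .
  also have "\<dots> = (1 + 33/4 * a - 49/4 * a\<^sup>2) / 2 * (9/4 * a + 3 - 49/4 * a\<^sup>2 + (2 * a + 4 * a\<^sup>2) * t)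
      - a\<^sup>2 * (49/4 * a - 2 + (1 - 2 * a) * t)\<^sup>2 + \<sigma> * a\<^sup>2 * (m * t\<^sup>2 - (1 - a) * t + 1)"
    unfolding q2_def q1_def q0_def \<sigma>_def m_def
    by (simp add: field_simps) algebra
  also have "\<dots> \<le> (1 + 33/4 * a - 49/4 * a\<^sup>2) / 2 * (9/4 * a + 3 - 49/4 * a\<^sup>2 + (2 * a + 4 * a\<^sup>2) * t)
      - a\<^sup>2 * (49/4 * a - 2 + (1 - 2 * a) * t)\<^sup>2"
    using mult_nonneg_nonpos[OF _ con, of "\<sigma> * a\<^sup>2"] p by (simp add: \<sigma>_def)
  finally have "a\<^sup>2 * (49/4 * a - 2 + (1 - 2 * a) * t)\<^sup>2 \<le>
     (1 + 33/4 * a - 49/4 * a\<^sup>2) / 2 * (9/4 * a + 3 - 49/4 * a\<^sup>2 + (2 * a + 4 * a\<^sup>2) * t)" by simp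
  also have "\<dots> = a\<^sup>2 * ((33/4 - 49/4 * a + 1 / a) / 2 * (9/4 + 3 / a + 2 * t - 49/4 * a + 4 * a * t))"
    using p by (simp add: power2_eq_square field_simps)
  finally have *: "(49/4 * a - 2 + (1 - 2 * a) * t)\<^sup>2 \<le>
     (33/4 - 49/4 * a + 1 / a) / 2 * (9/4 + 3 / a + 2 * t - 49/4 * a + 4 * a * t)"
    using p by (simp add: mult_le_cancel_left_pos)
  have e1: "49/4 * a - 2 + (1 - 2 * a) * t = 49/4 * a - 2 - 2 * a / b + 1 / b"
    by (simp add: t_def diff_divide_distrib left_diff_distrib)
  have e2: "2 * t = 2 / b" "4 * a * t = 4 * a / b" by (simp_all add: t_def)
  show ?thesis using * unfolding e1 e2 .
qed

text \<open>Bounds the coefficient of \<open>y * z\<close> in \<open>cone_form_unit\<close>. Since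
  \<open>2 * a - 1\<close> changes sign in the cone, the two sides differ: the upper bound rests on
  \<open>a\<close> being at most 3/5, the lower one on \<open>a * (1 - 2 * a)\<close> being at most
  1/8 while \<open>b * c\<close> is at least 3/100.\<close>

lemma cone_form_mixed:
  fixes a b c :: real
  assumes p: "a > 0" "b > 0" "c > 0" and H: "a + b + c = 1"
    and cone: "7 \<le> 25 * (a * b + a * c + b * c)"
  shows "\<bar>a * (49/4 + (2 * a - 1) / (b * c))\<bar> \<le> 21/2"
proof -
  have cone': "7 * (a + b + c)\<^sup>2 \<le> 25 * (a * b + a * c + b * c)" using cone H by simp
  have a: "1/15 \<le> a" "a \<le> 3/5" using cone_bounds[OF p cone'] H by auto
  define m where "m = a\<^sup>2 - a + 7/25"
  have m0: "m \<ge> 3/100" using zero_le_power2[of "a - 1/2"] by (simp add: m_def power2_eq_square algebra_simps)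
  have "b + c = 1 - a" using H by simp
  then have "a * (b + c) = a * (1 - a)" by simp
  then have m: "m \<le> b * c"
    using cone by (simp add: m_def power2_eq_square algebra_simps)
  then have bc: "b * c > 0" "b * c \<ge> 3/100" using m0 by auto
  have up: "(2 * a - 1) / (b * c) \<le> 5"
  proof (cases "2 * a \<le> 1")
    case True
    then have "(2 * a - 1) / (b * c) \<le> 0" using bc by (simp add: divide_le_0_iff)
    then show ?thesis by simp
  next
    case False
    \<comment> \<open>This product is \<open>5 * m - (2 * a - 1)\<close>; it vanishes at the extreme
      value 3/5.\<close>
    have "(5 * a - 3) * (a - 4/5) \<ge> 0" using a by (intro mult_nonpos_nonpos) auto
    then have "2 * a - 1 \<le> 5 * m" by (simp add: m_def power2_eq_square algebra_simps)
    also have "\<dots> \<le> 5 * (b * c)" using m by simp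
    finally show ?thesis using bc by (simp add: divide_le_eq)
  qed
  have "a * (49/4 + (2 * a - 1) / (b * c)) \<le> a * (69/4)"
  proof (rule mult_left_mono)
    show "49/4 + (2 * a - 1) / (b * c) \<le> 69/4" using up by linarith
  qed (use p in simp)
  also have "\<dots> \<le> 3/5 * (69/4)" using a by (intro mult_right_mono) auto
  also have "\<dots> \<le> 21/2" by simp
  finally have 1: "a * (49/4 + (2 * a - 1) / (b * c)) \<le> 21/2" .
  have "a * (1 - 2 * a) \<le> 1/8" using zero_le_power2[of "a - 1/4"] by (simp add: power2_eq_square algebra_simps)
  also have "\<dots> \<le> 21/2 * (b * c)" using bc by simp
  finally have "a * (1 - 2 * a) / (b * c) \<le> 21/2" using bc by (simp add: divide_le_eq)
  moreover have "a * (49/4 + (2 * a - 1) / (b * c)) = a * (49/4) - a * (1 - 2 * a) / (b * c)"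
    unfolding divide_inverse[of _ "b * c"] by algebra
  ultimately have 2: "- (21/2) \<le> a * (49/4 + (2 * a - 1) / (b * c))" using a by linarith
  show ?thesis using 1 2 by simp
qed

text \<open>The ternary form is split into three binary ones, in (x, y), (x, z) and (y, z). The
  first two are handled by the discriminant bound of \<open>cone_form_entry\<close>, the third by
  \<open>cone_form_mixed\<close>.\<close>

lemma cone_form_unit:
  fixes a b c :: real
  assumes p: "a > 0" "b > 0" "c > 0" and H: "a + b + c = 1"
    and cone: "7 \<le> 25 * (a * b + a * c + b * c)"
  shows "0 \<le> 17/4 * (x\<^sup>2 + 3 * y\<^sup>2 + 3 * z\<^sup>2) - 49/4 * a * (x + y + z)\<^sup>2 + 4 * a * (x + y + z) * (x / a + y / b + z / c)
     + ((x\<^sup>2 + 3 * y\<^sup>2 + 3 * z\<^sup>2) / a + 2 * (y\<^sup>2 / b + z\<^sup>2 / c)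
        - 2 * a * (x * y / (a * b) + x * z / (a * c) + y * z / (b * c)))" (is "0 \<le> ?E")
proof -
  have cone': "7 * (a + b + c)\<^sup>2 \<le> 25 * (a * b + a * c + b * c)" using cone H by simp
  have a: "1/15 \<le> a" "a \<le> 3/5" using cone_bounds[OF p cone'] H by auto
  define A where "A = 33/4 - 49/4 * a + 1 / a"
  \<comment> \<open>The coefficient 51/4 of the square of \<open>y\<close> is divided into 9/4, kept
    here, and 21/2, reserved for the product \<open>y * z\<close>; likewise for \<open>z\<close>.
    The coefficient \<open>A\<close> of the square of \<open>x\<close> is shared equally between the
    two pairs.\<close>
  define By where "By = 9/4 + 3 / a + 2 / b - 49/4 * a + 4 * a / b"
  define Bz where "Bz = 9/4 + 3 / a + 2 / c - 49/4 * a + 4 * a / c"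
  define My where "My = 49/4 * a - 2 - 2 * a / b + 1 / b"
  define Mz where "Mz = 49/4 * a - 2 - 2 * a / c + 1 / c"
  define M where "M = a * (49/4 + (2 * a - 1) / (b * c))"
  have A: "A > 0" unfolding A_def by (rule add_pos_pos) (use a p in simp_all)
  have 1: "My\<^sup>2 \<le> A / 2 * By" unfolding My_def A_def By_def by (rule cone_form_entry[OF p H cone])
  have 2: "Mz\<^sup>2 \<le> A / 2 * Bz" unfolding Mz_def A_def Bz_def
    by (rule cone_form_entry[of a c b]) (use p H cone in \<open>auto simp: algebra_simps\<close>)
  have q: "0 \<le> A / 2 * x\<^sup>2 - 2 * n * x * y + B * y\<^sup>2" if "n\<^sup>2 \<le> A / 2 * B" for n B y
    using quadratic_nonneg[of "A / 2" "- 2 * n * y" "B * y\<^sup>2" x] A that mult_right_mono[OF that, of "y\<^sup>2"]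
    by (simp add: power2_eq_square algebra_simps)
  have 3: "\<bar>M\<bar> \<le> 21/2" unfolding M_def by (rule cone_form_mixed[OF p H cone])
  have "2 * M * (y * z) \<le> \<bar>M\<bar> * (2 * \<bar>y * z\<bar>)"
    using abs_ge_self[of "M * (y * z)"] by (simp add: abs_mult)
  also have "\<dots> \<le> 21/2 * (y\<^sup>2 + z\<^sup>2)"
  proof (rule mult_mono[OF 3])
    show "2 * \<bar>y * z\<bar> \<le> y\<^sup>2 + z\<^sup>2"
      using zero_le_power2[of "\<bar>y\<bar> - \<bar>z\<bar>"] by (simp add: power2_eq_square abs_mult algebra_simps)
  qed auto
  finally have 4: "0 \<le> 21/2 * y\<^sup>2 + 21/2 * z\<^sup>2 - 2 * M * (y * z)" by simp
  have "?E = (A / 2 * x\<^sup>2 - 2 * My * x * y + By * y\<^sup>2) + (A / 2 * x\<^sup>2 - 2 * Mz * x * z + Bz * z\<^sup>2)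
      + (21/2 * y\<^sup>2 + 21/2 * z\<^sup>2 - 2 * M * (y * z))"
  proof -
    define r s t where "r = 1 / a" and "s = 1 / b" and "t = 1 / c"
    have rst: "a * r = 1" "b * s = 1" "c * t = 1" using p by (auto simp: r_def s_def t_def)
    have d: "w / a = w * r" "w / b = w * s" "w / c = w * t" "w / (a * b) = w * (r * s)" "w / (a * c) = w * (r * t)" "w / (b * c) = w * (s * t)" for w
      by (simp_all add: r_def s_def t_def)
    have st: "s + t = (1 - a) * (s * t)"
    proof -
      have "(1 - a) * (s * t) = (b * s) * t + (c * t) * s" using H by (simp add: algebra_simps flip: H)
      then show ?thesis by (simp add: rst)
    qed
    have "?E = (A / 2 * x\<^sup>2 - 2 * My * x * y + By * y\<^sup>2) + (A / 2 * x\<^sup>2 - 2 * Mz * x * z + Bz * z\<^sup>2)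
      + (21/2 * y\<^sup>2 + 21/2 * z\<^sup>2 - 2 * M * (y * z))
      + (a * r - 1) * (4 * (x + y + z) * x - 2 * x * y * s - 2 * x * z * t)
      + 4 * a * y * z * (s + t - (1 - a) * (s * t))"
      unfolding A_def By_def Bz_def My_def Mz_def M_def d
      by (simp add: field_simps) algebra
    then show ?thesis by (simp only: rst(1) st diff_self mult_zero_left mult_zero_right add_0_right)
  qed
  then show ?thesis using q[OF 1, of y] q[OF 2, of z] 4 by linarith
qed

text \<open>The homogeneous version of \<open>cone_form_unit\<close>, by scaling to sum 1 and
  multiplying by the product of the curvatures and H^4.\<close>

lemma cone_form:
  fixes a b c :: real
  assumes p: "a > 0" "b > 0" "c > 0" and H: "H = a + b + c"
    and cone: "7 * H\<^sup>2 \<le> 25 * (a * b + a * c + b * c)"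
    and B: "B = x\<^sup>2 + 3 * y\<^sup>2 + 3 * z\<^sup>2" and s: "s = x + y + z" and u: "u = b * c * x + a * c * y + a * b * z"
    and Q: "Q = b * c * B + 2 * a * c * y\<^sup>2 + 2 * a * b * z\<^sup>2 - 2 * (a * c * x * y + a * b * x * z + a\<^sup>2 * y * z)"
  shows "0 \<le> a * b * c * (17/4 * H * B - 49/4 * a * s\<^sup>2) + 4 * H * a * s * u + H\<^sup>2 * Q"
proof -
  have H0: "H > 0" using p H by simp
  define a' b' c' where "a' = a / H" and "b' = b / H" and "c' = c / H"
  have abc: "a = H * a'" "b = H * b'" "c = H * c'" using H0 by (auto simp: a'_def b'_def c'_def)
  have p': "a' > 0" "b' > 0" "c' > 0" using p H0 by (auto simp: a'_def b'_def c'_def)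
  have "H * (a' + b' + c') = H * 1" using H unfolding abc by (simp add: algebra_simps)
  then have H': "a' + b' + c' = 1" using H0 by simp
  have "H\<^sup>2 * 7 \<le> H\<^sup>2 * (25 * (a' * b' + a' * c' + b' * c'))"
    using cone unfolding abc by (simp add: power2_eq_square algebra_simps)
  then have cone': "7 \<le> 25 * (a' * b' + a' * c' + b' * c')" using H0 by simp
  \<comment> \<open>Reciprocals become variables subject to \<open>a' * r1 = 1\<close> and so on, so
    that clearing denominators is a polynomial identity modulo these relations.\<close>
  define r1 r2 r3 where "r1 = 1 / a'" and "r2 = 1 / b'" and "r3 = 1 / c'"
  have r: "a' * r1 = 1" "b' * r2 = 1" "c' * r3 = 1" using p' by (auto simp: r1_def r2_def r3_def)
  have d: "w / a' = w * r1" "w / b' = w * r2" "w / c' = w * r3" "w / (a' * b') = w * (r1 * r2)"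
    "w / (a' * c') = w * (r1 * r3)" "w / (b' * c') = w * (r2 * r3)" for w
    by (simp_all add: r1_def r2_def r3_def)
  define E where "E = 17/4 * B - 49/4 * a' * s\<^sup>2 + 4 * a' * s * (x * r1 + y * r2 + z * r3)
     + (B * r1 + 2 * (y\<^sup>2 * r2 + z\<^sup>2 * r3)
        - 2 * a' * (x * y * (r1 * r2) + x * z * (r1 * r3) + y * z * (r2 * r3)))"
  have "0 \<le> E" using cone_form_unit[OF p' H' cone', of x y z] unfolding d E_def B s .
  then have "0 \<le> H ^ 4 * (a' * b' * c') * E" using H0 p' by simp
  also have "\<dots> = a * b * c * (17/4 * H * B - 49/4 * a * s\<^sup>2) + 4 * H * a * s * u + H\<^sup>2 * Q"
  proof -
    have k: "a' * b' * c' * (x * r1 + y * r2 + z * r3) = b' * c' * x + a' * c' * y + a' * b' * z"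
    proof -
      have "a' * b' * c' * (x * r1 + y * r2 + z * r3) =
          (a' * r1) * (b' * c' * x) + (b' * r2) * (a' * c' * y) + (c' * r3) * (a' * b' * z)"
        by (simp add: algebra_simps)
      then show ?thesis by (simp add: r)
    qed
    have w: "a' * b' * c' * (B * r1 + 2 * (y\<^sup>2 * r2 + z\<^sup>2 * r3)
        - 2 * a' * (x * y * (r1 * r2) + x * z * (r1 * r3) + y * z * (r2 * r3)))
       = b' * c' * B + 2 * a' * c' * y\<^sup>2 + 2 * a' * b' * z\<^sup>2 - 2 * (a' * c' * x * y + a' * b' * x * z + a'\<^sup>2 * y * z)"
    proof -
      have "a' * b' * c' * (B * r1 + 2 * (y\<^sup>2 * r2 + z\<^sup>2 * r3)
        - 2 * a' * (x * y * (r1 * r2) + x * z * (r1 * r3) + y * z * (r2 * r3))) =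
        (a' * r1) * (b' * c' * B) + (b' * r2) * (2 * a' * c' * y\<^sup>2) + (c' * r3) * (2 * a' * b' * z\<^sup>2)
        - 2 * ((a' * r1) * (b' * r2) * (a' * c' * x * y) + (a' * r1) * (c' * r3) * (a' * b' * x * z)
           + (b' * r2) * (c' * r3) * (a'\<^sup>2 * y * z))"
        by (simp add: power2_eq_square algebra_simps)
      then show ?thesis by (simp add: r)
    qed
    have "H ^ 4 * (a' * b' * c') * E = H ^ 4 * (a' * b' * c' * (17/4 * B - 49/4 * a' * s\<^sup>2)
        + 4 * a' * s * (b' * c' * x + a' * c' * y + a' * b' * z)
        + (b' * c' * B + 2 * a' * c' * y\<^sup>2 + 2 * a' * b' * z\<^sup>2 - 2 * (a' * c' * x * y + a' * b' * x * z + a'\<^sup>2 * y * z)))"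
      unfolding k[symmetric] w[symmetric] E_def by (simp add: algebra_simps)
    also have "\<dots> = a * b * c * (17/4 * H * B - 49/4 * a * s\<^sup>2) + 4 * H * a * s * u + H\<^sup>2 * Q"
      unfolding u Q unfolding abc by (simp add: power2_eq_square power4_eq_xxxx algebra_simps)
    finally show ?thesis .
  qed
  finally show ?thesis .
qed

text \<open>Unlike for the cone, the critical point equation is indispensable: it expresses the
  derivative \<open>t\<close> of the second symmetric function through \<open>s\<close> and
  \<open>u\<close>. What then remains is controlled by \<open>cone_form\<close> and
  \<open>cone_sum_sq\<close>.\<close>

lemma psi_group:
  fixes a b c :: real
  assumes p: "a > 0" "b > 0" "c > 0" and H: "H = a + b + c" and T: "T = a * b + a * c + b * c"
    and cone: "7 * H\<^sup>2 \<le> 25 * T"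
    and m: "m * (a * b * c) = H\<^sup>2 * (2 * H\<^sup>2 - 6 * T)" and P: "2 * H\<^sup>2 - 6 * T > 0"
    and B: "B = x\<^sup>2 + 3 * y\<^sup>2 + 3 * z\<^sup>2" and s: "s = x + y + z" and u: "u = b * c * x + a * c * y + a * b * z"
    and Q: "Q = b * c * B + 2 * a * c * y\<^sup>2 + 2 * a * b * z\<^sup>2 - 2 * (a * c * x * y + a * b * x * z + a\<^sup>2 * y * z)"
    and crit: "(8 * H ^ 3 - 12 * H * T) * s - 6 * H\<^sup>2 * t - m * u = 0"
  shows "(8 * H ^ 3 - 12 * H * T) * B - 6 * H\<^sup>2 * (H * B - a * s\<^sup>2) - m * Q
     - a * ((24 * H\<^sup>2 - 12 * T) * s\<^sup>2 - 24 * H * s * t) \<le> 0" (is "?X \<le> 0")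
proof -
  define K where "K = a * b * c"
  define P where "P = 2 * H\<^sup>2 - 6 * T"
  have K0: "K > 0" and H0: "H > 0" using p H by (auto simp: K_def)
  have P0: "P > 0" using P by (simp add: P_def)
  have 1: "25 * P \<le> 8 * H\<^sup>2" using cone by (simp add: P_def)
  have 2: "0 \<le> H * B - a * s\<^sup>2"
    using cone_sum_sq[OF p, of x y z] cone by (simp add: H T B s)
  have 3: "0 \<le> K * (17/4 * H * B - 49/4 * a * s\<^sup>2) + 4 * H * a * s * u + H\<^sup>2 * Q"
    unfolding K_def by (rule cone_form[OF p H _ B s u Q]) (use cone T in simp)
  have mK: "m * K = H\<^sup>2 * P" using m by (simp add: K_def P_def)
  \<comment> \<open>The factor \<open>H\<close> turns \<open>24 * H * s * t\<close> into a multiple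
    of the term \<open>6 * H\<^sup>2 * t\<close> that \<open>crit\<close> replaces, and
    \<open>K\<close> turns \<open>m\<close> into the product known from \<open>mK\<close>.\<close>
  have "H * (K * ?X) = H * (2 * H * P * B * K - 2 * H\<^sup>2 * K * (H * B - a * s\<^sup>2) + 6 * P * a * s\<^sup>2 * K
      - 4 * H * P * a * s * u - H\<^sup>2 * P * Q)"
    using crit mK P_def by algebra
  then have "K * ?X = 2 * H * P * B * K - 2 * H\<^sup>2 * K * (H * B - a * s\<^sup>2) + 6 * P * a * s\<^sup>2 * K
      - 4 * H * P * a * s * u - H\<^sup>2 * P * Q" using H0 by simp
  \<comment> \<open>The cone condition is 25 P \<le> 8 H^2. Splitting off its slack times
    \<open>K * (H * B - a * s\<^sup>2)\<close> produces the constants of \<open>cone_form\<close>: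
    17/4 = 25/4 - 2 and 49/4 = 25/4 + 6.\<close>
  also have "\<dots> = - (P * (K * (17/4 * H * B - 49/4 * a * s\<^sup>2) + 4 * H * a * s * u + H\<^sup>2 * Q))
      - (8 * H\<^sup>2 - 25 * P) * (K * (H * B - a * s\<^sup>2)) / 4"
    by (simp add: field_simps)
  also have "\<dots> \<le> 0"
  proof -
    have "0 \<le> P * (K * (17/4 * H * B - 49/4 * a * s\<^sup>2) + 4 * H * a * s * u + H\<^sup>2 * Q)"
      using P0 3 by simp
    moreover have "0 \<le> (8 * H\<^sup>2 - 25 * P) * (K * (H * B - a * s\<^sup>2))" using 1 2 K0 by simp
    ultimately show ?thesis by simp
  qed
  finally show ?thesis using K0 by (simp add: mult_le_0_iff)
qed

text \<open>Written in H, S and C, the reaction is - H times the polynomial of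
  \<open>psi_reaction\<close>. Its first weighted sum is Euler's relation: a difference of terms of
  degrees 4 and 3 with equal values yields that value.\<close>

lemma psi_reaction_le:
  fixes a b c :: real
  assumes p: "a > 0" "b > 0" "c > 0" and H: "H = a + b + c" and T: "T = a * b + a * c + b * c"
    and S: "S = a\<^sup>2 + b\<^sup>2 + c\<^sup>2" and C: "C = a ^ 3 + b ^ 3 + c ^ 3"
    and m: "m * (a * b * c) = H\<^sup>2 * (2 * H\<^sup>2 - 6 * T)" and \<alpha>: "\<alpha> = 8 * H ^ 3 - 12 * H * T"
    and g: "g1 = \<alpha> - 6 * H\<^sup>2 * (b + c) - m * (b * c)" "g2 = \<alpha> - 6 * H\<^sup>2 * (a + c) - m * (a * c)"
      "g3 = \<alpha> - 6 * H\<^sup>2 * (a + b) - m * (a * b)"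
  shows "- S * (g1 * a\<^sup>2 + g2 * b\<^sup>2 + g3 * c\<^sup>2) + 2 * C * (g1 * a + g2 * b + g3 * c) \<le> 0"
proof -
  have T': "T = (H\<^sup>2 - S) / 2" unfolding H T S by (simp add: power2_eq_square algebra_simps)
  have 1: "g1 * a + g2 * b + g3 * c = H\<^sup>2 * (2 * H\<^sup>2 - 6 * T)"
  proof -
    have "g1 * a + g2 * b + g3 * c = \<alpha> * H - 12 * H\<^sup>2 * T - 3 * (m * (a * b * c))"
      unfolding g H T by algebra
    then show ?thesis unfolding m \<alpha> by algebra
  qed
  have 2: "g1 * a\<^sup>2 + g2 * b\<^sup>2 + g3 * c\<^sup>2 = \<alpha> * S - 6 * H\<^sup>2 * (H * S - C) - (m * (a * b * c)) * H"
    unfolding g H S C by algebra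
  have "- S * (g1 * a\<^sup>2 + g2 * b\<^sup>2 + g3 * c\<^sup>2) + 2 * C * (g1 * a + g2 * b + g3 * c) =
     - H * (6 * S ^ 3 - 7 * S\<^sup>2 * H\<^sup>2 + S * H ^ 4 + 2 * C * H ^ 3)"
    unfolding 1 2 m \<alpha> T' by (simp add: field_simps power2_eq_square power3_eq_cube power4_eq_xxxx)
  also have "\<dots> \<le> 0"
  proof -
    have "0 \<le> H * (6 * S ^ 3 - 7 * S\<^sup>2 * H\<^sup>2 + S * H ^ 4 + 2 * C * H ^ 3)"
      unfolding H S C using p by (intro mult_nonneg_nonneg psi_reaction) simp_all
    then show ?thesis by (simp only: mult_minus_left neg_le_0_iff_le)
  qed
  finally show ?thesis .
qed

section \<open>Sign of the time derivative at a spatial maximum\<close>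

context graph_param
begin

lemma l_pos: "l $ i > 0" using pos[OF p0] by (simp add: l_def)

lemma esym_l: "esym1 (\<kappa> (0, t0)) = l$1 + l$2 + l$3" "esym2 (\<kappa> (0, t0)) = l$1 * l$2 + l$1 * l$3 + l$2 * l$3"
  "esym3 (\<kappa> (0, t0)) = l$1 * l$2 * l$3"
  by (simp_all add: esym1_def esym2_def esym3_def l_def)

lemma DD_swap:
  "DD 1 2 = W4 1 2 - l$1 * (l$2)\<^sup>2" "DD 2 1 = W4 1 2 - l$2 * (l$1)\<^sup>2"
  "DD 1 3 = W4 1 3 - l$1 * (l$3)\<^sup>2" "DD 3 1 = W4 1 3 - l$3 * (l$1)\<^sup>2"
  "DD 2 3 = W4 2 3 - l$2 * (l$3)\<^sup>2" "DD 3 2 = W4 2 3 - l$3 * (l$2)\<^sup>2"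
  by (simp_all add: DD_def W4_sym[of 2 1] W4_sym[of 3 1] W4_sym[of 3 2])

lemma W3_sort:
  "W3 1 2 1 = W3 1 1 2" "W3 2 1 1 = W3 1 1 2" "W3 1 3 1 = W3 1 1 3" "W3 3 1 1 = W3 1 1 3"
  "W3 2 1 2 = W3 1 2 2" "W3 2 2 1 = W3 1 2 2" "W3 3 1 3 = W3 1 3 3" "W3 3 3 1 = W3 1 3 3"
  "W3 2 3 2 = W3 2 2 3" "W3 3 2 2 = W3 2 2 3" "W3 3 2 3 = W3 2 3 3" "W3 3 3 2 = W3 2 3 3"
  "W3 1 3 2 = W3 1 2 3" "W3 2 1 3 = W3 1 2 3" "W3 2 3 1 = W3 1 2 3" "W3 3 1 2 = W3 1 2 3" "W3 3 2 1 = W3 1 2 3"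
  by (metis W3_sym)+

lemma Tm_sorted:
  "Tm 1 = 2 * (l$1 * DD 1 1 + l$2 * DD 2 1 + l$3 * DD 3 1) + 2 * ((W3 1 1 1)\<^sup>2 + (W3 1 2 2)\<^sup>2 + (W3 1 3 3)\<^sup>2
     + 2 * (W3 1 1 2)\<^sup>2 + 2 * (W3 1 1 3)\<^sup>2 + 2 * (W3 1 2 3)\<^sup>2) + ((l$1)\<^sup>2 + (l$2)\<^sup>2 + (l$3)\<^sup>2) * (l$1)\<^sup>2"
  "Tm 2 = 2 * (l$1 * DD 1 2 + l$2 * DD 2 2 + l$3 * DD 3 2) + 2 * ((W3 1 1 2)\<^sup>2 + (W3 2 2 2)\<^sup>2 + (W3 2 3 3)\<^sup>2
     + 2 * (W3 1 2 2)\<^sup>2 + 2 * (W3 1 2 3)\<^sup>2 + 2 * (W3 2 2 3)\<^sup>2) + ((l$1)\<^sup>2 + (l$2)\<^sup>2 + (l$3)\<^sup>2) * (l$2)\<^sup>2"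
  "Tm 3 = 2 * (l$1 * DD 1 3 + l$2 * DD 2 3 + l$3 * DD 3 3) + 2 * ((W3 1 1 3)\<^sup>2 + (W3 2 2 3)\<^sup>2 + (W3 3 3 3)\<^sup>2
     + 2 * (W3 1 2 3)\<^sup>2 + 2 * (W3 1 3 3)\<^sup>2 + 2 * (W3 2 3 3)\<^sup>2) + ((l$1)\<^sup>2 + (l$2)\<^sup>2 + (l$3)\<^sup>2) * (l$3)\<^sup>2"
  by (simp_all add: Tm_def SF_def S0_def W3_sort)

text \<open>The gradient of 7 e1^2 - 25 e2 by the symmetric functions is (14 H, -25, 0), and its
  Hessian contributes \<open>14 * (s k)\<^sup>2\<close> to the second space derivatives, which are
  nonpositive at the maximum. Strictness comes from \<open>pinching_reaction\<close> alone.\<close>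

lemma pinching_time:
  assumes max: "\<And>z. z \<in> V \<Longrightarrow> 7 * (esym1 (\<kappa> (z, t0)))\<^sup>2 - 25 * esym2 (\<kappa> (z, t0)) \<le> 0"
    and eq: "7 * (esym1 (\<kappa> (0, t0)))\<^sup>2 - 25 * esym2 (\<kappa> (0, t0)) = 0"
  shows "\<exists>d<0. ((\<lambda>t. 7 * (esym1 (\<kappa> (0, t)))\<^sup>2 - 25 * esym2 (\<kappa> (0, t))) has_real_derivative d) (at t0 within I)"
proof -
  define a b c where abc: "a = l$1" "b = l$2" "c = l$3"
  define H where "H = a + b + c"
  define s where "s k = W3 1 1 k + W3 2 2 k + W3 3 3 k" for k
  define g1 g2 g3 where g: "g1 = 14 * H + (-25) * (b + c) + 0 * (b * c)" "g2 = 14 * H + (-25) * (a + c) + 0 * (a * c)"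
    "g3 = 14 * H + (-25) * (a + b) + 0 * (a * b)"
  define q where "q k = 2 * (-25) * (W3 1 1 k * W3 2 2 k - (W3 1 2 k)\<^sup>2 + W3 1 1 k * W3 3 3 k - (W3 1 3 k)\<^sup>2 + W3 2 2 k * W3 3 3 k - (W3 2 3 k)\<^sup>2)
     + 2 * 0 * (c * (W3 1 1 k * W3 2 2 k - (W3 1 2 k)\<^sup>2) + b * (W3 1 1 k * W3 3 3 k - (W3 1 3 k)\<^sup>2) + a * (W3 2 2 k * W3 3 3 k - (W3 2 3 k)\<^sup>2))" for k
  have p: "a > 0" "b > 0" "c > 0" using l_pos by (auto simp: abc)
  have H0: "H > 0" using p by (simp add: H_def)
  have eq': "7 * (a + b + c)\<^sup>2 = 25 * (a * b + a * c + b * c)" using eq by (simp add: esym_l abc)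
  have jet: "jet2 (\<lambda>s. 7 * (esym1 (\<kappa> (s *\<^sub>R ax k, t0)) * esym1 (\<kappa> (s *\<^sub>R ax k, t0))) - 25 * esym2 (\<kappa> (s *\<^sub>R ax k, t0)))
      0 (g1 * W3 1 1 k + g2 * W3 2 2 k + g3 * W3 3 3 k) (g1 * DD 1 k + g2 * DD 2 k + g3 * DD 3 k + q k + 14 * (s k)\<^sup>2)" for k
    by (rule jet2_eq, (rule jet2_diff jet2_cmult jet2_mult jet_esym1 jet_esym2)+)
       (use eq' in \<open>simp_all add: abc g H_def q_def s_def power2_eq_square algebra_simps\<close>)
  have GG: "g1 * DD 1 k + g2 * DD 2 k + g3 * DD 3 k + q k + 14 * (s k)\<^sup>2 \<le> 0" for k
  proof -
    have ev: "\<forall>\<^sub>F z in nhds 0. 7 * (esym1 (\<kappa> (z, t0)) * esym1 (\<kappa> (z, t0))) - 25 * esym2 (\<kappa> (z, t0)) \<le> 0"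
      using eventually_nhds_in_open[OF openV origin] by eventually_elim (use max in \<open>simp add: power2_eq_square\<close>)
    show ?thesis
      using jet2_local_max[OF jet[of k]] eventually_line[OF ev, of "ax k"] eq by (simp add: power2_eq_square)
  qed
  define G where "G k = g1 * DD 1 k + g2 * DD 2 k + g3 * DD 3 k + q k" for k
  define B where "B x y z = x\<^sup>2 + 3 * y\<^sup>2 + 3 * z\<^sup>2" for x y z :: real
  have key: "g1 * Tm 1 + g2 * Tm 2 + g3 * Tm 3 = 2 * (a * G 1 + b * G 2 + c * G 3)
     - (a\<^sup>2 + b\<^sup>2 + c\<^sup>2) * (g1 * a\<^sup>2 + g2 * b\<^sup>2 + g3 * c\<^sup>2) + 2 * (a ^ 3 + b ^ 3 + c ^ 3) * (g1 * a + g2 * b + g3 * c)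
     + 2 * ((14 * H * B (W3 1 1 1) (W3 1 2 2) (W3 1 3 3) - 25 * (H * B (W3 1 1 1) (W3 1 2 2) (W3 1 3 3) - a * (W3 1 1 1 + W3 1 2 2 + W3 1 3 3)\<^sup>2))
       + (14 * H * B (W3 2 2 2) (W3 1 1 2) (W3 2 3 3) - 25 * (H * B (W3 2 2 2) (W3 1 1 2) (W3 2 3 3) - b * (W3 2 2 2 + W3 1 1 2 + W3 2 3 3)\<^sup>2))
       + (14 * H * B (W3 3 3 3) (W3 1 1 3) (W3 2 2 3) - 25 * (H * B (W3 3 3 3) (W3 1 1 3) (W3 2 2 3) - c * (W3 3 3 3 + W3 1 1 3 + W3 2 2 3)\<^sup>2)))
     + (4 * (g1 + g2 + g3) + 4 * (-25) * H) * (W3 1 2 3)\<^sup>2"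
    using gradient_identity[OF DD_swap Tm_sorted, of "G 1" "14 * H" "-25" 0 "G 2" "G 3"]
    unfolding G_def q_def g abc[symmetric] H_def[symmetric]
    by (simp add: W3_sort B_def)
  have s: "s 1 = W3 1 1 1 + W3 1 2 2 + W3 1 3 3" "s 2 = W3 2 2 2 + W3 1 1 2 + W3 2 3 3" "s 3 = W3 3 3 3 + W3 1 1 3 + W3 2 2 3"
    by (simp_all add: s_def W3_sort)
  have Bs: "a * (s 1)\<^sup>2 \<le> H * B (W3 1 1 1) (W3 1 2 2) (W3 1 3 3)" "b * (s 2)\<^sup>2 \<le> H * B (W3 2 2 2) (W3 1 1 2) (W3 2 3 3)"
    "c * (s 3)\<^sup>2 \<le> H * B (W3 3 3 3) (W3 1 1 3) (W3 2 2 3)"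
  proof -
    have "7 * (b + a + c)\<^sup>2 \<le> 25 * (b * a + b * c + a * c)" "7 * (c + a + b)\<^sup>2 \<le> 25 * (c * a + c * b + a * b)"
      using eq' by (simp_all add: algebra_simps)
    then show "a * (s 1)\<^sup>2 \<le> H * B (W3 1 1 1) (W3 1 2 2) (W3 1 3 3)" "b * (s 2)\<^sup>2 \<le> H * B (W3 2 2 2) (W3 1 1 2) (W3 2 3 3)"
      "c * (s 3)\<^sup>2 \<le> H * B (W3 3 3 3) (W3 1 1 3) (W3 2 2 3)"
      using cone_sum_sq[OF p, of "W3 1 1 1" "W3 1 2 2" "W3 1 3 3"] cone_sum_sq[OF p(2,1,3), of "W3 2 2 2" "W3 1 1 2" "W3 2 3 3"]
        cone_sum_sq[OF p(3,1,2), of "W3 3 3 3" "W3 1 1 3" "W3 2 2 3"] eq'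
      unfolding s B_def H_def by (simp_all add: add_ac)
  qed
  have GG': "G 1 \<le> - 14 * (s 1)\<^sup>2" "G 2 \<le> - 14 * (s 2)\<^sup>2" "G 3 \<le> - 14 * (s 3)\<^sup>2"
    using GG[of 1] GG[of 2] GG[of 3] unfolding G_def by simp_all
  have aG: "a * G 1 \<le> a * (- 14 * (s 1)\<^sup>2)" "b * G 2 \<le> b * (- 14 * (s 2)\<^sup>2)" "c * G 3 \<le> c * (- 14 * (s 3)\<^sup>2)"
    using mult_left_mono[OF GG'(1) less_imp_le[OF p(1)]] mult_left_mono[OF GG'(2) less_imp_le[OF p(2)]]
      mult_left_mono[OF GG'(3) less_imp_le[OF p(3)]] .
  define R where "R = (a\<^sup>2 + b\<^sup>2 + c\<^sup>2) * (25 * (a ^ 3 + b ^ 3 + c ^ 3) - 11 * H * (a\<^sup>2 + b\<^sup>2 + c\<^sup>2))"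
  have R: "R > 0"
    using pinching_reaction[OF p eq'] p unfolding R_def H_def by (intro mult_pos_pos add_pos_pos) auto
  have r1: "(4 * (g1 + g2 + g3) + 4 * (-25) * H) * (W3 1 2 3)\<^sup>2 = - 132 * (H * (W3 1 2 3)\<^sup>2)"
    unfolding g H_def by algebra
  \<comment> \<open>Euler's relation for a quadratic function at one of its zeros; it removes the
    reaction term with the sum of cubes.\<close>
  have r2: "g1 * a + g2 * b + g3 * c = 0"
    using eq' by (simp add: g H_def power2_eq_square algebra_simps)
  have r3: "(a\<^sup>2 + b\<^sup>2 + c\<^sup>2) * (g1 * a\<^sup>2 + g2 * b\<^sup>2 + g3 * c\<^sup>2) = R"
    unfolding R_def g H_def by algebra
  have r4: "H * (W3 1 2 3)\<^sup>2 \<ge> 0" using H0 by simp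
  have r5: "14 * H * y - 25 * (H * y - x) = - 11 * (H * y) + 25 * x" for x y by algebra
  have r6: "x * (- 14 * y) = - 14 * (x * y)" for x y :: real by simp
  \<comment> \<open>The third-derivative terms balance exactly: the space derivatives give -28 for
    each \<open>x1\<close>, \<open>x2\<close>, \<open>x3\<close>, and the forms give at most 50 - 22
    = 28.\<close>
  have arith: "Q \<le> - R" if "Q = 2 * (A1 + A2 + A3) - R + 0 + 2 * ((- 11 * h1 + 25 * x1) + (- 11 * h2 + 25 * x2) + (- 11 * h3 + 25 * x3)) + - 132 * w"
    "x1 \<le> h1" "x2 \<le> h2" "x3 \<le> h3" "A1 \<le> - 14 * x1" "A2 \<le> - 14 * x2" "A3 \<le> - 14 * x3" "0 \<le> w"
    for Q A1 A2 A3 h1 h2 h3 x1 x2 x3 w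
    using that by argo
  have "g1 * Tm 1 + g2 * Tm 2 + g3 * Tm 3 \<le> - R"
    by (rule arith[OF key[unfolded s[symmetric] r1 r2 r3 r5 mult_zero_right] Bs aG[unfolded r6] r4])
  then have neg: "g1 * Tm 1 + g2 * Tm 2 + g3 * Tm 3 < 0" using R by linarith
  have "((\<lambda>t. 7 * (esym1 (\<kappa> (0, t)))\<^sup>2 - 25 * esym2 (\<kappa> (0, t))) has_real_derivative
      g1 * Tm 1 + g2 * Tm 2 + g3 * Tm 3) (at t0 within I)"
    by (rule DERIV_cong, (rule derivative_intros esym_time)+)
       (simp add: esym_l g abc H_def algebra_simps)
  then show ?thesis using neg by blast
qed

text \<open>With \<open>m\<close> frozen at the maximum of \<psi>, the function e1^2 (2 e1^2 - 6 e2)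
  - m e3 is nonpositive on the slice and vanishes at the base point, so it has a maximum there as
  well.\<close>

lemma psi_time:
  assumes max: "\<And>z. z \<in> V \<Longrightarrow> (esym1 (\<kappa> (z, t0)))\<^sup>2 * (2 * (esym1 (\<kappa> (z, t0)))\<^sup>2 - 6 * esym2 (\<kappa> (z, t0))) \<le> m * esym3 (\<kappa> (z, t0))"
    and eq: "(esym1 (\<kappa> (0, t0)))\<^sup>2 * (2 * (esym1 (\<kappa> (0, t0)))\<^sup>2 - 6 * esym2 (\<kappa> (0, t0))) = m * esym3 (\<kappa> (0, t0))"
    and m: "m > 0"
    and cone: "7 * (esym1 (\<kappa> (0, t0)))\<^sup>2 \<le> 25 * esym2 (\<kappa> (0, t0))"
  shows "\<exists>d\<le>0. ((\<lambda>t. (esym1 (\<kappa> (0, t)))\<^sup>2 * (2 * (esym1 (\<kappa> (0, t)))\<^sup>2 - 6 * esym2 (\<kappa> (0, t))) - m * esym3 (\<kappa> (0, t)))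
     has_real_derivative d) (at t0 within I)"
proof -
  define a b c where abc: "a = l$1" "b = l$2" "c = l$3"
  define H where "H = a + b + c"
  define T where "T = a * b + a * c + b * c"
  define S where "S = a\<^sup>2 + b\<^sup>2 + c\<^sup>2"
  define C where "C = a ^ 3 + b ^ 3 + c ^ 3"
  \<comment> \<open>\<alpha>, \<beta> and \<open>- m\<close> are the derivatives of e1^2 (2 e1^2 - 6
    e2) - m e3 by e1, e2 and e3 at the base point.\<close>
  define \<alpha> where "\<alpha> = 8 * H ^ 3 - 12 * H * T"
  define \<beta> where "\<beta> = - 6 * H\<^sup>2"
  define s where "s k = W3 1 1 k + W3 2 2 k + W3 3 3 k" for k
  define t where "t k = (b + c) * W3 1 1 k + (a + c) * W3 2 2 k + (a + b) * W3 3 3 k" for k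
  define u where "u k = b * c * W3 1 1 k + a * c * W3 2 2 k + a * b * W3 3 3 k" for k
  define g1 g2 g3 where g: "g1 = \<alpha> + \<beta> * (b + c) + (- m) * (b * c)" "g2 = \<alpha> + \<beta> * (a + c) + (- m) * (a * c)"
    "g3 = \<alpha> + \<beta> * (a + b) + (- m) * (a * b)"
  define q where "q k = 2 * \<beta> * (W3 1 1 k * W3 2 2 k - (W3 1 2 k)\<^sup>2 + W3 1 1 k * W3 3 3 k - (W3 1 3 k)\<^sup>2 + W3 2 2 k * W3 3 3 k - (W3 2 3 k)\<^sup>2)
     + 2 * (- m) * (c * (W3 1 1 k * W3 2 2 k - (W3 1 2 k)\<^sup>2) + b * (W3 1 1 k * W3 3 3 k - (W3 1 3 k)\<^sup>2) + a * (W3 2 2 k * W3 3 3 k - (W3 2 3 k)\<^sup>2))" for k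
  define G where "G k = g1 * DD 1 k + g2 * DD 2 k + g3 * DD 3 k + q k" for k
  have p: "a > 0" "b > 0" "c > 0" using l_pos by (auto simp: abc)
  have H0: "H > 0" using p by (simp add: H_def)
  have mK: "m * (a * b * c) = H\<^sup>2 * (2 * H\<^sup>2 - 6 * T)" using eq by (simp add: esym_l abc H_def T_def)
  have cone': "7 * H\<^sup>2 \<le> 25 * T" using cone by (simp add: esym_l abc H_def T_def)
  have "H\<^sup>2 * (2 * H\<^sup>2 - 6 * T) > 0" using p m unfolding mK[symmetric] by simp
  then have P: "2 * H\<^sup>2 - 6 * T > 0" using H0 by (simp add: zero_less_mult_iff)
  have e0: "esym1 (\<kappa> (0, t0)) = H" "esym2 (\<kappa> (0, t0)) = T" "esym3 (\<kappa> (0, t0)) = a * b * c"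
    by (simp_all add: esym_l abc H_def T_def)
  have j1: "jet2 (\<lambda>s. esym1 (\<kappa> (s *\<^sub>R ax k, t0))) H (s k) (DD 1 k + DD 2 k + DD 3 k)" for k
    by (rule jet2_eq[OF jet_esym1]) (simp_all add: abc H_def s_def)
  have j2: "jet2 (\<lambda>s. esym2 (\<kappa> (s *\<^sub>R ax k, t0))) T (t k) ((b + c) * DD 1 k + (a + c) * DD 2 k + (a + b) * DD 3 k +
     2 * (W3 1 1 k * W3 2 2 k - (W3 1 2 k)\<^sup>2 + W3 1 1 k * W3 3 3 k - (W3 1 3 k)\<^sup>2 + W3 2 2 k * W3 3 3 k - (W3 2 3 k)\<^sup>2))" for k
    by (rule jet2_eq[OF jet_esym2]) (simp_all add: abc T_def t_def)
  have j3: "jet2 (\<lambda>s. esym3 (\<kappa> (s *\<^sub>R ax k, t0))) (a * b * c) (u k) (b * c * DD 1 k + a * c * DD 2 k + a * b * DD 3 k +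
     2 * (c * (W3 1 1 k * W3 2 2 k - (W3 1 2 k)\<^sup>2) + b * (W3 1 1 k * W3 3 3 k - (W3 1 3 k)\<^sup>2)
        + a * (W3 2 2 k * W3 3 3 k - (W3 2 3 k)\<^sup>2)))" for k
    by (rule jet2_eq[OF jet_esym3]) (simp_all add: abc u_def)
  let ?F = "\<lambda>z. (esym1 (\<kappa> (z, t0)) * esym1 (\<kappa> (z, t0))) * (2 * (esym1 (\<kappa> (z, t0)) * esym1 (\<kappa> (z, t0))) - 6 * esym2 (\<kappa> (z, t0)))
      - m * esym3 (\<kappa> (z, t0))"
  have jet: "jet2 (\<lambda>s. ?F (s *\<^sub>R ax k)) 0 (\<alpha> * s k + \<beta> * t k - m * u k)
      (G k + (24 * H\<^sup>2 - 12 * T) * (s k)\<^sup>2 - 24 * H * s k * t k)" for k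
    by (rule jet2_eq, (rule jet2_diff jet2_cmult jet2_mult j1 j2 j3)+)
       (use mK in \<open>simp_all add: g G_def q_def \<alpha>_def \<beta>_def power2_eq_square power3_eq_cube algebra_simps\<close>)
  have ev: "\<forall>\<^sub>F z in nhds 0. ?F z \<le> 0"
    using eventually_nhds_in_open[OF openV origin] by eventually_elim (use max in \<open>simp add: power2_eq_square\<close>)
  have F0: "?F 0 = 0" using eq by (simp add: power2_eq_square)
  have crit: "\<alpha> * s k + \<beta> * t k - m * u k = 0"
    and GG: "G k + (24 * H\<^sup>2 - 12 * T) * (s k)\<^sup>2 - 24 * H * s k * t k \<le> 0" for k
    using jet2_local_max[OF jet[of k]] eventually_line[OF ev, of "ax k"] F0 by simp_all
  define B where "B x y z = x\<^sup>2 + 3 * y\<^sup>2 + 3 * z\<^sup>2" for x y z :: real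
  define E where "E p q r x y z = q * r * B x y z + 2 * p * r * y\<^sup>2 + 2 * p * q * z\<^sup>2
         - 2 * (p * r * x * y + p * q * x * z + p\<^sup>2 * y * z)" for p q r x y z :: real
  have s: "s 1 = W3 1 1 1 + W3 1 2 2 + W3 1 3 3" "s 2 = W3 2 2 2 + W3 1 1 2 + W3 2 3 3" "s 3 = W3 3 3 3 + W3 1 1 3 + W3 2 2 3"
    by (simp_all add: s_def W3_sort)
  have key: "g1 * Tm 1 + g2 * Tm 2 + g3 * Tm 3 = 2 * (a * G 1 + b * G 2 + c * G 3)
     - S * (g1 * a\<^sup>2 + g2 * b\<^sup>2 + g3 * c\<^sup>2) + 2 * C * (g1 * a + g2 * b + g3 * c)
     + 2 * ((\<alpha> * B (W3 1 1 1) (W3 1 2 2) (W3 1 3 3) + \<beta> * (H * B (W3 1 1 1) (W3 1 2 2) (W3 1 3 3) - a * (s 1)\<^sup>2) + (- m) * E a b c (W3 1 1 1) (W3 1 2 2) (W3 1 3 3))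
       + (\<alpha> * B (W3 2 2 2) (W3 1 1 2) (W3 2 3 3) + \<beta> * (H * B (W3 2 2 2) (W3 1 1 2) (W3 2 3 3) - b * (s 2)\<^sup>2) + (- m) * E b a c (W3 2 2 2) (W3 1 1 2) (W3 2 3 3))
       + (\<alpha> * B (W3 3 3 3) (W3 1 1 3) (W3 2 2 3) + \<beta> * (H * B (W3 3 3 3) (W3 1 1 3) (W3 2 2 3) - c * (s 3)\<^sup>2) + (- m) * E c a b (W3 3 3 3) (W3 1 1 3) (W3 2 2 3)))
     + (4 * (g1 + g2 + g3) + 4 * \<beta> * H + 4 * (- m) * S) * (W3 1 2 3)\<^sup>2"
    unfolding s E_def B_def S_def C_def H_def g
    by (rule gradient_identity[OF DD_swap[folded abc] Tm_sorted[folded abc]])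
       (simp_all add: G_def q_def g W3_sort algebra_simps)
  have 1: "\<alpha> * B (W3 1 1 1) (W3 1 2 2) (W3 1 3 3) + \<beta> * (H * B (W3 1 1 1) (W3 1 2 2) (W3 1 3 3) - a * (s 1)\<^sup>2) + (- m) * E a b c (W3 1 1 1) (W3 1 2 2) (W3 1 3 3)
     \<le> a * ((24 * H\<^sup>2 - 12 * T) * (s 1)\<^sup>2 - 24 * H * s 1 * t 1)"
    using psi_group[OF p H_def T_def cone' mK P B_def s(1) _ E_def, of "u 1" "t 1"] crit[of 1]
    unfolding \<alpha>_def \<beta>_def by (simp add: u_def W3_sort)
  have 2: "\<alpha> * B (W3 2 2 2) (W3 1 1 2) (W3 2 3 3) + \<beta> * (H * B (W3 2 2 2) (W3 1 1 2) (W3 2 3 3) - b * (s 2)\<^sup>2) + (- m) * E b a c (W3 2 2 2) (W3 1 1 2) (W3 2 3 3)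
     \<le> b * ((24 * H\<^sup>2 - 12 * T) * (s 2)\<^sup>2 - 24 * H * s 2 * t 2)"
  proof -
    have x: "H = b + a + c" "T = b * a + b * c + a * c" "m * (b * a * c) = H\<^sup>2 * (2 * H\<^sup>2 - 6 * T)"
      using mK by (simp_all add: H_def T_def mult_ac)
    show ?thesis
      using psi_group[OF p(2,1,3) x(1,2) cone' x(3) P B_def s(2) _ E_def, of "u 2" "t 2"] crit[of 2]
      unfolding \<alpha>_def \<beta>_def by (simp add: u_def W3_sort mult_ac)
  qed
  have 3: "\<alpha> * B (W3 3 3 3) (W3 1 1 3) (W3 2 2 3) + \<beta> * (H * B (W3 3 3 3) (W3 1 1 3) (W3 2 2 3) - c * (s 3)\<^sup>2) + (- m) * E c a b (W3 3 3 3) (W3 1 1 3) (W3 2 2 3)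
     \<le> c * ((24 * H\<^sup>2 - 12 * T) * (s 3)\<^sup>2 - 24 * H * s 3 * t 3)"
  proof -
    have x: "H = c + a + b" "T = c * a + c * b + a * b" "m * (c * a * b) = H\<^sup>2 * (2 * H\<^sup>2 - 6 * T)"
      using mK by (simp_all add: H_def T_def mult_ac)
    show ?thesis
      using psi_group[OF p(3,1,2) x(1,2) cone' x(3) P B_def s(3) _ E_def, of "u 3" "t 3"] crit[of 3]
      unfolding \<alpha>_def \<beta>_def by (simp add: u_def W3_sort mult_ac add_ac)
  qed
  have 4: "- S * (g1 * a\<^sup>2 + g2 * b\<^sup>2 + g3 * c\<^sup>2) + 2 * C * (g1 * a + g2 * b + g3 * c) \<le> 0"
    by (rule psi_reaction_le[OF p H_def T_def S_def C_def mK \<alpha>_def]) (simp_all add: g \<beta>_def)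
  \<comment> \<open>The cone gives H^2 \<le> 25/7 T, which is below 6 T; the rest is a negative
    multiple of \<open>m\<close>.\<close>
  have 5: "4 * (g1 + g2 + g3) + 4 * \<beta> * H + 4 * (- m) * S \<le> 0"
  proof -
    have "4 * (g1 + g2 + g3) + 4 * \<beta> * H + 4 * (- m) * S = 24 * H * (H\<^sup>2 - 6 * T) - 4 * (m * (T + S))"
      unfolding g \<alpha>_def \<beta>_def H_def T_def S_def by algebra
    moreover have "H * (H\<^sup>2 - 6 * T) \<le> 0"
    proof (rule mult_nonneg_nonpos)
      have "T > 0" using p by (simp add: T_def add_pos_pos)
      then show "H\<^sup>2 - 6 * T \<le> 0" using cone' by linarith
    qed (use H0 in simp)
    moreover have "m * (T + S) \<ge> 0" using m p by (simp add: T_def S_def)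
    ultimately show ?thesis by linarith
  qed
  have 6: "(4 * (g1 + g2 + g3) + 4 * \<beta> * H + 4 * (- m) * S) * (W3 1 2 3)\<^sup>2 \<le> 0"
    using 5 by (intro mult_nonpos_nonneg) auto
  have Gk: "G k \<le> - ((24 * H\<^sup>2 - 12 * T) * (s k)\<^sup>2 - 24 * H * s k * t k)" for k
    using GG[of k] by linarith
  have 7: "a * G 1 \<le> a * - ((24 * H\<^sup>2 - 12 * T) * (s 1)\<^sup>2 - 24 * H * s 1 * t 1)"
    "b * G 2 \<le> b * - ((24 * H\<^sup>2 - 12 * T) * (s 2)\<^sup>2 - 24 * H * s 2 * t 2)"
    "c * G 3 \<le> c * - ((24 * H\<^sup>2 - 12 * T) * (s 3)\<^sup>2 - 24 * H * s 3 * t 3)"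
    using mult_left_mono[OF Gk less_imp_le[OF p(1)]] mult_left_mono[OF Gk less_imp_le[OF p(2)]]
      mult_left_mono[OF Gk less_imp_le[OF p(3)]] .
  have neg: "g1 * Tm 1 + g2 * Tm 2 + g3 * Tm 3 \<le> 0"
  proof -
    have arith: "Q \<le> 0" if "Q = 2 * (A1 + A2 + A3) - R1 + R2 + 2 * (X1 + X2 + X3) + w" "X1 \<le> Y1" "X2 \<le> Y2" "X3 \<le> Y3"
      "A1 \<le> - Y1" "A2 \<le> - Y2" "A3 \<le> - Y3" "- R1 + R2 \<le> 0" "w \<le> 0" for Q A1 A2 A3 X1 X2 X3 Y1 Y2 Y3 R1 R2 w :: real
      using that by argo
    show ?thesis
      by (rule arith[OF key 1 2 3 7[unfolded mult_minus_right] 4[unfolded mult_minus_left] 6])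
  qed
  have "((\<lambda>t. (esym1 (\<kappa> (0, t)))\<^sup>2 * (2 * (esym1 (\<kappa> (0, t)))\<^sup>2 - 6 * esym2 (\<kappa> (0, t))) - m * esym3 (\<kappa> (0, t)))
     has_real_derivative g1 * Tm 1 + g2 * Tm 2 + g3 * Tm 3) (at t0 within I)"
    by (rule DERIV_cong, (rule derivative_intros esym_time)+)
       (unfold e0, unfold abc[symmetric] g \<alpha>_def \<beta>_def, simp add: power2_eq_square power3_eq_cube algebra_simps)
  then show ?thesis using neg by blast
qed

end

context flow_param
begin

lemma pinching_decreasing:
  assumes p: "(z0, t0) \<in> S"
    and max: "\<And>z. z \<in> V \<Longrightarrow> 7 * (esym1 (\<kappa> (z, t0)))\<^sup>2 - 25 * esym2 (\<kappa> (z, t0)) \<le> 0"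
    and eq: "7 * (esym1 (\<kappa> (z0, t0)))\<^sup>2 - 25 * esym2 (\<kappa> (z0, t0)) = 0"
  shows "\<exists>d<0. ((\<lambda>t. 7 * (esym1 (\<kappa> (z0, t)))\<^sup>2 - 25 * esym2 (\<kappa> (z0, t))) has_real_derivative d) (at t0 within I)"
proof -
  obtain V' \<theta> E y0 where gp: "graph_param V' I (\<lambda>q. Y (\<theta> (fst q), snd q)) (\<lambda>q. N (\<theta> (fst q), snd q))
      (\<lambda>q. \<kappa> (\<theta> (fst q), snd q)) t0 E y0" and \<theta>: "\<theta> 0 = z0" "\<theta> ` V' \<subseteq> V"
    by (rule graph_at[OF p])
  show ?thesis
    using graph_param.pinching_time[OF gp] max \<theta>(2) eq by (auto simp: \<theta>(1))
qed

lemma psi_nonincreasing: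
  assumes p: "(z0, t0) \<in> S"
    and max: "\<And>z. z \<in> V \<Longrightarrow> (esym1 (\<kappa> (z, t0)))\<^sup>2 * (2 * (esym1 (\<kappa> (z, t0)))\<^sup>2 - 6 * esym2 (\<kappa> (z, t0))) \<le> m * esym3 (\<kappa> (z, t0))"
    and eq: "(esym1 (\<kappa> (z0, t0)))\<^sup>2 * (2 * (esym1 (\<kappa> (z0, t0)))\<^sup>2 - 6 * esym2 (\<kappa> (z0, t0))) = m * esym3 (\<kappa> (z0, t0))"
    and m: "m > 0"
    and cone: "7 * (esym1 (\<kappa> (z0, t0)))\<^sup>2 \<le> 25 * esym2 (\<kappa> (z0, t0))"
  shows "\<exists>d\<le>0. ((\<lambda>t. (esym1 (\<kappa> (z0, t)))\<^sup>2 * (2 * (esym1 (\<kappa> (z0, t)))\<^sup>2 - 6 * esym2 (\<kappa> (z0, t))) - m * esym3 (\<kappa> (z0, t)))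
     has_real_derivative d) (at t0 within I)"
proof -
  obtain V' \<theta> E y0 where gp: "graph_param V' I (\<lambda>q. Y (\<theta> (fst q), snd q)) (\<lambda>q. N (\<theta> (fst q), snd q))
      (\<lambda>q. \<kappa> (\<theta> (fst q), snd q)) t0 E y0" and \<theta>: "\<theta> 0 = z0" "\<theta> ` V' \<subseteq> V"
    by (rule graph_at[OF p])
  show ?thesis
    using graph_param.psi_time[OF gp, of m] max \<theta>(2) eq m cone by (auto simp: \<theta>(1))
qed

end

section \<open>The maximum principle on the closed hypersurface\<close>

lemma time_interval_iff: "t \<in> time_interval T \<longleftrightarrow> 0 \<le> t \<and> ereal t < T"
  by (simp add: time_interval_def)

lemma time_interval_between: "r \<in> time_interval T \<Longrightarrow> 0 \<le> s \<Longrightarrow> s \<le> r \<Longrightarrow> s \<in> time_interval T"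
  unfolding time_interval_iff by (meson ereal_less_eq(3) order_le_less_trans)

lemma time_interval_forward:
  assumes "t \<in> time_interval T"
  shows "\<exists>e>0. \<forall>s. 0 \<le> s \<and> s < e \<longrightarrow> t + s \<in> time_interval T"
proof -
  obtain r where r: "ereal t < ereal r" "ereal r < T"
    using assms ereal_dense2[of "ereal t" T] by (auto simp: time_interval_iff)
  have "r \<in> time_interval T" using r assms by (simp add: time_interval_iff)
  then show ?thesis
    using r assms time_interval_between[of r T]
    by (intro exI[of _ "r - t"]) (auto simp: time_interval_iff)
qed

lemma uniq_diff_time_interval: "uniq_diff (time_interval T)"
  unfolding uniq_diff_def
proof (intro ballI allI impI)
  fix t i e :: real
  assume t: "t \<in> time_interval T" and i: "i \<in> Basis" and e: "0 < e"
  obtain d where d: "d > 0" "\<And>s. 0 \<le> s \<Longrightarrow> s < d \<Longrightarrow> t + s \<in> time_interval T"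
    using time_interval_forward[OF t] by blast
  then show "\<exists>d. 0 < \<bar>d\<bar> \<and> \<bar>d\<bar> < e \<and> t + d *\<^sub>R i \<in> time_interval T"
    using i e by (intro exI[of _ "min d e / 2"]) auto
qed

locale convex_flow =
  fixes M :: "'m::t2_space set" and \<A> :: "'m atlas" and T :: ereal
    and X :: "real \<Rightarrow> 'm \<Rightarrow> real^4" and \<nu> :: "real \<Rightarrow> 'm \<Rightarrow> real^4" and \<kappa> :: "real \<Rightarrow> 'm \<Rightarrow> real^3"
  assumes flow: "A_squared_flow M \<A> T X \<nu> \<kappa>"
    and convex: "\<And>t. t \<in> time_interval T \<Longrightarrow> strictly_convex M (\<kappa> t)"
begin

abbreviation "I \<equiv> time_interval T"

lemma compact_M: "compact M" and M_nonempty: "M \<noteq> {}"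
  using flow by (auto simp: A_squared_flow_def closed_manifold_def)

lemma chart_cover: "x \<in> M \<Longrightarrow> \<exists>U \<phi> u. (U, \<phi>) \<in> \<A> \<and> u \<in> U \<and> \<phi> u = x"
  using flow unfolding A_squared_flow_def closed_manifold_def by blast

lemma zero_I: "0 \<in> I"
  using flow by (auto simp: A_squared_flow_def time_interval_iff zero_ereal_def)

context
  fixes U \<phi>
  assumes chart: "(U, \<phi>) \<in> \<A>"
begin

lemma chart_open: "open U" and chart_image: "openin (top_of_set M) (\<phi> ` U)"
  and chart_homeomorphism: "\<exists>\<psi>. homeomorphism U (\<phi> ` U) \<phi> \<psi>"
  using flow chart unfolding A_squared_flow_def closed_manifold_def by fast+

lemma chart_subset: "\<phi> ` U \<subseteq> M"
  using chart_image openin_imp_subset by blast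

text \<open>The geometric definitions differentiate one time slice at a time. On an open chart
  domain this agrees with the space-time derivative in a direction without time component.\<close>

lemma chart_flow_param:
  "flow_param U I (\<lambda>p. X (snd p) (\<phi> (fst p))) (\<lambda>p. \<nu> (snd p) (\<phi> (fst p))) (\<lambda>p. \<kappa> (snd p) (\<phi> (fst p)))"
proof -
  let ?S = "U \<times> I" and ?Y = "\<lambda>p. X (snd p) (\<phi> (fst p))"
  note U = chart_open
  have "smooth_on (\<lambda>(u, t). X t (\<phi> u)) ?S" using flow chart by (auto simp: A_squared_flow_def)
  then have Ck: "Ck_on k ?Y ?S" for k by (simp add: smooth_on_def case_prod_unfold)
  have in_M: "\<phi> u \<in> M" if "u \<in> U" for u using chart_subset that by auto
  have pd: "partial_deriv i (X t \<circ> \<phi>) u = par ?S ?Y i (u, t)" if "u \<in> U" "t \<in> I" for i u t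
  proof -
    have "partial_deriv i (X t \<circ> \<phi>) u = dirD U (axis i 1) (\<lambda>z. ?Y (z, t)) u"
      by (simp add: partial_deriv_def dirD_open[OF U that(1)] o_def)
    also have "\<dots> = par ?S ?Y i (u, t)"
      unfolding par_def by (rule dirD_slice[OF U that(2) Ck that(1)])
    finally show ?thesis .
  qed
  have pd2: "partial_deriv j (partial_deriv i (X t \<circ> \<phi>)) u = par2 ?S ?Y i j (u, t)" if "u \<in> U" "t \<in> I" for i j u t
  proof -
    have C: "Ck_on (Suc 0) (par ?S ?Y i) ?S" unfolding par_def by (rule Ck_on_dirD[OF Ck])
    have "partial_deriv j (partial_deriv i (X t \<circ> \<phi>)) u = dirD U (axis j 1) (partial_deriv i (X t \<circ> \<phi>)) u"
      by (simp add: partial_deriv_def[of j] dirD_open[OF U that(1)])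
    also have "\<dots> = dirD U (axis j 1) (\<lambda>z. par ?S ?Y i (z, t)) u"
      by (rule dirD_cong[OF that(1) pd[OF _ that(2)]])
    also have "\<dots> = par2 ?S ?Y i j (u, t)"
      unfolding par2_def by (rule dirD_slice[OF U that(2) C that(1)])
    finally show ?thesis .
  qed
  have pointwise: "outer_unit_normal M \<A> (X t) x (\<nu> t x)" "principal_curvatures \<A> (X t) (\<nu> t x) x (\<kappa> t x)"
    "((\<lambda>s. X s x) has_vector_derivative - norm_A_squared (\<kappa> t x) *\<^sub>R \<nu> t x) (at t within I)"
    if "t \<in> I" "x \<in> M" for t x
    using flow that by (auto simp: A_squared_flow_def)
  show ?thesis
  proof
    show "open U" by (rule U)
    show "uniq_diff I" by (rule uniq_diff_time_interval)
    show "\<And>t. t \<in> I \<Longrightarrow> \<exists>e>0. \<forall>s. 0 \<le> s \<and> s < e \<longrightarrow> t + s \<in> I" by (rule time_interval_forward)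
    show "Ck_on 6 ?Y ?S" by (rule Ck)
    fix p assume "p \<in> ?S"
    then obtain u t where p: "p = (u, t)" "u \<in> U" "t \<in> I" by auto
    note pw = pointwise[OF p(3) in_M[OF p(2)]]
    show "\<nu> (snd p) (\<phi> (fst p)) \<bullet> \<nu> (snd p) (\<phi> (fst p)) = 1"
      using pw(1) by (simp add: p outer_unit_normal_def norm_eq_1)
    have "partial_deriv i (X t \<circ> \<phi>) u \<bullet> \<nu> t (\<phi> u) = 0" for i
      using pw(1) chart p(2) unfolding outer_unit_normal_def by blast
    then show "par ?S ?Y i p \<bullet> \<nu> (snd p) (\<phi> (fst p)) = 0" for i
      using pd[OF p(2,3)] by (simp add: p(1))
    have "eigenvalues_wrt (induced_metric (X t \<circ> \<phi>) u) (second_fundamental_form (X t \<circ> \<phi>) (\<nu> t (\<phi> u)) u) (\<kappa> t (\<phi> u))"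
      using pw(2) chart p(2) unfolding principal_curvatures_def by blast
    moreover have "induced_metric (X t \<circ> \<phi>) u = gram ?S ?Y p"
      using pd[OF p(2,3)] by (simp add: induced_metric_def gram_def p(1))
    moreover have "second_fundamental_form (X t \<circ> \<phi>) (\<nu> t (\<phi> u)) u = sff ?S ?Y (\<nu> t (\<phi> u)) p"
      using pd2[OF p(2,3)] by (simp add: second_fundamental_form_def sff_def p(1))
    ultimately show "eigenvalues_wrt (gram ?S ?Y p) (sff ?S ?Y (\<nu> (snd p) (\<phi> (fst p))) p) (\<kappa> (snd p) (\<phi> (fst p)))"
      by (simp add: p(1))
    show "\<kappa> (snd p) (\<phi> (fst p)) $ i > 0" for i
      using convex[OF p(3)] in_M[OF p(2)] by (simp add: strictly_convex_def p(1))
    have "((\<lambda>s. ?Y (u, s)) has_vector_derivative dirD ?S (0, 1) ?Y (u, t)) (at t within I)"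
      by (rule Ck_on_time_derivative[OF Ck p(2,3)])
    from uniq_diff_deriv_eq[OF uniq_diff_time_interval p(3) this[unfolded has_vector_derivative_def], of 1]
      uniq_diff_deriv_eq[OF uniq_diff_time_interval p(3) pw(3)[unfolded has_vector_derivative_def], of 1]
    show "dirD ?S (0, 1) ?Y p = - norm_A_squared (\<kappa> (snd p) (\<phi> (fst p))) *\<^sub>R \<nu> (snd p) (\<phi> (fst p))"
      by (simp add: p(1))
  qed
qed

end

lemma continuous_from_charts:
  fixes f :: "'m \<times> real \<Rightarrow> real"
  assumes "\<And>U \<phi>. (U, \<phi>) \<in> \<A> \<Longrightarrow> continuous_on (U \<times> I) (\<lambda>p. f (\<phi> (fst p), snd p))"
  shows "continuous_on (M \<times> I) f"
  unfolding continuous_on_eq_continuous_within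
proof
  fix q assume q: "q \<in> M \<times> I"
  obtain U \<phi> u where c: "(U, \<phi>) \<in> \<A>" "u \<in> U" "\<phi> u = fst q" using chart_cover[of "fst q"] q by auto
  obtain \<psi> where \<psi>: "homeomorphism U (\<phi> ` U) \<phi> \<psi>" using chart_homeomorphism[OF c(1)] by blast
  obtain W where W: "open W" "\<phi> ` U = M \<inter> W" using chart_image[OF c(1)] by (auto simp: openin_open)
  have "continuous_on (\<phi> ` U \<times> I) (\<lambda>p. (\<lambda>p. f (\<phi> (fst p), snd p)) (\<psi> (fst p), snd p))"
  proof (rule continuous_on_compose2[OF assms[OF c(1)]])
    have c\<psi>: "continuous_on (\<phi> ` U) \<psi>" and im: "\<psi> ` \<phi> ` U \<subseteq> U" using \<psi> by (auto simp: homeomorphism_def)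
    show "continuous_on (\<phi> ` U \<times> I) (\<lambda>p. (\<psi> (fst p), snd p))"
      by (rule continuous_on_Pair[OF continuous_on_compose2[OF c\<psi> continuous_on_fst[OF continuous_on_id]]
            continuous_on_snd[OF continuous_on_id]]) auto
    show "(\<lambda>p. (\<psi> (fst p), snd p)) ` (\<phi> ` U \<times> I) \<subseteq> U \<times> I" using im by auto
  qed
  moreover have "f (\<phi> (fst (\<psi> (fst p), snd p)), snd (\<psi> (fst p), snd p)) = f p" if "p \<in> \<phi> ` U \<times> I" for p
    using \<psi> that by (auto simp: homeomorphism_def)
  ultimately have "continuous_on (\<phi> ` U \<times> I) f" by (rule continuous_on_eq)
  moreover have qU: "q \<in> \<phi> ` U \<times> I" using imageI[OF c(2), of \<phi>] c(3) q by (simp add: mem_Times_iff)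
  ultimately have "continuous (at q within \<phi> ` U \<times> I) f"
    unfolding continuous_on_eq_continuous_within by blast
  moreover have "at q within M \<times> I = at q within \<phi> ` U \<times> I"
    by (rule at_within_nhd[of _ "W \<times> UNIV"]) (use qU W in \<open>auto simp: mem_Times_iff open_Times\<close>)
  ultimately show "continuous (at q within M \<times> I) f" by simp
qed

lemma esym_continuous_on:
  "continuous_on (M \<times> I) (\<lambda>q. esym1 (\<kappa> (snd q) (fst q)))" "continuous_on (M \<times> I) (\<lambda>q. esym2 (\<kappa> (snd q) (fst q)))"
  "continuous_on (M \<times> I) (\<lambda>q. esym3 (\<kappa> (snd q) (fst q)))"
  using flow_param.esym_continuous[OF chart_flow_param] by (auto intro!: continuous_from_charts)

lemma esym_positive: "x \<in> M \<Longrightarrow> t \<in> I \<Longrightarrow> esym1 (\<kappa> t x) > 0" "x \<in> M \<Longrightarrow> t \<in> I \<Longrightarrow> esym3 (\<kappa> t x) > 0"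
  using convex by (simp_all add: strictly_convex_def esym1_def esym3_def add_pos_pos)

text \<open>Nonpositive exactly when the principal curvatures lie in the circular cone.\<close>

definition "pinch x t = 7 * (esym1 (\<kappa> t x))\<^sup>2 - 25 * esym2 (\<kappa> t x)"

lemma pinch_continuous: "continuous_on (M \<times> I) (\<lambda>q. pinch (fst q) (snd q))"
  unfolding pinch_def by (intro continuous_intros esym_continuous_on)

text \<open>In the interior of the cone continuity suffices. On its boundary the time derivative is
  negative at the point, hence by continuity of the derivative in a whole neighbourhood, and every
  nearby point starts at time \<open>s\<close> with a nonpositive value.\<close>

lemma pinch_locally_preserved:
  assumes s: "s \<in> I" and x: "x \<in> M" and le: "\<And>y. y \<in> M \<Longrightarrow> pinch y s \<le> 0"
  shows "\<exists>W d. open W \<and> x \<in> W \<and> d > 0 \<and> (\<forall>y\<in>M \<inter> W. \<forall>t\<in>I. s \<le> t \<and> t < s + d \<longrightarrow> pinch y t \<le> 0)"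
proof (cases "pinch x s < 0")
  case True
  obtain O' where O': "open O'" "(\<lambda>q. pinch (fst q) (snd q)) -` {..<0} \<inter> (M \<times> I) = O' \<inter> (M \<times> I)"
    using pinch_continuous[unfolded continuous_on_open_invariant, rule_format, OF open_lessThan[of "0::real"]]
    by (auto simp: Int_commute)
  have "(x, s) \<in> (\<lambda>q. pinch (fst q) (snd q)) -` {..<0} \<inter> (M \<times> I)" using True s x by simp
  then have "(x, s) \<in> O'" unfolding O'(2) by simp
  then obtain W J where "open W" "open J" "(x, s) \<in> W \<times> J" "W \<times> J \<subseteq> O'"
    by (rule open_prod_elim[OF O'(1)])
  then have WJ: "open W" "open J" "x \<in> W" "s \<in> J" "W \<times> J \<subseteq> O'" by auto
  obtain d where d: "d > 0" "ball s d \<subseteq> J" using WJ by (meson open_contains_ball)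
  have "pinch y t \<le> 0" if "y \<in> M \<inter> W" "t \<in> I" "s \<le> t" "t < s + d" for y t
  proof -
    have "t \<in> J" using that d(2) by (auto simp: dist_real_def subset_eq)
    then have "(y, t) \<in> O' \<inter> (M \<times> I)" using that WJ(5) by auto
    then show ?thesis unfolding O'(2)[symmetric] by simp
  qed
  then show ?thesis using WJ d by blast
next
  case False
  then have eq: "pinch x s = 0" using le[OF x] by simp
  obtain U \<phi> u where c: "(U, \<phi>) \<in> \<A>" "u \<in> U" "\<phi> u = x" using chart_cover[OF x] by blast
  interpret fp: flow_param U I "\<lambda>p. X (snd p) (\<phi> (fst p))" "\<lambda>p. \<nu> (snd p) (\<phi> (fst p))" "\<lambda>p. \<kappa> (snd p) (\<phi> (fst p))"
    by (rule chart_flow_param[OF c(1)])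
  define F where "F p = pinch (\<phi> (fst p)) (snd p)" for p
  have F: "Ck_on (Suc 0) F (U \<times> I)"
    using fp.pinching_Ck unfolding F_def[abs_def] pinch_def by simp
  define F' where "F' = dirD (U \<times> I) (0, 1) F"
  have in_M: "\<phi> z \<in> M" if "z \<in> U" for z using chart_subset[OF c(1)] that by auto
  have us: "(u, s) \<in> U \<times> I" using c s by simp
  obtain d where d: "d < 0" "((\<lambda>t. F (u, t)) has_real_derivative d) (at s within I)"
    using fp.pinching_decreasing[OF us] le in_M eq c(3) by (auto simp: pinch_def F_def)
  have "F' (u, s) = d"
    using uniq_diff_deriv_eq[OF uniq_diff_time_interval s Ck_on_time_derivative[OF F c(2) s, unfolded has_vector_derivative_def], of 1]
      uniq_diff_deriv_eq[OF uniq_diff_time_interval s d(2)[unfolded has_field_derivative_def], of 1]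
    by (simp add: F'_def)
  then have neg: "F' (u, s) < 0" using d by simp
  have "continuous_on (U \<times> I) F'"
    unfolding F'_def by (rule Ck_on_imp_continuous[OF Ck_on_dirD[OF F]])
  then obtain e where e0: "e > 0" "\<And>p. p \<in> U \<times> I \<Longrightarrow> dist p (u, s) < e \<Longrightarrow> dist (F' p) (F' (u, s)) < - F' (u, s)"
    using us neg unfolding continuous_on_iff by (meson neg_0_less_iff_less)
  have e: "e > 0" "\<And>p. p \<in> U \<times> I \<Longrightarrow> dist p (u, s) < e \<Longrightarrow> F' p < 0"
    using e0 by (auto simp: dist_real_def abs_less_iff)
  obtain \<psi> where \<psi>: "homeomorphism U (\<phi> ` U) \<phi> \<psi>" using chart_homeomorphism[OF c(1)] by blast
  have "openin (top_of_set (\<phi> ` U)) (\<phi> ` (U \<inter> ball u (e / 2)))"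
    using homeomorphism_imp_open_map[OF \<psi>] by (meson openin_open_Int open_ball)
  then have "openin (top_of_set M) (\<phi> ` (U \<inter> ball u (e / 2)))"
    using chart_image[OF c(1)] openin_trans by blast
  then obtain W where W: "open W" "\<phi> ` (U \<inter> ball u (e / 2)) = M \<inter> W" by (auto simp: openin_open)
  have "u \<in> U \<inter> ball u (e / 2)" using c e by simp
  then have "x \<in> M \<inter> W" using W(2) c(3) by blast
  moreover have "pinch y t \<le> 0" if y: "y \<in> M \<inter> W" and t: "t \<in> I" "s \<le> t" "t < s + e / 2" for y t
  proof -
    obtain z where z: "z \<in> U" "dist u z < e / 2" "y = \<phi> z" using y unfolding W(2)[symmetric] by auto
    have between: "r \<in> I" if "s \<le> r" "r \<le> t" for r
      using time_interval_between[OF t(1)] that s by (auto simp: time_interval_iff)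
    have "F (z, t) \<le> F (z, s)"
    proof (cases "s = t")
      case False
      then have st: "s < t" using t by simp
      have "((\<lambda>r. F (z, r)) has_derivative (\<lambda>h. h *\<^sub>R F' (z, r))) (at r within {s..t})" if "s \<le> r" "r \<le> t" for r
        using Ck_on_time_derivative[OF F z(1) between[OF that]] between
        unfolding has_vector_derivative_def F'_def by (auto intro: has_derivative_subset)
      from mvt_simple[OF st this] obtain r where r: "s < r" "r < t" "F (z, t) - F (z, s) = (t - s) * F' (z, r)" by auto
      have "dist (z, r) (u, s) \<le> dist z u + dist r s"
        by (simp add: dist_Pair_Pair real_sqrt_sum_squares_triangle_ineq sqrt_sum_squares_le_sum)
      also have "\<dots> < e" using z(2) r t(3) by (simp add: dist_commute dist_real_def)
      finally have "F' (z, r) < 0" using e(2) z(1) between r by simp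
      then show ?thesis using r st by (smt (verit) mult_pos_neg)
    qed simp
    also have "F (z, s) \<le> 0" using le in_M[OF z(1)] by (simp add: F_def)
    finally show ?thesis by (simp add: F_def z(3))
  qed
  ultimately show ?thesis using W(1) e(1) by (intro exI[of _ W] exI[of _ "e / 2"]) auto
qed

text \<open>
  The initial hypersurface may touch the boundary of the cone, so there need not be a positive first
  time at which the boundary is reached. Instead, the set of good times is closed and open to the right.
\<close>

lemma pinch_preserved:
  assumes init: "\<And>x. x \<in> M \<Longrightarrow> pinch x 0 \<le> 0" and "t \<in> I" "x \<in> M"
  shows "pinch x t \<le> 0"
proof (rule ccontr)
  assume bad: "\<not> pinch x t \<le> 0"
  define B where "B = {t \<in> I. \<exists>x\<in>M. pinch x t > 0}"
  have "t \<in> B" using bad assms(2,3) by (auto simp: B_def not_le intro!: bexI[of _ x])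
  then have B: "B \<noteq> {}" by auto
  have Bb: "bdd_below B" by (rule bdd_belowI[of _ 0]) (auto simp: B_def time_interval_iff)
  define s where "s = Inf B"
  have lower: "s \<le> r" if "r \<in> B" for r unfolding s_def using that Bb by (rule cInf_lower)
  have "0 \<le> s" unfolding s_def by (rule cInf_greatest[OF B]) (auto simp: B_def time_interval_iff)
  moreover have "s \<le> t" by (rule lower) fact
  ultimately have s: "s \<in> I" "0 \<le> s" using time_interval_between[OF assms(2)] by auto
  \<comment> \<open>The good set is closed: at times before the infimum the inequality holds, and it
    passes to the limit from the left.\<close>
  have le: "pinch y s \<le> 0" if y: "y \<in> M" for y
  proof (cases "s = 0")
    case False
    then have s0: "0 < s" using s by simp
    have "continuous_on I (\<lambda>r. (\<lambda>q. pinch (fst q) (snd q)) (y, r))"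
      by (rule continuous_on_compose2[OF pinch_continuous]) (use y in \<open>auto intro!: continuous_intros\<close>)
    then have "((\<lambda>r. pinch y r) \<longlongrightarrow> pinch y s) (at s within I)" using s(1) by (simp add: continuous_on_def)
    then have "((\<lambda>r. pinch y r) \<longlongrightarrow> pinch y s) (at s within {0..<s})"
      by (rule tendsto_within_subset) (use time_interval_between[OF s(1)] in auto)
    moreover have "\<forall>\<^sub>F r in at s within {0..<s}. pinch y r \<le> 0"
    proof -
      have "pinch y r \<le> 0" if "r \<in> {0..<s}" for r
        using lower[of r] that y time_interval_between[OF s(1), of r] by (force simp: B_def)
      then show ?thesis by (simp add: eventually_at_filter)
    qed
    moreover have "at s within {0..<s} \<noteq> bot"
      using s0 by (simp add: at_within_eq_bot_iff)
    ultimately show ?thesis by (rule tendsto_upperbound)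
  qed (use init y in simp)
  \<comment> \<open>Compactness of \<open>M\<close> makes the forward time step uniform, so that no
    bad time lies within \<open>e\<close> after the infimum.\<close>
  obtain W d where Wd: "\<And>y. y \<in> M \<Longrightarrow> open (W y) \<and> y \<in> W y \<and> d y > 0 \<and>
      (\<forall>z\<in>M \<inter> W y. \<forall>t\<in>I. s \<le> t \<and> t < s + d y \<longrightarrow> pinch z t \<le> 0)"
    using pinch_locally_preserved[OF s(1) _ le] by metis
  obtain C where C: "C \<subseteq> M" "finite C" "M \<subseteq> (\<Union>y\<in>C. W y)"
    by (rule compactE_image[OF compact_M, of M W]) (use Wd in auto)
  have "C \<noteq> {}" using C(3) M_nonempty by auto
  define e where "e = Min (d ` C)"
  have e: "e > 0" unfolding e_def using C \<open>C \<noteq> {}\<close> Wd by (subst Min_gr_iff) auto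
  have "s + e \<le> r" if r: "r \<in> B" for r
  proof (rule ccontr)
    assume less: "\<not> s + e \<le> r"
    obtain z where z: "z \<in> M" "pinch z r > 0" and rI: "r \<in> I" using r by (auto simp: B_def)
    then obtain y where y: "y \<in> C" "z \<in> W y" using C by auto
    have "e \<le> d y" unfolding e_def using C y by (intro Min_le) auto
    then have "r < s + d y" using less by simp
    then have "pinch z r \<le> 0" using Wd[of y] y C z(1) rI lower[OF r] by blast
    then show False using z by simp
  qed
  from cInf_greatest[OF B this] have "s + e \<le> s" by (simp flip: s_def)
  then show False using e by simp
qed

section \<open>Monotonicity of the maximum of \<psi>\<close>

lemma psi_esym: "psi_A_squared k = (esym1 k)\<^sup>2 * (2 * (esym1 k)\<^sup>2 - 6 * esym2 k) / esym3 k"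
  by (simp add: psi_A_squared_def esym1_def esym2_def esym3_def Let_def power2_eq_square algebra_simps)

lemma psi_continuous: "continuous_on (M \<times> I) (\<lambda>q. psi_A_squared (\<kappa> (snd q) (fst q)))"
  unfolding psi_esym
proof (intro continuous_intros esym_continuous_on)
  show "\<forall>q\<in>M \<times> I. esym3 (\<kappa> (snd q) (fst q)) \<noteq> 0" using esym_positive(2) by force
qed

lemma psi_nonneg: "x \<in> M \<Longrightarrow> t \<in> I \<Longrightarrow> psi_A_squared (\<kappa> t x) \<ge> 0"
  using convex by (simp add: strictly_convex_def psi_A_squared_def Let_def less_imp_le)

lemma psi_attains_max:
  assumes "t \<in> I"
  shows "\<exists>x\<in>M. \<forall>y\<in>M. psi_A_squared (\<kappa> t y) \<le> psi_A_squared (\<kappa> t x)"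
proof (rule continuous_attains_sup[OF compact_M M_nonempty])
  have "continuous_on M (\<lambda>x. (\<lambda>q. psi_A_squared (\<kappa> (snd q) (fst q))) (x, t))"
    by (rule continuous_on_compose2[OF psi_continuous]) (use assms in \<open>auto intro!: continuous_intros\<close>)
  then show "continuous_on M (\<lambda>x. psi_A_squared (\<kappa> t x))" by simp
qed

text \<open>Subtracting a small linear function of time gives, at the first time a level is reached,
  a lower bound \<open>e\<close> times \<open>esym3\<close> on the left difference quotients. The
  derivative there is nonpositive by \<open>psi_nonincreasing\<close>, which is a
  contradiction.\<close>

lemma psi_max_nonincreasing:
  assumes init: "\<And>x. x \<in> M \<Longrightarrow> pinch x 0 \<le> 0"
    and t: "t1 \<in> I" "t2 \<in> I" "t1 \<le> t2" and c1: "\<And>x. x \<in> M \<Longrightarrow> psi_A_squared (\<kappa> t1 x) \<le> c1" and x2: "x2 \<in> M"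
  shows "psi_A_squared (\<kappa> t2 x2) \<le> c1"
proof (rule ccontr)
  let ?\<psi> = "\<lambda>x t. psi_A_squared (\<kappa> t x)"
  assume "\<not> ?\<psi> x2 t2 \<le> c1"
  then have gt: "?\<psi> x2 t2 > c1" by simp
  then have t12: "t1 < t2" using c1[OF x2] t(3) by (cases "t1 = t2") auto
  have between: "r \<in> I" if "t1 \<le> r" "r \<le> t2" for r
    using time_interval_between[OF t(2)] that t(1) by (auto simp: time_interval_iff)
  \<comment> \<open>Half of the excess over \<open>c1\<close> is spread over the time interval, so
    the perturbed function still exceeds \<open>c1\<close> at \<open>x2\<close> and
    \<open>t2\<close>.\<close>
  define e where "e = (?\<psi> x2 t2 - c1) / 2 / (t2 - t1)"
  have e: "e > 0" using gt t12 by (simp add: e_def)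
  define f where "f x r = ?\<psi> x r - e * (r - t1)" for x r
  define c where "c = f x2 t2"
  have c: "c > c1"
  proof -
    have "e * (t2 - t1) = (?\<psi> x2 t2 - c1) / 2" using t12 eq_divide_eq[of e "(?\<psi> x2 t2 - c1) / 2" "t2 - t1"] by (simp add: e_def)
    then show ?thesis using gt by (simp add: c_def f_def)
  qed
  have c0: "c > 0" using c c1[OF x2] psi_nonneg[OF x2 t(1)] by simp
  have cont: "continuous_on (M \<times> {t1..t2}) (\<lambda>q. f (fst q) (snd q))"
  proof -
    have "M \<times> {t1..t2} \<subseteq> M \<times> I" using between by auto
    from continuous_on_subset[OF psi_continuous this] show ?thesis
      unfolding f_def by (intro continuous_intros)
  qed
  \<comment> \<open>The points where the level is reached form a compact set, whose projection to
    time has a least element.\<close>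
  define Z where "Z = (M \<times> {t1..t2}) \<inter> (\<lambda>q. f (fst q) (snd q)) -` {c..}"
  have "closedin (top_of_set (M \<times> {t1..t2})) Z"
    unfolding Z_def by (rule continuous_closedin_preimage[OF cont]) simp
  then have "compact Z"
    using closedin_compact compact_Times[OF compact_M compact_Icc] by blast
  then have cZ: "compact (snd ` Z)" by (intro compact_continuous_image continuous_intros)
  have "(x2, t2) \<in> Z" using x2 t12 by (simp add: Z_def c_def)
  then have "snd ` Z \<noteq> {}" by auto
  from compact_attains_inf[OF cZ this] obtain x0 s where
    xs: "(x0, s) \<in> Z" and min: "\<And>x r. (x, r) \<in> Z \<Longrightarrow> s \<le> r" by force
  have x0: "x0 \<in> M" and s12: "t1 \<le> s" "s \<le> t2" and fs: "f x0 s \<ge> c" using xs by (auto simp: Z_def)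
  have sI: "s \<in> I" by (rule between[OF s12])
  have s1: "t1 < s"
  proof (rule ccontr)
    assume "\<not> t1 < s"
    then have "s = t1" using s12 by simp
    then have "f x0 s \<le> c1" using c1[OF x0] by (simp add: f_def)
    then show False using fs c by simp
  qed
  have below: "f x r < c" if "x \<in> M" "t1 \<le> r" "r < s" for x r
    using min[of x r] that s12 by (force simp: Z_def)
  have nb: "at s within {t1..<s} \<noteq> bot" using s1 by (simp add: at_within_eq_bot_iff)
  have at_s: "f x s \<le> c" if x: "x \<in> M" for x
  proof -
    have "continuous_on {t1..t2} (\<lambda>r. (\<lambda>q. f (fst q) (snd q)) (x, r))"
      by (rule continuous_on_compose2[OF cont]) (use x in \<open>auto intro!: continuous_intros\<close>)
    then have "((\<lambda>r. f x r) \<longlongrightarrow> f x s) (at s within {t1..t2})" using s12 by (simp add: continuous_on_def)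
    then have "((\<lambda>r. f x r) \<longlongrightarrow> f x s) (at s within {t1..<s})"
      by (rule tendsto_within_subset) (use s12 in auto)
    moreover have "\<forall>\<^sub>F r in at s within {t1..<s}. f x r \<le> c"
      using below[OF x] by (auto simp: eventually_at_filter less_imp_le)
    ultimately show ?thesis using nb by (rule tendsto_upperbound)
  qed
  define m where "m = c + e * (s - t1)"
  have m0: "m > 0" using c0 e s1 by (simp add: m_def add_pos_nonneg)
  have ms: "?\<psi> x0 s = m" using fs at_s[OF x0] by (simp add: m_def f_def)
  have mx: "?\<psi> x s \<le> m" if "x \<in> M" for x using at_s[OF that] by (simp add: m_def f_def)
  define N where "N x r = (esym1 (\<kappa> r x))\<^sup>2 * (2 * (esym1 (\<kappa> r x))\<^sup>2 - 6 * esym2 (\<kappa> r x))" for x r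
  have N: "N x r = ?\<psi> x r * esym3 (\<kappa> r x)" if "x \<in> M" "r \<in> I" for x r
    using esym_positive(2)[OF that] by (simp add: N_def psi_esym)
  obtain U \<phi> u where ch: "(U, \<phi>) \<in> \<A>" "u \<in> U" "\<phi> u = x0" using chart_cover[OF x0] by blast
  interpret fp: flow_param U I "\<lambda>p. X (snd p) (\<phi> (fst p))" "\<lambda>p. \<nu> (snd p) (\<phi> (fst p))" "\<lambda>p. \<kappa> (snd p) (\<phi> (fst p))"
    by (rule chart_flow_param[OF ch(1)])
  have in_M: "\<phi> z \<in> M" if "z \<in> U" for z using chart_subset[OF ch(1)] that by auto
  have le: "N x s \<le> m * esym3 (\<kappa> s x)" if "x \<in> M" for x
    using mx[OF that] esym_positive(2)[OF that sI] unfolding N[OF that sI] by (simp add: mult_right_mono)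
  have eq: "N x0 s = m * esym3 (\<kappa> s x0)" using ms N[OF x0 sI] by simp
  have cone: "7 * (esym1 (\<kappa> s x0))\<^sup>2 \<le> 25 * esym2 (\<kappa> s x0)"
    using pinch_preserved[OF init sI x0] by (simp add: pinch_def)
  obtain d where d: "d \<le> 0" "((\<lambda>r. N x0 r - m * esym3 (\<kappa> r x0)) has_real_derivative d) (at s within I)"
    using fp.psi_nonincreasing[of u s m] ch sI le in_M eq m0 cone unfolding N_def by auto
  have "((\<lambda>r. N x0 r - m * esym3 (\<kappa> r x0)) has_real_derivative d) (at s within {t1..<s})"
    by (rule DERIV_subset[OF d(2)]) (use between s12 in auto)
  then have lim: "((\<lambda>r. (N x0 r - m * esym3 (\<kappa> r x0) - (N x0 s - m * esym3 (\<kappa> s x0))) / (r - s)) \<longlongrightarrow> d) (at s within {t1..<s})"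
    by (simp add: has_field_derivative_iff)
  have "continuous_on I (\<lambda>r. (\<lambda>q. esym3 (\<kappa> (snd q) (fst q))) (x0, r))"
    by (rule continuous_on_compose2[OF esym_continuous_on(3)]) (use x0 in \<open>auto intro!: continuous_intros\<close>)
  then have "((\<lambda>r. esym3 (\<kappa> r x0)) \<longlongrightarrow> esym3 (\<kappa> s x0)) (at s within I)" using sI by (simp add: continuous_on_def)
  then have "((\<lambda>r. esym3 (\<kappa> r x0)) \<longlongrightarrow> esym3 (\<kappa> s x0)) (at s within {t1..<s})"
    by (rule tendsto_within_subset) (use between s12 in auto)
  then have lim': "((\<lambda>r. e * esym3 (\<kappa> r x0)) \<longlongrightarrow> e * esym3 (\<kappa> s x0)) (at s within {t1..<s})"
    by (intro tendsto_intros)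
  \<comment> \<open>Before \<open>s\<close> the level has not been reached; dividing by the negative
    \<open>r - s\<close> reverses the inequality.\<close>
  have "e * esym3 (\<kappa> r x0) \<le> (N x0 r - m * esym3 (\<kappa> r x0) - (N x0 s - m * esym3 (\<kappa> s x0))) / (r - s)"
    if r: "t1 \<le> r" "r < s" for r
  proof -
    have rI: "r \<in> I" using between r s12 by simp
    have p3: "esym3 (\<kappa> r x0) > 0" by (rule esym_positive(2)[OF x0 rI])
    have "?\<psi> x0 r - m \<le> e * (r - s)"
      using below[OF x0 r] by (simp add: f_def m_def algebra_simps)
    then have "(?\<psi> x0 r - m) * esym3 (\<kappa> r x0) \<le> e * (r - s) * esym3 (\<kappa> r x0)"
      using p3 by (intro mult_right_mono) auto
    then have "N x0 r - m * esym3 (\<kappa> r x0) - (N x0 s - m * esym3 (\<kappa> s x0)) \<le> e * esym3 (\<kappa> r x0) * (r - s)"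
      by (simp add: eq N[OF x0 rI] algebra_simps)
    then show ?thesis using r by (simp add: neg_le_divide_eq)
  qed
  then have "\<forall>\<^sub>F r in at s within {t1..<s}. e * esym3 (\<kappa> r x0) \<le> (N x0 r - m * esym3 (\<kappa> r x0) - (N x0 s - m * esym3 (\<kappa> s x0))) / (r - s)"
    by (simp add: eventually_at_filter)
  from tendsto_le[OF nb lim lim' this] have "e * esym3 (\<kappa> s x0) \<le> d" .
  moreover have "e * esym3 (\<kappa> s x0) > 0" using e esym_positive(2)[OF x0 sI] by simp
  ultimately show False using d(1) by simp
qed

end

text \<open>The difference is a sum of products of nonnegative factors, all of which vanish at (1,
  1, 3), where the bound is sharp.\<close>

lemma pinched_3_cone_sorted:
  fixes a b c :: real
  assumes "0 < a" "a \<le> b" "b \<le> c" "c \<le> 3 * a"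
  shows "7 * (a + b + c)\<^sup>2 \<le> 25 * (a * b + a * c + b * c)"
proof -
  have "25 * (a * b + a * c + b * c) - 7 * (a + b + c)\<^sup>2 =
      7 * ((b - a) * (c - b)) + 4 * ((b - a) * (a + c)) + (3 * a - c) * (7 * c - a)"
    by (simp add: power2_eq_square algebra_simps)
  also have "\<dots> \<ge> 0" using assms by (intro add_nonneg_nonneg mult_nonneg_nonneg) auto
  finally show ?thesis by simp
qed

lemma pinched_3_cone:
  fixes a b c :: real
  assumes "0 < a" "0 < b" "0 < c" "a \<le> 3 * b" "a \<le> 3 * c" "b \<le> 3 * a" "b \<le> 3 * c" "c \<le> 3 * a" "c \<le> 3 * b"
  shows "7 * (a + b + c)\<^sup>2 \<le> 25 * (a * b + a * c + b * c)"
proof -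
  consider "a \<le> b" "b \<le> c" | "a \<le> c" "c \<le> b" | "b \<le> a" "a \<le> c" | "b \<le> c" "c \<le> a" | "c \<le> a" "a \<le> b" | "c \<le> b" "b \<le> a"
    by linarith
  then show ?thesis
    using pinched_3_cone_sorted[of a b c] pinched_3_cone_sorted[of a c b] pinched_3_cone_sorted[of b a c]
      pinched_3_cone_sorted[of b c a] pinched_3_cone_sorted[of c a b] pinched_3_cone_sorted[of c b a] assms
    by cases (simp_all add: add_ac mult_ac)
qed

theorem lemma7p1:
  fixes M :: "'m::t2_space set" and \<A> :: "'m atlas" and T :: ereal
    and X :: "real \<Rightarrow> 'm \<Rightarrow> real^4"
    and \<nu> :: "real \<Rightarrow> 'm \<Rightarrow> real^4"
    and \<kappa> :: "real \<Rightarrow> 'm \<Rightarrow> real^3"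
  assumes "maximal_A_squared_flow M \<A> T X \<nu> \<kappa>"
    and "\<And>t. t \<in> time_interval T \<Longrightarrow> strictly_convex M (\<kappa> t)"
    and "pinched 3 M (\<kappa> 0)"
  shows "\<exists>m :: real \<Rightarrow> real.
    (\<forall>t\<in>time_interval T. m t \<in> (\<lambda>x. psi_A_squared (\<kappa> t x)) ` M \<and>
        (\<forall>x\<in>M. psi_A_squared (\<kappa> t x) \<le> m t)) \<and>
    antimono_on (time_interval T) m"
proof -
  interpret convex_flow M \<A> T X \<nu> \<kappa>
    using assms(1,2) by unfold_locales (auto simp: maximal_A_squared_flow_def)
  have init: "pinch x 0 \<le> 0" if x: "x \<in> M" for x
  proof -
    have p: "\<kappa> 0 x $ i > 0" for i using assms(2)[OF zero_I] x by (simp add: strictly_convex_def)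
    have "\<kappa> 0 x $ i \<le> 3 * \<kappa> 0 x $ j" for i j
    proof -
      have "\<kappa> 0 x $ i / \<kappa> 0 x $ j \<le> 3" using assms(3) x unfolding pinched_def by blast
      then show ?thesis using p[of j] by (simp add: pos_divide_le_eq)
    qed
    then show ?thesis
      using pinched_3_cone[OF p[of 1] p[of 2] p[of 3]] by (simp add: pinch_def esym1_def esym2_def)
  qed
  obtain xm where xm: "\<And>t. t \<in> I \<Longrightarrow> xm t \<in> M" "\<And>t y. t \<in> I \<Longrightarrow> y \<in> M \<Longrightarrow> psi_A_squared (\<kappa> t y) \<le> psi_A_squared (\<kappa> t (xm t))"
    using psi_attains_max by metis
  define m where "m t = psi_A_squared (\<kappa> t (xm t))" for t
  have "antimono_on I m"
  proof (rule monotone_onI)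
    fix t1 t2 assume t: "t1 \<in> I" "t2 \<in> I" "t1 \<le> t2"
    show "m t2 \<le> m t1"
      unfolding m_def by (rule psi_max_nonincreasing[OF init t xm(2)[OF t(1)] xm(1)[OF t(2)]])
  qed
  then show ?thesis using xm by (intro exI[of _ m]) (auto simp: m_def)
qed

end
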